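(* Let $K\ge1$ and for each $i=1,\dots,K$ let $\mathbf V(i)=(Q(i),N^{(1)}(i),\dots,N^{(K)}(i))$ with $Q(i)\ge0$ and $N^{(k)}(i)\in\{0,1,2,\dots\}$ (arbitrary dependence among components). Let $m_{ik}=\mathbb{E}N^{(k)}(i)$, $\mathbf M=(m_{ik})$, and assume the spectral radius of $\mathbf M$ is $<1$. Fix a reference regularly varying tail $\bar F(x)=L(x)x^{-\alpha}$ whose distribution $F$ on $(0,\infty)$ has finite mean. Assume that each $\mathbf V(i)$ satisfies MRV$(F)$ with constant $b(i)\ge0$ and (when $b(i)>0$) angular measure $\mu_i$, and that $b(i)>0$ for at least one $i$. Let $R(1),\dots,R(K)$ be the unique non-negative finite-mean solution of $$R(i)\ \stackrel{\mathcal D}{=}\ Q(i)+\sum_{k=1}^K\sum_{m=1}^{N^{(k)}(i)}R_m(k),\qquad i=1,\dots,K,$$ and $\bar r_i=\mathbb{E}R(i)$ (the unique solution of $\bar r_i=\mathbb{E}Q(i)+\sum_k m_{ik}\bar r_k$). Define, for $a_0,\dots,a_K\ge0$, $$c_i(a_0,\dots,a_K)=b(i)\int_{\mathcal B_{K+1}}(a_0\theta_0+\cdots+a_K\theta_K)^\alpha\,\mu_i(d\theta_0,\dots,d\theta_K)$$ (with $c_i=0$ if $b(i)=0$). Then there are constants $d_1,\dots,d_K$ with $$\mathbb{P}(R(i)>x)\sim d_i\bar F(x)\quad(x\to\infty),\qquad i=1,\dots,K,$$ and $(d_1,\dots,d_K)$ is the unique solution of the linear system $$d_i=c_i(1,\bar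 r_1,\dots,\bar r_K)+\sum_{k=1}^K m_{ik}d_k,\qquad i=1,\dots,K.$$
   Context: In the fixed-point problem, for each fixed $i$ the $R_m(k)$ are mutually independent, independent of $\mathbf V(i)$, with $R_m(k)\stackrel{\mathcal D}{=}R(k)$; only marginal distributions matter. MRV$(F)$: fix a reference tail $\bar F(x)=L(x)x^{-\alpha}$, $\alpha>0$, $L$ slowly varying. For $\mathbf v=(v_1,\dots,v_p)$ let $\|\mathbf v\|=|v_1|+\cdots+|v_p|$ and $\mathcal B_p=\{\mathbf v\in\mathbb{R}^p:\|\mathbf v\|=1\}$. A random vector $\mathbf V\in\mathbb{R}^p$ satisfies MRV$(F)$ if $\mathbb{P}(\|\mathbf V\|>x)\sim b\bar F(x)$ for some constant $b\ge0$ (for $b=0$ this means $\mathbb{P}(\|\mathbf V\|>x)=o(\bar F(x))$), and, when $b>0$, the conditional distribution of $\mathbf V/\|\mathbf V\|$ given $\|\mathbf V\|>x$ converges weakly as $x\to\infty$ to a probability measure $\mu$ on $\mathcal B_p$ (the angular measure). *)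

theory Defs
  imports "HOL-Probability.Probability" "HOL-Library.Landau_Symbols"
begin

definition l1norm :: "real ^ 'p::finite \<Rightarrow> real" where
  "l1norm v = (\<Sum>j\<in>UNIV. \<bar>v $ j\<bar>)"

definition l1sphere :: "(real ^ 'p::finite) set" where
  "l1sphere = {v. l1norm v = 1}"

definition tail :: "real measure \<Rightarrow> real \<Rightarrow> real" where
  "tail F x = measure F {x<..}"

definition slowly_varying :: "(real \<Rightarrow> real) \<Rightarrow> bool" where
  "slowly_varying L \<longleftrightarrow> (\<forall>\<^sub>F x in at_top. L x > 0) \<and>
     (\<forall>c>0. ((\<lambda>x. L (c * x) / L x) \<longlongrightarrow> 1) at_top)"

text \<open>Reference distribution: F on (0,infinity), finite mean, tail L(x) x^(-alpha),
  alpha > 0, L slowly varying (L is forced to be tail F x * x powr alpha).\<close>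
definition ref_tail :: "real measure \<Rightarrow> real \<Rightarrow> bool" where
  "ref_tail F \<alpha> \<longleftrightarrow> prob_space F \<and> sets F = sets borel \<and> measure F {0<..} = 1 \<and>
     integrable F (\<lambda>x. x) \<and> \<alpha> > 0 \<and> slowly_varying (\<lambda>x. tail F x * x powr \<alpha>)"

definition tail_equiv :: "(real \<Rightarrow> real) \<Rightarrow> real \<Rightarrow> (real \<Rightarrow> real) \<Rightarrow> bool" where
  "tail_equiv f b g \<longleftrightarrow>
     (if b = 0 then f \<in> o[at_top](g) else f \<sim>[at_top] (\<lambda>x. b * g x))"

text \<open>MRV(F) for a random vector V on the probability space M with constant b and (when b > 0)
  angular measure mu on the l1 unit sphere.  Weak convergence of the conditional law of
  V/||V|| given ||V|| > x is expressed via bounded continuous test functions.\<close>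
definition MRV :: "real measure \<Rightarrow> 'a measure \<Rightarrow> ('a \<Rightarrow> real ^ 'p::finite) \<Rightarrow> real
                    \<Rightarrow> (real ^ 'p) measure \<Rightarrow> bool" where
  "MRV F M V b \<mu> \<longleftrightarrow> b \<ge> 0 \<and>
     tail_equiv (\<lambda>x. measure M {\<omega> \<in> space M. l1norm (V \<omega>) > x}) b (tail F) \<and>
     (b > 0 \<longrightarrow>
        prob_space \<mu> \<and> sets \<mu> = sets borel \<and> measure \<mu> l1sphere = 1 \<and>
        (\<forall>f :: real ^ 'p \<Rightarrow> real. continuous_on UNIV f \<and> bounded (range f) \<longrightarrow>
           ((\<lambda>x. (\<integral>\<omega>. f (V \<omega> /\<^sub>R l1norm (V \<omega>)) *
                          indicator {\<omega> \<in> space M. l1norm (V \<omega>) > x} \<omega> \<partial>M)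
                  / measure M {\<omega> \<in> space M. l1norm (V \<omega>) > x})
             \<longlongrightarrow> (\<integral>\<theta>. f \<theta> \<partial>\<mu>)) at_top))"

definition spectral_radius :: "real ^ 'n ^ 'n::finite \<Rightarrow> real" where
  "spectral_radius A = Max {cmod l | l. \<exists>v :: complex ^ 'n. v \<noteq> 0 \<and>
       (\<chi> i j. complex_of_real (A $ i $ j)) *v v = l *s v}"

end

theory Submission
  imports Defs "HOL-Real_Asymp.Real_Asymp"
begin

text \<open>
  One application of the fixed-point equation is dominated by three scenarios: the weight vector
  is large and the summands behave like their means (contributing \<open>c\<^sub>i\<close>, by multivariate regular
  variation), or exactly one summand is large (contributing \<open>\<Sum>\<^sub>k m\<^sub>i\<^sub>k\<close> times the tail of \<open>R(k)\<close>);
  everything else is negligible by an exponential-moment bound for truncated sums, or because two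
  independent large jumps are needed.  Since the spectral radius of the mean matrix is below 1, the
  matrix contracts a weighted supremum norm.  This first yields \<open>P(R(i) > x) = O(F(x))\<close> through a
  dominatedly varying envelope of the unknown tails, and then forces the upper and lower limits
  of the tail ratios to agree with the solution of the linear system.
\<close>

section \<open>Non-negative matrices with spectral radius below 1\<close>

text \<open>The obstacle is a circularity. A sharp bound for sums of copies of \<open>R\<close>
  needs a tail majorant that does not grow too fast when its argument shrinks, while a finite mean
  only gives P(R(i) > x) = o(1/x). The majorant is therefore built from the unknown tails
  themselves: the running supremum of u^a times the tail, divided by x^a, obeys such a growth bound
  by construction. Its exponent a = \<alpha> + 1 exceeds the index of the reference tail G, so u^a
  G(u) is almost increasing and the recursion at every u <= x can be compared with x^a G(x). The
  weight solves w = 1 + M w for the mean matrix M, hence M w = w - 1 <= (1 - 1/W) w with W the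
  largest entry. The gap 1/W pays for a slight rescaling of the argument and for the error terms, so
  that the majorant can be absorbed on the left-hand side. For the limit, the same factor acts on
  the error: if the tail ratios eventually stay within t w of the solution d on one side, they stay
  within t' w for every t' > (1 - 1/W) t, so the infimum of the admissible t is 0. Existence of a
  limit is never presupposed.\<close>

lemma det_eq_0_iff_kernel:
  fixes A :: "'a::field ^ 'n ^ 'n"
  shows "det A = 0 \<longleftrightarrow> (\<exists>v. v \<noteq> 0 \<and> A *v v = 0)"
  using invertible_det_nz[of A] invertible_left_inverse[of A] matrix_left_invertible_ker[of A]
  by blast

text \<open>\<open>Max\<close> in \<open>spectral_radius\<close> is meaningful only on a finite set.
  Eigenvalues are the roots of the characteristic polynomial \<open>p\<close>, which is not the zero
  polynomial because it does not vanish at B + 1, where B is the sum of the moduli of all entries: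
  an eigenvector for B + 1 fails at its largest component.\<close>

lemma finite_eigenvalues:
  fixes A :: "complex ^ 'n ^ 'n"
  shows "finite {l. \<exists>v. v \<noteq> 0 \<and> A *v v = l *s v}"
proof -
  define p where "p = det (\<chi> i j. if i = j then [:A$i$j, -1:] else [:A$i$j:])"
  have poly_p: "poly p l = det (\<chi> i j. A$i$j - (if i = j then l else 0))" for l
    unfolding p_def det_def
    unfolding poly_sum poly_mult poly_prod poly_of_int
    by (intro sum.cong prod.cong refl arg_cong2[where f = times]) simp
  have mv: "(\<chi> i j. A$i$j - (if i = j then l else 0)) *v v = A *v v - l *s v" for l v
    by (simp add: vec_eq_iff matrix_vector_mult_def left_diff_distrib sum_subtractf
        if_distrib[of "\<lambda>x. x * _"] cong: if_cong)
  have root_iff: "poly p l = 0 \<longleftrightarrow> (\<exists>v. v \<noteq> 0 \<and> A *v v = l *s v)" for l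
    unfolding poly_p det_eq_0_iff_kernel mv by simp
  define B where "B = (\<Sum>i\<in>UNIV. \<Sum>j\<in>UNIV. cmod (A$i$j))"
  have "B \<ge> 0" unfolding B_def by (intro sum_nonneg) auto
  have "poly p (of_real (B + 1)) \<noteq> 0"
  proof
    assume "poly p (of_real (B + 1)) = 0"
    then obtain v where v: "v \<noteq> 0" "A *v v = of_real (B + 1) *s v" using root_iff by blast
    define c where "c = Max (range (\<lambda>i. cmod (v$i)))"
    have le: "cmod (v$j) \<le> c" for j unfolding c_def by simp
    have "c \<in> range (\<lambda>i. cmod (v$i))" unfolding c_def by (rule Max_in) auto
    then obtain i where i: "c = cmod (v$i)" by auto
    have "c > 0"
    proof (rule ccontr)
      assume "\<not> c > 0"
      hence "cmod (v$j) \<le> 0" for j using le[of j] by linarith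
      hence "v = 0" by (simp add: vec_eq_iff)
      with v show False by simp
    qed
    have "(B + 1) * c = cmod ((of_real (B + 1) *s v) $ i)"
      using \<open>B \<ge> 0\<close> i by (simp add: norm_mult del: of_real_add)
    also have "\<dots> = cmod (\<Sum>j\<in>UNIV. A$i$j * v$j)"
      unfolding v(2)[symmetric] by (simp add: matrix_vector_mult_def)
    also have "\<dots> \<le> (\<Sum>j\<in>UNIV. cmod (A$i$j) * c)"
      by (intro order.trans[OF norm_sum] sum_mono) (auto simp: norm_mult intro: mult_left_mono le)
    also have "\<dots> = (\<Sum>j\<in>UNIV. cmod (A$i$j)) * c" by (simp add: sum_distrib_right)
    also have "\<dots> \<le> B * c"
      unfolding B_def using \<open>c > 0\<close>
      by (intro mult_right_mono member_le_sum[of i UNIV "\<lambda>i. \<Sum>j\<in>UNIV. cmod (A$i$j)"])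
         (auto intro: sum_nonneg)
    finally show False using \<open>c > 0\<close> by (simp add: algebra_simps)
  qed
  hence "p \<noteq> 0" by auto
  hence "finite {l. poly p l = 0}" by (rule poly_roots_finite)
  thus ?thesis unfolding root_iff .
qed

text \<open>A kernel vector of 1 - t A is a real eigenvector of A for 1/t >= 1; read as a complex
  vector it contradicts the spectral radius. The whole range of t is covered because
  \<open>superharmonic_vector\<close> follows a path from t = 0 to t = 1.\<close>

lemma det_id_minus_scaled_nonzero:
  fixes A :: "real ^ 'n ^ 'n"
  assumes spec: "spectral_radius A < 1" and t: "0 \<le> t" "t \<le> 1"
  shows "det (mat 1 - t *\<^sub>R A) \<noteq> 0"
proof
  assume "det (mat 1 - t *\<^sub>R A) = 0"
  then obtain v where v: "v \<noteq> 0" "(mat 1 - t *\<^sub>R A) *v v = 0"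
    using det_eq_0_iff_kernel by blast
  have eq: "v = t *\<^sub>R (A *v v)"
    using v(2) by (simp add: matrix_vector_mult_diff_rdistrib scaleR_matrix_vector_assoc)
  have "t \<noteq> 0" using eq v(1) by auto
  hence "t > 0" using t by simp
  have Av: "A *v v = (1/t) *\<^sub>R v" using arg_cong[OF eq, of "\<lambda>x. (1/t) *\<^sub>R x"] \<open>t > 0\<close> by simp
  define B where "B = (\<chi> i j. complex_of_real (A $ i $ j))"
  define z where "z = (\<chi> i. complex_of_real (v $ i))"
  have "z \<noteq> 0" using v(1) by (auto simp: z_def vec_eq_iff)
  have "B *v z = complex_of_real (1/t) *s z"
  proof -
    have "(B *v z) $ i = complex_of_real ((A *v v) $ i)" for i
      by (simp add: B_def z_def matrix_vector_mult_def)
    thus ?thesis unfolding Av by (simp add: vec_eq_iff z_def)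
  qed
  hence mem: "cmod (complex_of_real (1/t)) \<in> {cmod l | l. \<exists>v. v \<noteq> 0 \<and> B *v v = l *s v}"
    using \<open>z \<noteq> 0\<close> by blast
  have "finite {cmod l | l. \<exists>v. v \<noteq> 0 \<and> B *v v = l *s v}"
    using finite_imageI[OF finite_eigenvalues[of B], of cmod] by (simp add: image_Collect)
  from Max_ge[OF this mem] have "cmod (complex_of_real (1/t)) \<le> spectral_radius A"
    unfolding spectral_radius_def B_def .
  also have "\<dots> < 1" by (rule spec)
  finally have "1/t < 1" using \<open>t > 0\<close> by (simp add: norm_divide)
  thus False using \<open>t > 0\<close> t by simp
qed

text \<open>The solution of \<open>v = 1 + t A v\<close> depends continuously on \<open>t \<in> [0,1]\<close>, and if it is
  non-negative then it is at least 1. Hence the set of such \<open>t\<close> is open and closed.\<close>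
lemma superharmonic_vector:
  fixes A :: "real ^ 'n ^ 'n"
  assumes nonneg: "\<And>i j. A $ i $ j \<ge> 0" and spec: "spectral_radius A < 1"
  obtains w :: "real ^ 'n" where "\<And>i. w $ i \<ge> 1" "\<And>i. w $ i = 1 + (\<Sum>k\<in>UNIV. A $ i $ k * w $ k)"
proof -
  let ?I = "{0..1::real}"
  define E where "E t = mat 1 - t *\<^sub>R A" for t
  \<comment> \<open>Cramer's formula for the solution of (1 - t A) v = 1: each entry is a quotient
    of polynomials in t, which makes continuity immediate.\<close>
  define v where "v t = (\<chi> k. det (\<chi> i j. if j = k then 1 else E t $ i $ j) / det (E t))" for t
  have det: "det (E t) \<noteq> 0" if "t \<in> ?I" for t
    using det_id_minus_scaled_nonzero[OF spec] that by (simp add: E_def)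
  have cont_E: "continuous_on ?I (\<lambda>t. E t $ i $ j)" for i j
    unfolding E_def by (auto intro!: continuous_intros)
  have cont: "continuous_on ?I (\<lambda>t. v t $ k)" for k
    unfolding v_def vec_lambda_beta
  proof (rule continuous_on_divide)
    have "continuous_on ?I (\<lambda>t. if j = k then 1 else E t $ i $ j)" for i j
      by (cases "j = k") (simp_all add: cont_E)
    thus "continuous_on ?I (\<lambda>t. det (\<chi> i j. if j = k then 1 else E t $ i $ j))"
      unfolding det_def vec_lambda_beta by (intro continuous_intros)
    show "continuous_on ?I (\<lambda>t. det (E t))"
      unfolding det_def by (intro continuous_intros cont_E)
  qed (use det in auto)
  have sol: "v t $ i = 1 + t * (\<Sum>k\<in>UNIV. A $ i $ k * v t $ k)" if "t \<in> ?I" for t i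
  proof -
    have "E t *v v t = (\<chi> i. 1)"
      using cramer[OF det[OF that], of "v t" "\<chi> i. 1", unfolded vec_lambda_beta] by (simp add: v_def)
    hence "v t - t *\<^sub>R (A *v v t) = (\<chi> i. 1)"
      unfolding E_def by (simp add: matrix_vector_mult_diff_rdistrib scaleR_matrix_vector_assoc)
    from arg_cong[OF this, of "\<lambda>x. x $ i"] show ?thesis
      by (simp add: matrix_vector_mult_def)
  qed
  have ge1: "v t $ i \<ge> 1" if "t \<in> ?I" "\<forall>k. v t $ k \<ge> 0" for t i
  proof -
    have "0 \<le> t * (\<Sum>k\<in>UNIV. A $ i $ k * v t $ k)"
      using that nonneg by (intro mult_nonneg_nonneg sum_nonneg) auto
    thus ?thesis using sol[OF that(1), of i] by linarith
  qed
  define U where "U = {t \<in> ?I. \<forall>k. v t $ k \<ge> 0}"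
  have U1: "U = (\<Inter>k. ?I \<inter> (\<lambda>t. v t $ k) -` {0..})" by (auto simp: U_def)
  have U2: "U = (\<Inter>k. ?I \<inter> (\<lambda>t. v t $ k) -` {0<..})"
  proof (intro set_eqI iffI)
    fix t assume t: "t \<in> U"
    hence "v t $ k > 0" for k using ge1[of t k] by (simp add: U_def)
    thus "t \<in> (\<Inter>k. ?I \<inter> (\<lambda>t. v t $ k) -` {0<..})" using t by (simp add: U_def)
  qed (auto simp: U_def less_imp_le)
  have "closedin (top_of_set ?I) U"
    unfolding U1 by (intro closedin_Inter) (auto intro: continuous_closedin_preimage[OF cont])
  moreover have "openin (top_of_set ?I) U"
    unfolding U2 by (intro openin_Inter) (auto intro: continuous_openin_preimage_gen[OF cont])
  moreover have "v 0 $ i = 1" for i by (subst sol) auto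
  hence "0 \<in> U" by (simp add: U_def)
  ultimately have "U = ?I"
    using connected_clopen[of ?I] by (metis connected_Icc empty_iff)
  hence "1 \<in> U" by simp
  hence ge: "v 1 $ i \<ge> 1" for i using ge1[of 1 i] by (simp add: U_def)
  have eq: "v 1 $ i = 1 + (\<Sum>k\<in>UNIV. A $ i $ k * v 1 $ k)" for i
    by (subst sol) auto
  show ?thesis by (rule that[OF ge eq])
qed

lemma unique_affine_fixed_point:
  fixes A :: "real ^ 'n ^ 'n"
  assumes spec: "spectral_radius A < 1"
  shows "\<exists>!d. \<forall>i. d i = c i + (\<Sum>k\<in>UNIV. A $ i $ k * d k)"
proof -
  let ?E = "mat 1 - A"
  have "det ?E \<noteq> 0" using det_id_minus_scaled_nonzero[OF spec, of 1] by simp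
  note cr = cramer[OF this, of _ "\<chi> i. c i"]
  have iff: "(\<forall>i. d i = c i + (\<Sum>k\<in>UNIV. A $ i $ k * d k)) \<longleftrightarrow> ?E *v (\<chi> i. d i) = (\<chi> i. c i)" for d
  proof -
    have "(?E *v (\<chi> i. d i)) $ i = d i - (\<Sum>k\<in>UNIV. A $ i $ k * d k)" for i
      by (simp add: matrix_vector_mult_diff_rdistrib) (simp add: matrix_vector_mult_def)
    thus ?thesis by (simp add: vec_eq_iff diff_eq_eq)
  qed
  define d0 where "d0 = (\<chi> k. det (\<chi> i j. if j = k then (\<chi> i. c i) $ i else ?E $ i $ j) / det ?E)"
  have "(\<forall>i. d i = c i + (\<Sum>k\<in>UNIV. A $ i $ k * d k)) \<longleftrightarrow> d = ($) d0" for d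
    unfolding iff cr d0_def[symmetric] by (auto simp: vec_eq_iff fun_eq_iff)
  thus ?thesis by auto
qed

section \<open>Regularly varying tails\<close>

locale regularly_varying_tail =
  fixes G :: "real \<Rightarrow> real" and \<alpha> :: real
  assumes index_pos: "\<alpha> > 0"
    and pos: "\<And>x. G x > 0"
    and antimono: "\<And>x y. x \<le> y \<Longrightarrow> G y \<le> G x"
    and scale: "\<And>c. c > 0 \<Longrightarrow> ((\<lambda>x. G (c * x) / G x) \<longlongrightarrow> c powr - \<alpha>) at_top"
begin

text \<open>One half of Potter's bounds. Doubling u multiplies u^a G(u) by roughly 2^(a - \<alpha>)
  > 1, so these values increase along u, 2u, 4u, ... The first dyadic multiple beyond x is at most
  2x, and monotonicity of G then costs only the factor 2^a.\<close>

lemma potter_bound: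
  assumes a: "\<alpha> < a"
  obtains C x1 where "C > 0" "x1 > 0"
    "\<And>u x. x1 \<le> u \<Longrightarrow> u \<le> x \<Longrightarrow> u powr a * G u \<le> C * (x powr a * G x)"
proof -
  have "2 powr - a < (2::real) powr - \<alpha>" using a by simp
  hence "\<forall>\<^sub>F x in at_top. 2 powr - a < G (2 * x) / G x"
    using order_tendstoD(1)[OF scale[of 2]] by simp
  then obtain x0 where x0: "\<And>x. x \<ge> x0 \<Longrightarrow> 2 powr - a < G (2 * x) / G x"
    by (auto simp: eventually_at_top_linorder)
  define x1 where "x1 = max x0 1"
  have doubling: "u powr a * G u \<le> (2 * u) powr a * G (2 * u)" if "u \<ge> x1" for u
  proof -
    have "u > 0" "u \<ge> x0" using that by (auto simp: x1_def)
    have "2 powr - a * G u < G (2 * u)"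
      using x0[OF \<open>u \<ge> x0\<close>] pos[of u] by (simp add: field_simps)
    hence "G u < 2 powr a * G (2 * u)" by (simp add: powr_minus field_simps)
    hence "u powr a * G u \<le> u powr a * (2 powr a * G (2 * u))" by (intro mult_left_mono) auto
    thus ?thesis using \<open>u > 0\<close> by (simp add: powr_mult mult_ac)
  qed
  have iter: "u powr a * G u \<le> (2 ^ j * u) powr a * G (2 ^ j * u)" if "u \<ge> x1" for u j
  proof (induction j)
    case (Suc j)
    have "u > 0" using that by (auto simp: x1_def)
    have "u \<le> 2 ^ j * u" using \<open>u > 0\<close> by simp
    hence "x1 \<le> 2 ^ j * u" using that by linarith
    from doubling[OF this] Suc show ?case by (simp add: mult_ac)
  qed auto
  show ?thesis
  proof (rule that)
    fix u x assume u: "x1 \<le> u" "u \<le> x"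
    have "u > 0" using u by (auto simp: x1_def)
    obtain j where "x / u < 2 ^ j" using real_arch_pow[of 2 "x / u"] by auto
    hence ex: "x < 2 ^ j * u" using \<open>u > 0\<close> by (simp add: field_simps)
    define J where "J = (LEAST j. x < 2 ^ j * u)"
    have J: "x < 2 ^ J * u" unfolding J_def by (rule LeastI, rule ex)
    have "J \<noteq> 0" using J u by (intro notI) auto
    then obtain i where i: "J = Suc i" using not0_implies_Suc by blast
    have "\<not> x < 2 ^ i * u" using not_less_Least[of i "\<lambda>j. x < 2 ^ j * u"] i by (simp add: J_def)
    hence "2 ^ J * u \<le> 2 * x" unfolding i by simp
    have "u powr a * G u \<le> (2 ^ J * u) powr a * G (2 ^ J * u)" by (rule iter[OF u(1)])
    also have "\<dots> \<le> (2 * x) powr a * G x"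
    proof (rule mult_mono)
      show "(2 ^ J * u) powr a \<le> (2 * x) powr a"
        using \<open>2 ^ J * u \<le> 2 * x\<close> a index_pos \<open>u > 0\<close> by (intro powr_mono2) auto
      show "G (2 ^ J * u) \<le> G x" using J by (intro antimono) auto
    qed (use pos less_imp_le in auto)
    also have "\<dots> = 2 powr a * (x powr a * G x)" using u \<open>u > 0\<close> by (simp add: powr_mult)
    finally show "u powr a * G u \<le> 2 powr a * (x powr a * G x)" .
  qed (auto simp: x1_def)
qed

end

lemma ref_tail_regularly_varying:
  assumes "ref_tail F \<alpha>"
  shows "regularly_varying_tail (tail F) \<alpha>"
proof
  interpret prob_space F using assms by (simp add: ref_tail_def)
  have sets: "sets F = sets borel" using assms by (simp add: ref_tail_def)
  let ?L = "\<lambda>x. tail F x * x powr \<alpha>"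
  have L: "\<forall>\<^sub>F x in at_top. ?L x > 0" "\<And>c. c > 0 \<Longrightarrow> ((\<lambda>x. ?L (c * x) / ?L x) \<longlongrightarrow> 1) at_top"
    using assms by (auto simp: ref_tail_def slowly_varying_def)
  show "\<alpha> > 0" using assms by (simp add: ref_tail_def)
  show antimono: "tail F y \<le> tail F x" if "x \<le> y" for x y
    unfolding tail_def using that by (intro finite_measure_mono) (auto simp: sets)
  show "tail F x > 0" for x
  proof -
    \<comment> \<open>Slow variation gives positivity only eventually; monotonicity carries it back
      to every x.\<close>
    obtain y0 where "\<And>y. y \<ge> y0 \<Longrightarrow> ?L y > 0"
      using L(1) by (auto simp: eventually_at_top_linorder)
    hence "?L (max x y0) > 0" by simp
    hence "tail F (max x y0) > 0" by (simp add: zero_less_mult_iff tail_def)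
    thus ?thesis using antimono[of x "max x y0"] by simp
  qed
  show "((\<lambda>x. tail F (c * x) / tail F x) \<longlongrightarrow> c powr - \<alpha>) at_top" if "c > 0" for c
  proof (rule Lim_transform_eventually)
    show "((\<lambda>x. c powr - \<alpha> * (?L (c * x) / ?L x)) \<longlongrightarrow> c powr - \<alpha>) at_top"
      using tendsto_mult[OF tendsto_const L(2)[OF that]] by simp
    show "\<forall>\<^sub>F x in at_top. c powr - \<alpha> * (?L (c * x) / ?L x) = tail F (c * x) / tail F x"
      using eventually_gt_at_top[of 0] by eventually_elim
        (use that in \<open>simp add: powr_mult powr_minus field_simps\<close>)
  qed
qed

section \<open>Linear functionals of multivariate regularly varying vectors\<close>

lemma continuous_on_l1norm [continuous_intros]:
  "continuous_on A (l1norm :: real ^ 'p::finite \<Rightarrow> real)"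
  unfolding l1norm_def[abs_def] by (intro continuous_intros)

lemma borel_measurable_vec_nth [measurable]:
  "(\<lambda>v. v $ j) \<in> borel_measurable (borel :: (real ^ 'p::finite) measure)"
  by (intro borel_measurable_continuous_onI continuous_intros)

lemma l1norm_measurable [measurable]: "l1norm \<in> borel_measurable borel"
  by (intro borel_measurable_continuous_onI continuous_intros)

lemma l1sphere_sets [measurable]: "(l1sphere :: (real ^ 'p::finite) set) \<in> sets borel"
proof -
  have "{v \<in> space borel. l1norm (v :: real ^ 'p) = 1} \<in> sets borel" by measurable
  thus ?thesis by (simp add: l1sphere_def)
qed

text \<open>Piecewise linear bumps centred at the points \<open>j h\<close>; they sum to 1 on \<open>[0, n h]\<close>.\<close>

definition ramp :: "real \<Rightarrow> nat \<Rightarrow> real \<Rightarrow> real" where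
  "ramp h j t = max 0 (min 1 (t / h - j))"

definition bump :: "real \<Rightarrow> nat \<Rightarrow> real \<Rightarrow> real" where
  "bump h j t = (case j of 0 \<Rightarrow> 1 | Suc i \<Rightarrow> ramp h i t) - ramp h j t"

lemma bump_nonneg: "bump h j t \<ge> 0"
  by (auto simp: bump_def ramp_def split: nat.splits)

lemma bump_le_1: "bump h j t \<le> 1"
  by (auto simp: bump_def ramp_def split: nat.splits)

lemma bump_support:
  assumes "h > 0" "t \<ge> 0" "bump h j t \<noteq> 0"
  shows "(real j - 1) * h < t" "t < (real j + 1) * h"
proof -
  define u where "u = t / h"
  have "u \<ge> 0" using assms by (simp add: u_def)
  hence "real j - 1 < u \<and> u < real j + 1"
    using assms(3) unfolding bump_def ramp_def u_def[symmetric]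
    by (cases j) (auto simp: min_def max_def split: if_splits)
  thus "(real j - 1) * h < t" "t < (real j + 1) * h"
    using assms(1) by (simp_all add: u_def field_simps)
qed

text \<open>The ramps telescope to \<open>1 - ramp h n t\<close>, and the last ramp vanishes up to n
  h.\<close>

lemma sum_bump:
  assumes "h > 0" "0 \<le> t" "t \<le> n * h"
  shows "(\<Sum>j\<le>n. bump h j t) = 1"
proof -
  have "(\<Sum>j\<le>n. bump h j t) = 1 - ramp h n t" by (induction n) (auto simp: bump_def)
  moreover have "t / h \<le> n" using assms by (simp add: field_simps)
  ultimately show ?thesis by (simp add: ramp_def)
qed

lemma continuous_on_bump: "continuous_on A f \<Longrightarrow> h > 0 \<Longrightarrow> continuous_on A (\<lambda>x. bump h j (f x))"
  unfolding bump_def ramp_def by (cases j) (auto intro!: continuous_intros)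

lemma (in regularly_varying_tail) scale_limit:
  assumes "((\<lambda>x. f x / G x) \<longlongrightarrow> l) at_top" "c > 0"
  shows "((\<lambda>x. f (x / c) / G x) \<longlongrightarrow> l * c powr \<alpha>) at_top"
proof -
  have c: "1 / c > 0" using assms by simp
  have "filterlim (\<lambda>x. x / c) at_top at_top"
    using filterlim_tendsto_pos_mult_at_top[OF tendsto_const c filterlim_ident] by simp
  from filterlim_compose[OF assms(1) this]
  have "((\<lambda>x. f (x / c) / G (x / c)) \<longlongrightarrow> l) at_top" .
  from tendsto_mult[OF this scale[OF c]]
  have "((\<lambda>x. f (x / c) / G (x / c) * (G (1 / c * x) / G x)) \<longlongrightarrow> l * c powr \<alpha>) at_top"
    using assms(2) by (simp add: powr_divide powr_minus)
  thus ?thesis using pos[of "_ / c"] by (simp add: less_imp_neq[symmetric])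
qed

text \<open>Merges the little-o case and the asymptotic equivalence into one limit, so that
  vanishing constants can be handled together with positive ones.\<close>

lemma tail_equiv_iff_tendsto:
  assumes "\<And>x. G x > 0"
  shows "tail_equiv f b G \<longleftrightarrow> ((\<lambda>x. f x / G x) \<longlongrightarrow> b) at_top"
proof (cases "b = 0")
  case True
  have nz: "\<forall>\<^sub>F x in at_top. G x \<noteq> 0" using assms by (auto simp: less_imp_neq[symmetric])
  have "f \<in> o[at_top](G) \<longleftrightarrow> ((\<lambda>x. f x / G x) \<longlongrightarrow> 0) at_top"
    using smalloD_tendsto[of f at_top G] smalloI_tendsto[OF _ nz, of f] by blast
  thus ?thesis using True by (simp add: tail_equiv_def)
next
  case False
  have nz: "b * G x \<noteq> 0" for x using False assms[of x] by simp
  have "f \<sim>[at_top] (\<lambda>x. b * G x) \<longleftrightarrow> ((\<lambda>x. f x / (b * G x)) \<longlongrightarrow> 1) at_top"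
    unfolding asymp_equiv_def using nz by simp
  also have "\<dots> \<longleftrightarrow> ((\<lambda>x. f x / G x) \<longlongrightarrow> b) at_top"
  proof
    assume "((\<lambda>x. f x / (b * G x)) \<longlongrightarrow> 1) at_top"
    from tendsto_mult[OF tendsto_const[of b] this] show "((\<lambda>x. f x / G x) \<longlongrightarrow> b) at_top"
      using False by simp
  next
    assume "((\<lambda>x. f x / G x) \<longlongrightarrow> b) at_top"
    from tendsto_mult[OF tendsto_const[of "1 / b"] this] show "((\<lambda>x. f x / (b * G x)) \<longlongrightarrow> 1) at_top"
      using False by simp
  qed
  finally show ?thesis using False by (simp add: tail_equiv_def)
qed

text \<open>The extra 1 keeps the constant positive even for a = 0, so that it can serve as a
  divisor.\<close>

lemma weighted_sum_le:
  fixes a v :: "real ^ 'p::finite"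
  assumes "\<And>j. a $ j \<ge> 0" "\<And>j. v $ j \<ge> 0"
  shows "(\<Sum>j\<in>UNIV. a $ j * v $ j) \<le> ((\<Sum>j\<in>UNIV. a $ j) + 1) * l1norm v"
proof -
  have "a $ j \<le> (\<Sum>j\<in>UNIV. a $ j) + 1" for j
    using member_le_sum[of j UNIV "($) a"] assms(1) by simp
  hence "(\<Sum>j\<in>UNIV. a $ j * v $ j) \<le> (\<Sum>j\<in>UNIV. ((\<Sum>j\<in>UNIV. a $ j) + 1) * v $ j)"
    using assms(2) by (intro sum_mono mult_right_mono) auto
  thus ?thesis using assms(2) by (simp add: l1norm_def sum_distrib_left)
qed

locale mrv_vector = prob_space M + regularly_varying_tail "tail F" \<alpha>
  for M :: "'a measure" and F \<alpha> +
  fixes V :: "'a \<Rightarrow> real ^ 'p::finite" and b :: real and \<mu> :: "(real ^ 'p) measure"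
  assumes MRV: "MRV F M V b \<mu>"
    and V_meas [measurable]: "V \<in> borel_measurable M"
    and V_nonneg: "\<And>\<omega> j. \<omega> \<in> space M \<Longrightarrow> V \<omega> $ j \<ge> 0"
begin

abbreviation "G \<equiv> tail F"
abbreviation "\<Theta> \<omega> \<equiv> V \<omega> /\<^sub>R l1norm (V \<omega>)"
abbreviation "E x \<equiv> {\<omega> \<in> space M. l1norm (V \<omega>) > x}"

lemma b_nonneg: "b \<ge> 0"
  using MRV by (simp add: MRV_def)

lemma norm_tail: "((\<lambda>x. prob (E x) / G x) \<longlongrightarrow> b) at_top"
  using MRV tail_equiv_iff_tendsto[OF pos] by (simp add: MRV_def)

lemma integrable_test:
  fixes f :: "real ^ 'p \<Rightarrow> real"
  assumes "continuous_on UNIV f" "\<And>v. \<bar>f v\<bar> \<le> B"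
  shows "integrable M (\<lambda>\<omega>. f (\<Theta> \<omega>) * indicator (E x) \<omega>)"
proof (rule integrable_const_bound[where B = B])
  have "f \<in> borel_measurable borel" using assms(1) by (rule borel_measurable_continuous_onI)
  thus "(\<lambda>\<omega>. f (\<Theta> \<omega>) * indicator (E x) \<omega>) \<in> borel_measurable M" by measurable
  have "B \<ge> 0" using assms(2) abs_ge_zero order.trans by blast
  thus "AE \<omega> in M. norm (f (\<Theta> \<omega>) * indicator (E x) \<omega>) \<le> B"
    using assms(2) by (auto simp: indicator_def)
qed

text \<open>Expectations taken at different norm thresholds can be added only after a common
  normalisation. The conditional law is therefore multiplied by \<open>prob (E x) / G x\<close>, and
  regular variation turns the threshold x / c into the factor c^\<alpha>.\<close>

lemma test_function_limit:
  fixes f :: "real ^ 'p \<Rightarrow> real"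
  assumes "b > 0" "continuous_on UNIV f" "\<And>v. \<bar>f v\<bar> \<le> B" "c > 0"
  shows "((\<lambda>x. expectation (\<lambda>\<omega>. f (\<Theta> \<omega>) * indicator (E (x / c)) \<omega>) / G x)
    \<longlongrightarrow> b * c powr \<alpha> * (\<integral>\<theta>. f \<theta> \<partial>\<mu>)) at_top"
proof -
  have "bounded (range f)" using assms(3) by (auto simp: bounded_iff)
  hence "((\<lambda>x. expectation (\<lambda>\<omega>. f (\<Theta> \<omega>) * indicator (E x) \<omega>) / prob (E x))
      \<longlongrightarrow> (\<integral>\<theta>. f \<theta> \<partial>\<mu>)) at_top"
    using MRV assms by (simp add: MRV_def)
  from tendsto_mult[OF this norm_tail]
  have lim: "((\<lambda>x. expectation (\<lambda>\<omega>. f (\<Theta> \<omega>) * indicator (E x) \<omega>) / prob (E x) * (prob (E x) / G x))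
      \<longlongrightarrow> (\<integral>\<theta>. f \<theta> \<partial>\<mu>) * b) at_top" .
  have "\<forall>\<^sub>F x in at_top. prob (E x) / G x > 0"
    using order_tendstoD(1)[OF norm_tail assms(1)] .
  hence "((\<lambda>x. expectation (\<lambda>\<omega>. f (\<Theta> \<omega>) * indicator (E x) \<omega>) / G x)
      \<longlongrightarrow> (\<integral>\<theta>. f \<theta> \<partial>\<mu>) * b) at_top"
    by (intro Lim_transform_eventually[OF lim]) (auto elim!: eventually_mono simp: zero_less_divide_iff)
  from scale_limit[OF this assms(4)] show ?thesis by (simp add: mult_ac)
qed

lemma \<mu>_prob: "b > 0 \<Longrightarrow> prob_space \<mu>" and \<mu>_sets: "b > 0 \<Longrightarrow> sets \<mu> = sets borel"
  using MRV by (auto simp: MRV_def)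

text \<open>\<open>MRV\<close> places the angular measure on the sphere but says nothing about
  signs. Since V is non-negative, a test function of the negative parts vanishes at every direction
  of V, and its integral under \<mu> is the limit of zeros.\<close>

lemma AE_\<mu>:
  assumes "b > 0"
  shows "AE \<theta> in \<mu>. l1norm \<theta> = 1 \<and> (\<forall>j. \<theta> $ j \<ge> 0)"
proof -
  interpret \<mu>: prob_space \<mu> by (rule \<mu>_prob[OF assms])
  note [measurable_cong] = \<mu>_sets[OF assms]
  have "AE \<theta> in \<mu>. \<theta> \<in> l1sphere"
    using MRV assms by (subst \<mu>.AE_in_set_eq_1) (auto simp: MRV_def)
  \<comment> \<open>The cap at 1 makes the sum of negative parts an admissible, bounded test
    function without changing its zeros.\<close>
  define f where "f \<theta> = min 1 (\<Sum>j\<in>UNIV. max 0 (- \<theta> $ j))" for \<theta> :: "real ^ 'p"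
  have f0: "0 \<le> f \<theta>" for \<theta> by (simp add: f_def sum_nonneg)
  have fb: "\<bar>f \<theta>\<bar> \<le> 1" for \<theta> using f0[of \<theta>] by (simp add: f_def)
  have cont: "continuous_on UNIV f" unfolding f_def by (intro continuous_intros)
  have "f (\<Theta> \<omega>) = 0" if "\<omega> \<in> space M" for \<omega>
  proof -
    have "\<Theta> \<omega> $ j \<ge> 0" for j
      using V_nonneg[OF that] by (simp add: l1norm_def sum_nonneg)
    hence "max 0 (- \<Theta> \<omega> $ j) = 0" for j by (smt (verit))
    thus ?thesis unfolding f_def by simp
  qed
  hence "expectation (\<lambda>\<omega>. f (\<Theta> \<omega>) * indicator (E (x / 1)) \<omega>) = 0" for x
    by (intro integral_eq_zero_AE AE_I2) auto
  with test_function_limit[OF assms cont fb, of 1]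
  have "((\<lambda>x::real. 0::real) \<longlongrightarrow> b * (\<integral>\<theta>. f \<theta> \<partial>\<mu>)) at_top" by simp
  hence "b * (\<integral>\<theta>. f \<theta> \<partial>\<mu>) = 0"
    using tendsto_unique[OF _ tendsto_const] trivial_limit_at_top_linorder by metis
  hence int0: "(\<integral>\<theta>. f \<theta> \<partial>\<mu>) = 0" using assms by simp
  have [measurable]: "f \<in> borel_measurable \<mu>"
    using borel_measurable_continuous_onI[OF cont] by measurable
  have "integrable \<mu> f" by (rule \<mu>.integrable_const_bound[where B = 1]) (use fb in auto)
  hence "AE \<theta> in \<mu>. f \<theta> = 0"
    using int0 f0 integral_nonneg_eq_0_iff_AE[of \<mu> f] by simp
  thus ?thesis using \<open>AE \<theta> in \<mu>. \<theta> \<in> l1sphere\<close>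
  proof eventually_elim
    case (elim \<theta>)
    hence "(\<Sum>j\<in>UNIV. max 0 (- \<theta> $ j)) = 0" by (simp add: f_def min_def split: if_splits)
    hence "\<forall>j. max 0 (- \<theta> $ j) = 0" by (subst (asm) sum_nonneg_eq_0_iff) auto
    hence "\<theta> $ j \<ge> 0" for j by (metis max.cobounded2 neg_le_0_iff_le)
    with elim show ?case by (simp add: l1sphere_def)
  qed
qed

section \<open>Tail of a linear functional, by slicing the sphere along the values of the
  functional\<close>

context
  fixes a :: "real ^ 'p" and A :: real and g :: "real ^ 'p \<Rightarrow> real"
  assumes a_nonneg: "\<And>j. a $ j \<ge> 0" and b_pos: "b > 0"
  defines "A \<equiv> (\<Sum>j\<in>UNIV. a $ j) + 1" and "g \<equiv> \<lambda>\<theta>. max 0 (min A (\<Sum>j\<in>UNIV. a $ j * \<theta> $ j))"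
begin

lemma A_pos: "A > 0"
  unfolding A_def using a_nonneg by (simp add: add_nonneg_pos sum_nonneg)

lemma g_bounds: "0 \<le> g \<theta>" "g \<theta> \<le> A"
  using A_pos by (auto simp: g_def)

lemma cont_g: "continuous_on B g"
  unfolding g_def by (intro continuous_intros)

lemma bump_g:
  shows "h > 0 \<Longrightarrow> continuous_on UNIV (\<lambda>\<theta>. bump h j (g \<theta>))"
    and "\<bar>bump h j (g \<theta>)\<bar> \<le> 1"
  using bump_nonneg[of h j "g \<theta>"] bump_le_1[of h j "g \<theta>"]
  by (auto intro: continuous_on_bump cont_g)

text \<open>Weak convergence is tested with functions that are bounded on the whole space, hence the
  clipping in \<open>g\<close>. On non-negative directions of norm 1 the clipping is
  invisible.\<close>

lemma g_eq: "l1norm \<theta> = 1 \<Longrightarrow> (\<And>j. \<theta> $ j \<ge> 0) \<Longrightarrow> g \<theta> = (\<Sum>j\<in>UNIV. a $ j * \<theta> $ j)"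
  unfolding g_def using weighted_sum_le[of a \<theta>] a_nonneg by (simp add: sum_nonneg A_def)

lemma weighted_sum_polar:
  assumes "\<omega> \<in> space M" "l1norm (V \<omega>) > 0"
  shows "(\<Sum>j\<in>UNIV. a $ j * V \<omega> $ j) = l1norm (V \<omega>) * g (\<Theta> \<omega>)"
proof -
  have "l1norm (\<Theta> \<omega>) = 1"
    using assms(2) by (simp add: l1norm_def abs_mult flip: sum_distrib_left)
  hence "g (\<Theta> \<omega>) = (\<Sum>j\<in>UNIV. a $ j * \<Theta> \<omega> $ j)"
    using V_nonneg[OF assms(1)] assms(2) by (intro g_eq) auto
  also have "l1norm (V \<omega>) * \<dots> = (\<Sum>j\<in>UNIV. a $ j * V \<omega> $ j)"
    unfolding sum_distrib_left using assms(2) by (intro sum.cong) (auto simp: field_simps)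
  finally show ?thesis ..
qed

lemma integrable_\<mu>:
  fixes f :: "real ^ 'p \<Rightarrow> real"
  assumes "continuous_on UNIV f" "\<And>v. \<bar>f v\<bar> \<le> B"
  shows "integrable \<mu> f"
proof -
  interpret \<mu>: prob_space \<mu> by (rule \<mu>_prob[OF b_pos])
  note [measurable_cong] = \<mu>_sets[OF b_pos]
  show ?thesis
    using borel_measurable_continuous_onI[OF assms(1)] assms(2)
    by (intro \<mu>.integrable_const_bound[where B = B]) auto
qed

text \<open>Where bump j is non-zero, \<open>g\<close> lies between (j - 1) h and (j + 1) h. There
  the event that norm times \<open>g\<close> exceeds x is implied by norm > x / ((j - 1) h) and
  implies norm > x / ((j + 1) h). The parameter \<open>l\<close> selects the end of the slice, hence
  an upper or a lower approximation.\<close>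

definition step_sum :: "nat set \<Rightarrow> real \<Rightarrow> (nat \<Rightarrow> real) \<Rightarrow> real \<Rightarrow> real" where
  "step_sum J h l x = (\<Sum>j\<in>J. expectation (\<lambda>\<omega>. bump h j (g (\<Theta> \<omega>)) * indicator (E (x / l j)) \<omega>))"

lemma step_sum_limit:
  assumes "h > 0" "finite J" "\<And>j. j \<in> J \<Longrightarrow> l j > 0"
  shows "((\<lambda>x. step_sum J h l x / G x) \<longlongrightarrow>
    b * (\<integral>\<theta>. (\<Sum>j\<in>J. l j powr \<alpha> * bump h j (g \<theta>)) \<partial>\<mu>)) at_top"
proof -
  note cont = bump_g(1)[OF assms(1)] and bd = bump_g(2)[of h]
  have "((\<lambda>x. \<Sum>j\<in>J. expectation (\<lambda>\<omega>. bump h j (g (\<Theta> \<omega>)) * indicator (E (x / l j)) \<omega>) / G x)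
      \<longlongrightarrow> (\<Sum>j\<in>J. b * l j powr \<alpha> * (\<integral>\<theta>. bump h j (g \<theta>) \<partial>\<mu>))) at_top"
    by (intro tendsto_sum test_function_limit[OF b_pos cont bd] assms)
  moreover have "(\<integral>\<theta>. (\<Sum>j\<in>J. l j powr \<alpha> * bump h j (g \<theta>)) \<partial>\<mu>) =
      (\<Sum>j\<in>J. l j powr \<alpha> * (\<integral>\<theta>. bump h j (g \<theta>) \<partial>\<mu>))"
    using integrable_\<mu>[OF cont bd] by (subst Bochner_Integration.integral_sum) auto
  ultimately show ?thesis
    by (simp add: step_sum_def sum_divide_distrib sum_distrib_left mult_ac)
qed

lemma tail_le_step_sum:
  assumes "n > 0" "x > 0" defines "h \<equiv> A / n"
  shows "prob {\<omega> \<in> space M. (\<Sum>j\<in>UNIV. a $ j * V \<omega> $ j) > x} \<le> step_sum {..n} h (\<lambda>j. (real j + 1) * h) x"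
proof -
  have h: "h > 0" "n * h = A" using assms A_pos by auto
  note cont = bump_g(1)[OF h(1)] and bd = bump_g(2)[of h]
  let ?S = "{\<omega> \<in> space M. (\<Sum>j\<in>UNIV. a $ j * V \<omega> $ j) > x}"
  have S: "?S \<in> events" by measurable
  have "indicator ?S \<omega> \<le> (\<Sum>j\<le>n. bump h j (g (\<Theta> \<omega>)) * indicator (E (x / ((real j + 1) * h))) \<omega>)"
    if \<omega>: "\<omega> \<in> space M" for \<omega>
  proof (cases "\<omega> \<in> ?S")
    case True
    \<comment> \<open>At norm 0 the quotient \<open>\<Theta> \<omega>\<close> is 0 by the convention
      for division and is not a direction, so the polar form is restricted to positive norm. Here x
      > 0 rules this case out.\<close>
    have "l1norm (V \<omega>) > 0"
    proof (rule ccontr)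
      assume "\<not> l1norm (V \<omega>) > 0"
      hence "A * l1norm (V \<omega>) \<le> 0" using A_pos by (simp add: mult_le_0_iff)
      with weighted_sum_le[of a "V \<omega>"] a_nonneg V_nonneg[OF \<omega>] True \<open>x > 0\<close>
      show False unfolding A_def by force
    qed
    from weighted_sum_polar[OF \<omega> this] True have gt: "l1norm (V \<omega>) * g (\<Theta> \<omega>) > x" by simp
    have "indicator ?S \<omega> = (\<Sum>j\<le>n. bump h j (g (\<Theta> \<omega>)))"
      using True sum_bump[OF h(1), of "g (\<Theta> \<omega>)" n] g_bounds[of "\<Theta> \<omega>"] h(2) by simp
    also have "\<dots> \<le> (\<Sum>j\<le>n. bump h j (g (\<Theta> \<omega>)) * indicator (E (x / ((real j + 1) * h))) \<omega>)"
    proof (intro sum_mono)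
      fix j
      show "bump h j (g (\<Theta> \<omega>)) \<le> bump h j (g (\<Theta> \<omega>)) * indicator (E (x / ((real j + 1) * h))) \<omega>"
      proof (cases "bump h j (g (\<Theta> \<omega>)) = 0")
        case False
        from bump_support(2)[OF h(1) g_bounds(1) False]
        have "l1norm (V \<omega>) * g (\<Theta> \<omega>) < l1norm (V \<omega>) * ((real j + 1) * h)"
          using \<open>l1norm (V \<omega>) > 0\<close> by (intro mult_strict_left_mono)
        hence "x < l1norm (V \<omega>) * ((real j + 1) * h)" using gt by linarith
        hence "x / ((real j + 1) * h) < l1norm (V \<omega>)"
          using h(1) by (subst pos_divide_less_eq) auto
        thus ?thesis using \<omega> by simp
      qed simp
    qed
    finally show ?thesis .
  qed (auto intro!: sum_nonneg simp: bump_nonneg)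
  hence "expectation (indicator ?S) \<le> expectation (\<lambda>\<omega>. \<Sum>j\<le>n. bump h j (g (\<Theta> \<omega>)) * indicator (E (x / ((real j + 1) * h))) \<omega>)"
    by (intro integral_mono Bochner_Integration.integrable_sum integrable_test[OF cont bd]
        integrable_real_indicator S) (simp_all add: emeasure_eq_measure)
  also have "\<dots> = step_sum {..n} h (\<lambda>j. (real j + 1) * h) x"
    unfolding step_sum_def using integrable_test[OF cont bd] by (subst Bochner_Integration.integral_sum) auto
  finally show ?thesis using S by simp
qed

text \<open>Slices 0 and 1 are left out because their lower end (j - 1) h is not positive, which
  gives no usable norm threshold.\<close>

lemma step_sum_le_tail:
  assumes "n > 0" "x > 0" defines "h \<equiv> A / n"
  shows "step_sum {2..n} h (\<lambda>j. (real j - 1) * h) x \<le> prob {\<omega> \<in> space M. (\<Sum>j\<in>UNIV. a $ j * V \<omega> $ j) > x}"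
proof -
  have h: "h > 0" "n * h = A" using assms A_pos by auto
  note cont = bump_g(1)[OF h(1)] and bd = bump_g(2)[of h]
  let ?S = "{\<omega> \<in> space M. (\<Sum>j\<in>UNIV. a $ j * V \<omega> $ j) > x}"
  have S: "?S \<in> events" by measurable
  have "(\<Sum>j\<in>{2..n}. bump h j (g (\<Theta> \<omega>)) * indicator (E (x / ((real j - 1) * h))) \<omega>) \<le> indicator ?S \<omega>"
    if \<omega>: "\<omega> \<in> space M" for \<omega>
  proof -
    have "(\<Sum>j\<in>{2..n}. bump h j (g (\<Theta> \<omega>)) * indicator (E (x / ((real j - 1) * h))) \<omega>)
        \<le> (\<Sum>j\<in>{2..n}. bump h j (g (\<Theta> \<omega>)) * indicator ?S \<omega>)"
    proof (intro sum_mono)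
      fix j assume j: "j \<in> {2..n}"
      show "bump h j (g (\<Theta> \<omega>)) * indicator (E (x / ((real j - 1) * h))) \<omega> \<le> bump h j (g (\<Theta> \<omega>)) * indicator ?S \<omega>"
      proof (cases "bump h j (g (\<Theta> \<omega>)) \<noteq> 0 \<and> \<omega> \<in> E (x / ((real j - 1) * h))")
        case True
        have jh: "(real j - 1) * h > 0" using j h by simp
        hence "x / ((real j - 1) * h) > 0" using \<open>x > 0\<close> by simp
        hence V: "l1norm (V \<omega>) > 0" using True by auto
        have "x < l1norm (V \<omega>) * ((real j - 1) * h)"
          using True jh by (simp add: pos_divide_less_eq)
        also have "\<dots> < l1norm (V \<omega>) * g (\<Theta> \<omega>)"
          using bump_support(1)[OF h(1) g_bounds(1)] True V by (intro mult_strict_left_mono) auto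
        finally have "\<omega> \<in> ?S" using weighted_sum_polar[OF \<omega> V] \<omega> by simp
        thus ?thesis using True by simp
      next
        case False
        thus ?thesis using bump_nonneg[of h j "g (\<Theta> \<omega>)"] by (auto simp: indicator_def)
      qed
    qed
    also have "\<dots> \<le> (\<Sum>j\<le>n. bump h j (g (\<Theta> \<omega>)) * indicator ?S \<omega>)"
      by (intro sum_mono2) (auto simp: bump_nonneg)
    also have "\<dots> = indicator ?S \<omega>"
      using sum_bump[OF h(1), of "g (\<Theta> \<omega>)" n] g_bounds[of "\<Theta> \<omega>"] h(2)
      by (simp flip: sum_distrib_right)
    finally show ?thesis .
  qed
  hence "expectation (\<lambda>\<omega>. \<Sum>j\<in>{2..n}. bump h j (g (\<Theta> \<omega>)) * indicator (E (x / ((real j - 1) * h))) \<omega>) \<le> expectation (indicator ?S)"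
    by (intro integral_mono Bochner_Integration.integrable_sum integrable_test[OF cont bd]
        integrable_real_indicator S) (simp_all add: emeasure_eq_measure)
  moreover have "expectation (\<lambda>\<omega>. \<Sum>j\<in>{2..n}. bump h j (g (\<Theta> \<omega>)) * indicator (E (x / ((real j - 1) * h))) \<omega>)
      = step_sum {2..n} h (\<lambda>j. (real j - 1) * h) x"
    unfolding step_sum_def using integrable_test[OF cont bd] by (subst Bochner_Integration.integral_sum) auto
  ultimately show ?thesis using S by simp
qed

lemma cont_powr_g: "continuous_on UNIV (\<lambda>\<theta>. max 0 (g \<theta> + e) powr \<alpha>)"
  using index_pos by (intro continuous_on_powr' continuous_intros cont_g) auto

lemma powr_g_bound: "\<bar>e\<bar> \<le> e' \<Longrightarrow> \<bar>max 0 (g \<theta> + e) powr \<alpha>\<bar> \<le> (A + e') powr \<alpha>"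
  using g_bounds[of \<theta>] index_pos by (auto intro!: powr_mono2)

text \<open>On the support of bump j, the level (j + 1) h exceeds \<open>g\<close> by less than 2h,
  and the bumps sum to 1.\<close>

lemma step_integral_upper:
  assumes "n > 0" defines "h \<equiv> A / n"
  shows "(\<integral>\<theta>. (\<Sum>j\<in>{..n}. ((real j + 1) * h) powr \<alpha> * bump h j (g \<theta>)) \<partial>\<mu>)
    \<le> (\<integral>\<theta>. max 0 (g \<theta> + 2 * A / n) powr \<alpha> \<partial>\<mu>)"
proof -
  have h: "h > 0" "n * h = A" "2 * A / n = 2 * h" using assms A_pos by auto
  note cont = bump_g(1)[OF h(1)] and bd = bump_g(2)[of h]
  show ?thesis unfolding h(3)
  proof (rule integral_mono)
    show "integrable \<mu> (\<lambda>\<theta>. \<Sum>j\<le>n. ((real j + 1) * h) powr \<alpha> * bump h j (g \<theta>))"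
      using integrable_\<mu>[OF cont bd] by auto
    show "integrable \<mu> (\<lambda>\<theta>. max 0 (g \<theta> + 2 * h) powr \<alpha>)"
      by (rule integrable_\<mu>[OF cont_powr_g powr_g_bound]) auto
    fix \<theta>
    have "(\<Sum>j\<le>n. ((real j + 1) * h) powr \<alpha> * bump h j (g \<theta>)) \<le> (\<Sum>j\<le>n. max 0 (g \<theta> + 2 * h) powr \<alpha> * bump h j (g \<theta>))"
    proof (intro sum_mono)
      fix j
      show "((real j + 1) * h) powr \<alpha> * bump h j (g \<theta>) \<le> max 0 (g \<theta> + 2 * h) powr \<alpha> * bump h j (g \<theta>)"
      proof (cases "bump h j (g \<theta>) = 0")
        case False
        from bump_support(1)[OF h(1) g_bounds(1) False] have "(real j + 1) * h \<le> max 0 (g \<theta> + 2 * h)"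
          by (simp add: algebra_simps)
        thus ?thesis using h index_pos bump_nonneg by (intro mult_right_mono powr_mono2) auto
      qed simp
    qed
    also have "\<dots> = max 0 (g \<theta> + 2 * h) powr \<alpha>"
      using sum_bump[OF h(1), of "g \<theta>" n] g_bounds[of \<theta>] h(2) by (simp flip: sum_distrib_left)
    finally show "(\<Sum>j\<le>n. ((real j + 1) * h) powr \<alpha> * bump h j (g \<theta>)) \<le> max 0 (g \<theta> + 2 * h) powr \<alpha>" .
  qed
qed

text \<open>On the support of bump j, the level (j - 1) h lies at most 2h below \<open>g\<close>.
  The omitted slices 0 and 1 sit where \<open>g\<close> < 2h, and there the positive part of
  \<open>g\<close> - 2h is 0.\<close>

lemma step_integral_lower:
  assumes "n > 0" defines "h \<equiv> A / n"
  shows "(\<integral>\<theta>. max 0 (g \<theta> + - (2 * A / n)) powr \<alpha> \<partial>\<mu>)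
    \<le> (\<integral>\<theta>. (\<Sum>j\<in>{2..n}. ((real j - 1) * h) powr \<alpha> * bump h j (g \<theta>)) \<partial>\<mu>)"
proof -
  have h: "h > 0" "n * h = A" "2 * A / n = 2 * h" using assms A_pos by auto
  note cont = bump_g(1)[OF h(1)] and bd = bump_g(2)[of h]
  show ?thesis unfolding h(3)
  proof (rule integral_mono)
    show "integrable \<mu> (\<lambda>\<theta>. \<Sum>j\<in>{2..n}. ((real j - 1) * h) powr \<alpha> * bump h j (g \<theta>))"
      using integrable_\<mu>[OF cont bd] by auto
    show "integrable \<mu> (\<lambda>\<theta>. max 0 (g \<theta> + - (2 * h)) powr \<alpha>)"
      by (rule integrable_\<mu>[OF cont_powr_g powr_g_bound]) auto
    fix \<theta>
    have zero: "max 0 (g \<theta> + - (2 * h)) powr \<alpha> * bump h j (g \<theta>) = 0" if "j < 2" for j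
    proof (cases "bump h j (g \<theta>) = 0")
      case False
      have "(real j + 1) * h \<le> 2 * h" using that h by (intro mult_right_mono) auto
      with bump_support(2)[OF h(1) g_bounds(1) False] show ?thesis by simp
    qed simp
    have "max 0 (g \<theta> + - (2 * h)) powr \<alpha> = (\<Sum>j\<le>n. max 0 (g \<theta> + - (2 * h)) powr \<alpha> * bump h j (g \<theta>))"
      using sum_bump[OF h(1), of "g \<theta>" n] g_bounds[of \<theta>] h(2) by (simp flip: sum_distrib_left)
    also have "\<dots> = (\<Sum>j\<in>{2..n}. max 0 (g \<theta> + - (2 * h)) powr \<alpha> * bump h j (g \<theta>))"
      by (intro sum.mono_neutral_right ballI zero) auto
    also have "\<dots> \<le> (\<Sum>j\<in>{2..n}. ((real j - 1) * h) powr \<alpha> * bump h j (g \<theta>))"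
    proof (intro sum_mono)
      fix j assume j: "j \<in> {2..n}"
      show "max 0 (g \<theta> + - (2 * h)) powr \<alpha> * bump h j (g \<theta>) \<le> ((real j - 1) * h) powr \<alpha> * bump h j (g \<theta>)"
      proof (cases "bump h j (g \<theta>) = 0")
        case False
        have "0 \<le> (real j - 1) * h" using j h by simp
        with bump_support(2)[OF h(1) g_bounds(1) False]
        have "max 0 (g \<theta> + - (2 * h)) \<le> (real j - 1) * h"
          by (simp add: algebra_simps)
        thus ?thesis using h index_pos bump_nonneg by (intro mult_right_mono powr_mono2) auto
      qed simp
    qed
    finally show "max 0 (g \<theta> + - (2 * h)) powr \<alpha> \<le> (\<Sum>j\<in>{2..n}. ((real j - 1) * h) powr \<alpha> * bump h j (g \<theta>))" .
  qed
qed

lemma integral_powr_g: "(\<integral>\<theta>. max 0 (g \<theta>) powr \<alpha> \<partial>\<mu>) = (\<integral>\<theta>. (\<Sum>j\<in>UNIV. a $ j * \<theta> $ j) powr \<alpha> \<partial>\<mu>)"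
proof (rule integral_cong_AE)
  note [measurable_cong] = \<mu>_sets[OF b_pos]
  show "(\<lambda>\<theta>. (\<Sum>j\<in>UNIV. a $ j * \<theta> $ j) powr \<alpha>) \<in> borel_measurable \<mu>" by measurable
  show "(\<lambda>\<theta>. max 0 (g \<theta>) powr \<alpha>) \<in> borel_measurable \<mu>"
    unfolding g_def by measurable
  show "AE \<theta> in \<mu>. max 0 (g \<theta>) powr \<alpha> = (\<Sum>j\<in>UNIV. a $ j * \<theta> $ j) powr \<alpha>"
    using AE_\<mu>[OF b_pos]
  proof eventually_elim
    case (elim \<theta>)
    thus ?case using g_eq[of \<theta>] g_bounds[of \<theta>] by simp
  qed
qed

lemma integral_powr_g_limit:
  assumes "e \<longlonglongrightarrow> 0"
  shows "(\<lambda>n. \<integral>\<theta>. max 0 (g \<theta> + e n) powr \<alpha> \<partial>\<mu>) \<longlonglongrightarrow> (\<integral>\<theta>. (\<Sum>j\<in>UNIV. a $ j * \<theta> $ j) powr \<alpha> \<partial>\<mu>)"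
  unfolding integral_powr_g[symmetric]
proof -
  interpret \<mu>: prob_space \<mu> by (rule \<mu>_prob[OF b_pos])
  note [measurable_cong] = \<mu>_sets[OF b_pos]
  obtain B where B: "\<And>n. \<bar>e n\<bar> \<le> B"
    using convergent_imp_Bseq[OF convergentI[OF assms]] by (auto simp: Bseq_def)
  show "(\<lambda>n. \<integral>\<theta>. max 0 (g \<theta> + e n) powr \<alpha> \<partial>\<mu>) \<longlonglongrightarrow> (\<integral>\<theta>. max 0 (g \<theta>) powr \<alpha> \<partial>\<mu>)"
  proof (rule integral_dominated_convergence[where w = "\<lambda>_. (A + B) powr \<alpha>"])
    show "(\<lambda>\<theta>. max 0 (g \<theta>) powr \<alpha>) \<in> borel_measurable \<mu>"
      using integrable_\<mu>[OF cont_powr_g[of 0] powr_g_bound] by auto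
    show "(\<lambda>\<theta>. max 0 (g \<theta> + e n) powr \<alpha>) \<in> borel_measurable \<mu>" for n
      using integrable_\<mu>[OF cont_powr_g powr_g_bound] by auto
    show "AE \<theta> in \<mu>. (\<lambda>n. max 0 (g \<theta> + e n) powr \<alpha>) \<longlonglongrightarrow> max 0 (g \<theta>) powr \<alpha>"
    proof (intro AE_I2)
      fix \<theta>
      have "(\<lambda>n. max 0 (g \<theta> + e n) powr \<alpha>) \<longlonglongrightarrow> max 0 (g \<theta> + 0) powr \<alpha>"
        using index_pos by (intro tendsto_powr2 tendsto_intros assms always_eventually) auto
      thus "(\<lambda>n. max 0 (g \<theta> + e n) powr \<alpha>) \<longlonglongrightarrow> max 0 (g \<theta>) powr \<alpha>" by simp
    qed
    show "AE \<theta> in \<mu>. norm (max 0 (g \<theta> + e n) powr \<alpha>) \<le> (A + B) powr \<alpha>" for n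
      using powr_g_bound[OF B] by auto
  qed auto
qed

text \<open>The number n of slices is fixed first, large enough for the slicing error 2A/n to fit
  into the given margin. Only then does x tend to infinity, in a finite sum of known limits.\<close>

lemma weighted_tail_limit_pos:
  "((\<lambda>x. prob {\<omega> \<in> space M. (\<Sum>j\<in>UNIV. a $ j * V \<omega> $ j) > x} / G x)
    \<longlongrightarrow> b * (\<integral>\<theta>. (\<Sum>j\<in>UNIV. a $ j * \<theta> $ j) powr \<alpha> \<partial>\<mu>)) at_top" (is "((\<lambda>x. ?p x / G x) \<longlongrightarrow> ?L) _")
proof (rule order_tendstoI)
  have e: "(\<lambda>n. 2 * A / real n) \<longlonglongrightarrow> 0" by (rule lim_const_over_n)
  fix y assume "?L < y"
  have "(\<lambda>n. b * (\<integral>\<theta>. max 0 (g \<theta> + 2 * A / real n) powr \<alpha> \<partial>\<mu>)) \<longlonglongrightarrow> ?L"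
    by (intro tendsto_mult tendsto_const integral_powr_g_limit e)
  hence "\<forall>\<^sub>F n in sequentially. b * (\<integral>\<theta>. max 0 (g \<theta> + 2 * A / real n) powr \<alpha> \<partial>\<mu>) < y"
    using \<open>?L < y\<close> by (rule order_tendstoD)
  from eventually_conj[OF this eventually_gt_at_top[of 0]]
  obtain n where n: "n > 0" "b * (\<integral>\<theta>. max 0 (g \<theta> + 2 * A / real n) powr \<alpha> \<partial>\<mu>) < y"
    using eventually_happens'[OF sequentially_bot] by blast
  let ?s = "step_sum {..n} (A / n) (\<lambda>j. (real j + 1) * (A / n))"
  have "((\<lambda>x. ?s x / G x) \<longlongrightarrow> b * (\<integral>\<theta>. (\<Sum>j\<in>{..n}. ((real j + 1) * (A / n)) powr \<alpha> * bump (A / n) j (g \<theta>)) \<partial>\<mu>)) at_top"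
    using n A_pos by (intro step_sum_limit) auto
  moreover have "b * (\<integral>\<theta>. (\<Sum>j\<in>{..n}. ((real j + 1) * (A / n)) powr \<alpha> * bump (A / n) j (g \<theta>)) \<partial>\<mu>) < y"
    using step_integral_upper[OF n(1)] b_pos n(2) by (meson le_less_trans mult_left_mono less_imp_le)
  ultimately have "\<forall>\<^sub>F x in at_top. ?s x / G x < y" by (rule order_tendstoD)
  thus "\<forall>\<^sub>F x in at_top. ?p x / G x < y"
    using eventually_gt_at_top[of 0]
  proof eventually_elim
    case (elim x)
    from tail_le_step_sum[OF n(1) elim(2)] have "?p x / G x \<le> ?s x / G x"
      using pos[of x] by (intro divide_right_mono) (auto intro: less_imp_le)
    with elim show ?case by linarith
  qed
next
  have e: "(\<lambda>n. - (2 * A / real n)) \<longlonglongrightarrow> 0" using tendsto_minus[OF lim_const_over_n] by simp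
  fix y assume "y < ?L"
  have "(\<lambda>n. b * (\<integral>\<theta>. max 0 (g \<theta> + - (2 * A / real n)) powr \<alpha> \<partial>\<mu>)) \<longlonglongrightarrow> ?L"
    by (intro tendsto_mult tendsto_const integral_powr_g_limit e)
  hence "\<forall>\<^sub>F n in sequentially. y < b * (\<integral>\<theta>. max 0 (g \<theta> + - (2 * A / real n)) powr \<alpha> \<partial>\<mu>)"
    using \<open>y < ?L\<close> by (rule order_tendstoD)
  from eventually_conj[OF this eventually_gt_at_top[of 0]]
  obtain n where n: "n > 0" "y < b * (\<integral>\<theta>. max 0 (g \<theta> + - (2 * A / real n)) powr \<alpha> \<partial>\<mu>)"
    using eventually_happens'[OF sequentially_bot] by blast
  let ?s = "step_sum {2..n} (A / n) (\<lambda>j. (real j - 1) * (A / n))"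
  have "((\<lambda>x. ?s x / G x) \<longlongrightarrow> b * (\<integral>\<theta>. (\<Sum>j\<in>{2..n}. ((real j - 1) * (A / n)) powr \<alpha> * bump (A / n) j (g \<theta>)) \<partial>\<mu>)) at_top"
    using n A_pos by (intro step_sum_limit) auto
  moreover have "y < b * (\<integral>\<theta>. (\<Sum>j\<in>{2..n}. ((real j - 1) * (A / n)) powr \<alpha> * bump (A / n) j (g \<theta>)) \<partial>\<mu>)"
    using step_integral_lower[OF n(1)] b_pos n(2) by (meson less_le_trans mult_left_mono less_imp_le)
  ultimately have "\<forall>\<^sub>F x in at_top. y < ?s x / G x" by (rule order_tendstoD)
  thus "\<forall>\<^sub>F x in at_top. y < ?p x / G x"
    using eventually_gt_at_top[of 0]
  proof eventually_elim
    case (elim x)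
    from step_sum_le_tail[OF n(1) elim(2)] have "?s x / G x \<le> ?p x / G x"
      using pos[of x] by (intro divide_right_mono) (auto intro: less_imp_le)
    with elim show ?case by linarith
  qed
qed

end

theorem weighted_tail_limit:
  assumes "\<And>j. a $ j \<ge> 0"
  shows "((\<lambda>x. prob {\<omega> \<in> space M. (\<Sum>j\<in>UNIV. a $ j * V \<omega> $ j) > x} / G x)
    \<longlongrightarrow> (if b = 0 then 0 else b * (\<integral>\<theta>. (\<Sum>j\<in>UNIV. a $ j * \<theta> $ j) powr \<alpha> \<partial>\<mu>))) at_top"
proof (cases "b = 0")
  case False
  thus ?thesis using weighted_tail_limit_pos[OF assms] b_nonneg by simp
next
  \<comment> \<open>For b = 0 there is no angular measure to work with; domination by a multiple of
    the norm already gives the limit 0.\<close>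
  case True
  define A where "A = (\<Sum>j\<in>UNIV. a $ j) + 1"
  have "A > 0" unfolding A_def using assms by (simp add: add_nonneg_pos sum_nonneg)
  have "((\<lambda>x. prob (E (x / A)) / G x) \<longlongrightarrow> 0) at_top"
    using scale_limit[OF norm_tail \<open>A > 0\<close>] True by simp
  hence "((\<lambda>x. prob {\<omega> \<in> space M. (\<Sum>j\<in>UNIV. a $ j * V \<omega> $ j) > x} / G x) \<longlongrightarrow> 0) at_top"
  proof (rule tendsto_sandwich[OF _ _ tendsto_const, rotated 2])
    have "prob {\<omega> \<in> space M. (\<Sum>j\<in>UNIV. a $ j * V \<omega> $ j) > x} \<le> prob (E (x / A))" for x
    proof (rule finite_measure_mono)
      show "{\<omega> \<in> space M. (\<Sum>j\<in>UNIV. a $ j * V \<omega> $ j) > x} \<subseteq> E (x / A)"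
      proof safe
        fix \<omega> assume \<omega>: "\<omega> \<in> space M" "x < (\<Sum>j\<in>UNIV. a $ j * V \<omega> $ j)"
        with weighted_sum_le[of a "V \<omega>"] assms V_nonneg[OF \<omega>(1)]
        have "x < A * l1norm (V \<omega>)" unfolding A_def by fastforce
        thus "x / A < l1norm (V \<omega>)" using \<open>A > 0\<close> by (simp add: pos_divide_less_eq mult.commute)
      qed
    qed measurable
    thus "\<forall>\<^sub>F x in at_top. prob {\<omega> \<in> space M. (\<Sum>j\<in>UNIV. a $ j * V \<omega> $ j) > x} / G x \<le> prob (E (x / A)) / G x"
      using pos by (intro always_eventually allI divide_right_mono) (auto intro: less_imp_le)
    show "\<forall>\<^sub>F x in at_top. 0 \<le> prob {\<omega> \<in> space M. (\<Sum>j\<in>UNIV. a $ j * V \<omega> $ j) > x} / G x"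
      using pos by (intro always_eventually allI divide_nonneg_nonneg) (auto intro: less_imp_le)
  qed
  thus ?thesis using True by simp
qed

text \<open>Continuity of the constants c in their coefficients. It allows the perturbations of the
  means and of the threshold in the one-step recursions to be removed at the end.\<close>

lemma angular_integral_limit:
  assumes "b > 0" and lim: "\<And>j. (\<lambda>n. a n $ j) \<longlonglongrightarrow> a0 $ j" and nonneg: "\<And>n j. a n $ j \<ge> 0"
  shows "(\<lambda>n. \<integral>\<theta>. (\<Sum>j\<in>UNIV. a n $ j * \<theta> $ j) powr \<alpha> \<partial>\<mu>) \<longlonglongrightarrow> (\<integral>\<theta>. (\<Sum>j\<in>UNIV. a0 $ j * \<theta> $ j) powr \<alpha> \<partial>\<mu>)"
proof -
  interpret \<mu>: prob_space \<mu> by (rule \<mu>_prob[OF assms(1)])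
  note [measurable_cong] = \<mu>_sets[OF assms(1)]
  have nonneg0: "a0 $ j \<ge> 0" for j
    using LIMSEQ_le_const[OF lim] nonneg by blast
  have "(\<lambda>n. (\<Sum>j\<in>UNIV. a n $ j) + 1) \<longlonglongrightarrow> (\<Sum>j\<in>UNIV. a0 $ j) + 1"
    by (intro tendsto_intros lim)
  hence "Bseq (\<lambda>n. (\<Sum>j\<in>UNIV. a n $ j) + 1)" by (intro convergent_imp_Bseq convergentI)
  then obtain B where B: "\<And>n. \<bar>(\<Sum>j\<in>UNIV. a n $ j) + 1\<bar> \<le> B"
    by (auto simp: Bseq_def)
  show ?thesis
  proof (rule integral_dominated_convergence[where w = "\<lambda>_. B powr \<alpha>"])
    show "AE \<theta> in \<mu>. (\<lambda>n. (\<Sum>j\<in>UNIV. a n $ j * \<theta> $ j) powr \<alpha>) \<longlonglongrightarrow> (\<Sum>j\<in>UNIV. a0 $ j * \<theta> $ j) powr \<alpha>"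
      using AE_\<mu>[OF assms(1)]
    proof eventually_elim
      case (elim \<theta>)
      show ?case using index_pos elim nonneg
        by (intro tendsto_powr2 tendsto_intros lim always_eventually allI sum_nonneg) auto
    qed
    show "AE \<theta> in \<mu>. norm ((\<Sum>j\<in>UNIV. a n $ j * \<theta> $ j) powr \<alpha>) \<le> B powr \<alpha>" for n
      using AE_\<mu>[OF assms(1)]
    proof eventually_elim
      case (elim \<theta>)
      have "(\<Sum>j\<in>UNIV. a n $ j * \<theta> $ j) \<le> B"
        using weighted_sum_le[of "a n" \<theta>] elim nonneg B[of n] by force
      moreover have "0 \<le> (\<Sum>j\<in>UNIV. a n $ j * \<theta> $ j)"
        using elim nonneg by (intro sum_nonneg) auto
      ultimately show ?case using index_pos by (auto intro: powr_mono2)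
    qed
  qed auto
qed

end

section \<open>Deviation bounds for sums of independent variables\<close>

context prob_space
begin

lemma exponential_moment_bound:
  fixes X :: "'i \<Rightarrow> 'a \<Rightarrow> real"
  assumes fin: "finite I" and indep: "indep_vars (\<lambda>_. borel) X I"
    and int: "\<And>i. i \<in> I \<Longrightarrow> integrable M (\<lambda>\<omega>. exp (X i \<omega>))"
    and q: "\<And>i. i \<in> I \<Longrightarrow> expectation (\<lambda>\<omega>. exp (X i \<omega>)) \<le> q"
  shows "prob {\<omega> \<in> space M. (\<Sum>i\<in>I. X i \<omega>) \<ge> t} \<le> exp (-t) * q ^ card I"
proof -
  have indep': "indep_vars (\<lambda>_. borel) (\<lambda>i \<omega>. exp (X i \<omega>)) I"
    by (rule indep_vars_compose2[OF indep]) auto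
  have eq: "exp (\<Sum>i\<in>I. X i \<omega>) = (\<Prod>i\<in>I. exp (X i \<omega>))" for \<omega>
    using fin by (rule exp_sum)
  have int': "integrable M (\<lambda>\<omega>. exp (\<Sum>i\<in>I. X i \<omega>))"
    unfolding eq by (rule indep_vars_integrable[OF fin indep' int])
  have "prob {\<omega> \<in> space M. (\<Sum>i\<in>I. X i \<omega>) \<ge> t}
      \<le> exp (- 1 * t) * (LINT \<omega>:space M|M. exp (1 * (\<Sum>i\<in>I. X i \<omega>)))"
    using int' integrable_mult_indicator[OF sets.top int']
    by (intro Chernoff_ineq_ge) (simp_all add: set_integrable_def)
  also have "\<dots> = exp (-t) * (\<Prod>i\<in>I. expectation (\<lambda>\<omega>. exp (X i \<omega>)))"
    using int' by (simp add: set_integral_space eq indep_vars_lebesgue_integral[OF fin indep' int])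
  also have "\<dots> \<le> exp (-t) * (\<Prod>i\<in>I. q)"
    by (intro mult_left_mono prod_mono conjI q) auto
  finally show ?thesis by simp
qed

text \<open>With only a first moment, Y^2 may fail to be integrable. The quantity Y min(1, s Y)
  replaces s Y^2 as the second-order error in exp(s Y), is dominated by Y, and tends to 0 in mean as
  s does. The absolute value in the last clause lets integrability be stated for every s.\<close>

lemma truncated_first_moment_small:
  fixes Y :: "'a \<Rightarrow> real"
  assumes int: "integrable M Y" and nonneg: "\<And>\<omega>. \<omega> \<in> space M \<Longrightarrow> Y \<omega> \<ge> 0" and "\<epsilon> > 0"
  obtains s0 where "s0 > 0"
    "\<And>s. 0 \<le> s \<Longrightarrow> s \<le> s0 \<Longrightarrow> expectation (\<lambda>\<omega>. Y \<omega> * min 1 (s * Y \<omega>)) \<le> \<epsilon>"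
    "\<And>s. integrable M (\<lambda>\<omega>. Y \<omega> * min 1 (\<bar>s\<bar> * Y \<omega>))"
proof -
  note [measurable] = borel_measurable_integrable[OF int]
  have bound: "norm (Y \<omega> * min 1 (\<bar>s\<bar> * Y \<omega>)) \<le> norm (Y \<omega>)" if "\<omega> \<in> space M" for s \<omega>
    using nonneg[OF that] by (auto simp: abs_mult min_def intro: mult_left_le)
  have int_s: "integrable M (\<lambda>\<omega>. Y \<omega> * min 1 (\<bar>s\<bar> * Y \<omega>))" for s
    by (rule Bochner_Integration.integrable_bound[OF int]) (use bound in \<open>auto intro!: AE_I2\<close>)
  have "(\<lambda>n. expectation (\<lambda>\<omega>. Y \<omega> * min 1 (\<bar>inverse (real (Suc n))\<bar> * Y \<omega>)))
      \<longlonglongrightarrow> expectation (\<lambda>\<omega>. 0)"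
  proof (rule integral_dominated_convergence[where w = "\<lambda>\<omega>. norm (Y \<omega>)"])
    have "(\<lambda>n. y * min 1 (\<bar>inverse (real (Suc n))\<bar> * y)) \<longlonglongrightarrow> y * min 1 (\<bar>0\<bar> * y)" for y
      by (intro tendsto_intros LIMSEQ_inverse_real_of_nat)
    thus "AE \<omega> in M. (\<lambda>n. Y \<omega> * min 1 (\<bar>inverse (real (Suc n))\<bar> * Y \<omega>)) \<longlonglongrightarrow> 0"
      by (intro AE_I2) simp
    show "AE \<omega> in M. norm (Y \<omega> * min 1 (\<bar>inverse (real (Suc n))\<bar> * Y \<omega>)) \<le> norm (Y \<omega>)" for n
      by (intro AE_I2 bound)
  qed (use int in auto)
  hence "\<forall>\<^sub>F n in sequentially. expectation (\<lambda>\<omega>. Y \<omega> * min 1 (\<bar>inverse (real (Suc n))\<bar> * Y \<omega>)) < \<epsilon>"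
    using \<open>\<epsilon> > 0\<close> by (intro order_tendstoD) auto
  then obtain n where n: "expectation (\<lambda>\<omega>. Y \<omega> * min 1 (\<bar>inverse (real (Suc n))\<bar> * Y \<omega>)) < \<epsilon>"
    by (auto simp: eventually_sequentially)
  show ?thesis
  proof (rule that[of "inverse (real (Suc n))", OF _ _ int_s])
    fix s assume s: "0 \<le> s" "s \<le> inverse (real (Suc n))"
    have "expectation (\<lambda>\<omega>. Y \<omega> * min 1 (\<bar>s\<bar> * Y \<omega>))
        \<le> expectation (\<lambda>\<omega>. Y \<omega> * min 1 (\<bar>inverse (real (Suc n))\<bar> * Y \<omega>))"
      using s nonneg by (intro integral_mono int_s mult_left_mono min.mono mult_right_mono) auto
    thus "expectation (\<lambda>\<omega>. Y \<omega> * min 1 (s * Y \<omega>)) \<le> \<epsilon>" using n s by simp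
  qed auto
qed

lemma expectation_cong_distr:
  fixes f :: "real \<Rightarrow> real"
  assumes [measurable]: "random_variable borel X" "random_variable borel Y" "f \<in> borel_measurable borel"
    and "distr M borel X = distr M borel Y"
  shows "expectation (\<lambda>\<omega>. f (X \<omega>)) = expectation (\<lambda>\<omega>. f (Y \<omega>))"
    "integrable M (\<lambda>\<omega>. f (X \<omega>)) \<longleftrightarrow> integrable M (\<lambda>\<omega>. f (Y \<omega>))"
  using integral_distr[of X M borel f] integral_distr[of Y M borel f]
    integrable_distr_eq[of X M borel f] integrable_distr_eq[of Y M borel f] assms by auto

lemma prob_cong_distr:
  fixes X Y :: "'a \<Rightarrow> real"
  assumes [measurable]: "random_variable borel X" "random_variable borel Y" "Measurable.pred borel P"
    and "distr M borel X = distr M borel Y"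
  shows "prob {\<omega> \<in> space M. P (X \<omega>)} = prob {\<omega> \<in> space M. P (Y \<omega>)}"
proof -
  have "measure (distr M borel X) {x. P x} = measure (distr M borel Y) {x. P x}" using assms by simp
  thus ?thesis by (simp add: measure_distr vimage_def Int_def conj_commute)
qed

text \<open>Non-negative variables have finite exponential moments on the negative side, and E
  exp(-s Y) <= exp(-s \<rho>) for small s because \<rho> is below the mean. In the Chernoff bound
  the factor exp(s n \<rho>) then cancels, which makes the estimate uniform in n.\<close>

lemma lower_deviation_bound:
  fixes X :: "nat \<Rightarrow> 'a \<Rightarrow> real" and Y :: "'a \<Rightarrow> real"
  assumes indep: "indep_vars (\<lambda>_. borel) X UNIV"
    and distr: "\<And>n. distr M borel (X n) = distr M borel Y"
    and int: "integrable M Y" and nonneg: "\<And>\<omega>. \<omega> \<in> space M \<Longrightarrow> Y \<omega> \<ge> 0"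
    and \<rho>: "\<rho> < expectation Y"
  obtains s where "s > 0"
    "\<And>n t. prob {\<omega> \<in> space M. (\<Sum>m=1..n. X m \<omega>) \<le> n * \<rho> - t} \<le> exp (- s * t)"
proof -
  have rv[measurable]: "random_variable borel (X n)" for n
    using indep by (simp add: indep_vars_def)
  note [measurable] = borel_measurable_integrable[OF int]
  from \<rho> have "expectation Y - \<rho> > 0" by simp
  from truncated_first_moment_small[OF int nonneg this] obtain s where s: "s > 0"
    "expectation (\<lambda>\<omega>. Y \<omega> * min 1 (s * Y \<omega>)) \<le> expectation Y - \<rho>"
    "integrable M (\<lambda>\<omega>. Y \<omega> * min 1 (s * Y \<omega>))"
    by (metis abs_of_pos order.refl less_imp_le)
  have exp_le: "exp (- v) \<le> 1 - v + v * min 1 v" if "v \<ge> 0" for v :: real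
  proof (cases "v \<le> 1")
    case True
    \<comment> \<open>The product equals 1 + v^3.\<close>
    have "1 \<le> (1 + v) * (1 - v + v * v)" using that by (simp add: algebra_simps)
    also have "\<dots> \<le> exp v * (1 - v + v * v)"
      using that True by (intro mult_right_mono exp_ge_add_one_self) (auto simp: power2_eq_square)
    finally show ?thesis using True by (simp add: exp_minus field_simps)
  next
    case False thus ?thesis by simp
  qed
  have exp_le_1: "exp (- (s * Y \<omega>)) \<le> 1" if "\<omega> \<in> space M" for \<omega>
    using nonneg[OF that] s(1) by simp
  have int_exp: "integrable M (\<lambda>\<omega>. exp (- (s * Y \<omega>)))"
    by (rule integrable_const_bound[where B = 1]) (use exp_le_1 in \<open>auto intro!: AE_I2\<close>)
  have "expectation (\<lambda>\<omega>. exp (- (s * Y \<omega>))) \<le> expectation (\<lambda>\<omega>. 1 - s * Y \<omega> + s * (Y \<omega> * min 1 (s * Y \<omega>)))"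
    using exp_le[of "s * Y _"] nonneg s int int_exp
    by (intro integral_mono) (auto simp: mult.assoc)
  also have "\<dots> = 1 - s * expectation Y + s * expectation (\<lambda>\<omega>. Y \<omega> * min 1 (s * Y \<omega>))"
    using int s(3) by (simp add: prob_space)
  also have "\<dots> \<le> 1 - s * expectation Y + s * (expectation Y - \<rho>)"
    using s by (intro add_left_mono mult_left_mono) auto
  also have "\<dots> = 1 + (- (s * \<rho>))" by (simp add: algebra_simps)
  also have "\<dots> \<le> exp (- (s * \<rho>))" by (rule exp_ge_add_one_self)
  finally have q: "expectation (\<lambda>\<omega>. exp (- (s * Y \<omega>))) \<le> exp (- (s * \<rho>))" .
  have meas: "(\<lambda>x. exp (- (s * x))) \<in> borel_measurable borel" by measurable
  note tr = expectation_cong_distr[OF rv _ meas distr, simplified]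
  show ?thesis
  proof (rule that[OF s(1)])
    fix n t
    have "prob {\<omega> \<in> space M. (\<Sum>m=1..n. X m \<omega>) \<le> n * \<rho> - t}
        = prob {\<omega> \<in> space M. (\<Sum>m=1..n. - (s * X m \<omega>)) \<ge> - (s * (n * \<rho> - t))}"
      using s(1) by (simp add: sum_negf flip: sum_distrib_left)
    also have "\<dots> \<le> exp (- (- (s * (n * \<rho> - t)))) * exp (- (s * \<rho>)) ^ card {1..n}"
    proof (rule exponential_moment_bound)
      show "indep_vars (\<lambda>_. borel) (\<lambda>m \<omega>. - (s * X m \<omega>)) {1..n}"
        by (rule indep_vars_compose2[OF indep_vars_subset[OF indep]]) auto
    qed (use tr int_exp q in auto)
    also have "\<dots> = exp (- s * t)"
      by (simp add: exp_of_nat_mult[symmetric] mult_exp_exp algebra_simps)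
    finally show "prob {\<omega> \<in> space M. (\<Sum>m=1..n. X m \<omega>) \<le> n * \<rho> - t} \<le> exp (- s * t)" .
  qed
qed

text \<open>An inequality of Fuk-Nagaev type. Summands are truncated at y = \<epsilon> x / 2;
  exceeding y is paid for by a union bound of order n \<Gamma>(x). For the truncated sum the
  Chernoff parameter s is tuned so that exp(-s \<epsilon> x) equals the target p = n \<Gamma>(x),
  while s y is only half of the exponent. Each truncated summand is then bounded by p^(-1/2), so the
  large values contribute a bounded factor exp(C1) over all n summands.\<close>

lemma upper_deviation_bound:
  fixes X :: "nat \<Rightarrow> 'a \<Rightarrow> real" and Y :: "'a \<Rightarrow> real" and \<Gamma> :: "real \<Rightarrow> real"
  assumes indep: "indep_vars (\<lambda>_. borel) X UNIV"
    and distr: "\<And>n. distr M borel (X n) = distr M borel Y"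
    and int: "integrable M Y" and nonneg: "\<And>\<omega>. \<omega> \<in> space M \<Longrightarrow> Y \<omega> \<ge> 0"
    and tail: "\<And>u. u > 0 \<Longrightarrow> prob {\<omega> \<in> space M. Y \<omega> > u} \<le> \<Gamma> u"
    and dom: "\<And>x l. x > 0 \<Longrightarrow> l \<ge> 1 \<Longrightarrow> \<Gamma> (x / l) \<le> l powr a * \<Gamma> x"
    and \<Gamma>1: "\<Gamma> 1 > 0" and lim: "((\<lambda>x. x * \<Gamma> x) \<longlongrightarrow> 0) at_top"
    and a: "a > 0" and \<epsilon>: "0 < \<epsilon>" "\<epsilon> \<le> 1"
  obtains C where "C > 0" "\<forall>\<^sub>F x in at_top. \<forall>n. real n \<le> x / \<epsilon> \<longrightarrow>
    prob {\<omega> \<in> space M. (\<Sum>m=1..n. X m \<omega>) > n * (expectation Y + \<epsilon>) + \<epsilon> * x} \<le> C * n * \<Gamma> x"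
proof -
  have rv[measurable]: "random_variable borel (X n)" for n
    using indep by (simp add: indep_vars_def)
  note [measurable] = borel_measurable_integrable[OF int]
  define r where "r = expectation Y"
  obtain s0 where s0: "s0 > 0"
    "\<And>s. 0 \<le> s \<Longrightarrow> s \<le> s0 \<Longrightarrow> expectation (\<lambda>\<omega>. Y \<omega> * min 1 (s * Y \<omega>)) \<le> \<epsilon>"
    "\<And>s. integrable M (\<lambda>\<omega>. Y \<omega> * min 1 (\<bar>s\<bar> * Y \<omega>))"
    using truncated_first_moment_small[OF int nonneg \<epsilon>(1)] by metis
  define C1 where "C1 = (2 * a) powr a / \<epsilon> powr a"
  define C where "C = (2 / \<epsilon>) powr a + exp C1"
  have "C > 0" unfolding C_def by (intro add_nonneg_pos) auto
  have ev1: "\<forall>\<^sub>F x in at_top. x * \<Gamma> x < \<epsilon> * exp (-1)"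
    using \<epsilon> by (intro order_tendstoD[OF lim]) auto
  \<comment> \<open>The numerator bounds the exponent l chosen below; it grows only logarithmically,
    so the Chernoff parameter l / (\<epsilon> x) eventually enters the range where the first-moment
    error is small.\<close>
  have "((\<lambda>x. (a * ln x - ln (\<Gamma> 1)) / (\<epsilon> * x)) \<longlongrightarrow> 0) at_top"
    using \<epsilon>(1) by real_asymp
  hence ev2: "\<forall>\<^sub>F x in at_top. (a * ln x - ln (\<Gamma> 1)) / (\<epsilon> * x) < s0"
    using s0(1) by (intro order_tendstoD)
  show ?thesis
  proof (rule that[OF \<open>C > 0\<close>], use ev1 ev2 eventually_ge_at_top[of 1] in eventually_elim,
      intro allI impI)
    fix x :: real and n :: nat
    assume x: "x * \<Gamma> x < \<epsilon> * exp (-1)" "(a * ln x - ln (\<Gamma> 1)) / (\<epsilon> * x) < s0" "1 \<le> x"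
      and n: "real n \<le> x / \<epsilon>"
    show "prob {\<omega> \<in> space M. (\<Sum>m=1..n. X m \<omega>) > n * (expectation Y + \<epsilon>) + \<epsilon> * x} \<le> C * n * \<Gamma> x"
    proof (cases "n = 0")
      case True
      moreover have "\<not> \<epsilon> * x < 0" using \<epsilon> x by (simp add: not_less)
      ultimately show ?thesis by simp
    next
      case False
      hence n1: "real n \<ge> 1" by simp
      \<comment> \<open>Domination with ratio x itself: \<Gamma> decays at most
        polynomially.\<close>
      have "\<Gamma> 1 \<le> x powr a * \<Gamma> x" using dom[of x x] x by simp
      hence "0 < x powr a * \<Gamma> x" using \<Gamma>1 by linarith
      hence \<Gamma>x: "\<Gamma> x > 0" by (simp add: zero_less_mult_iff)
      define p where "p = n * \<Gamma> x"
      have "p > 0" using n1 \<Gamma>x by (simp add: p_def)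
      have "p \<le> x / \<epsilon> * \<Gamma> x" unfolding p_def using n \<Gamma>x by (intro mult_right_mono) auto
      also have "\<dots> < exp (-1)" using x(1) \<epsilon> by (simp add: field_simps)
      finally have p_lt: "p < exp (-1)" .
      \<comment> \<open>Chosen so that exp(-l) is the target p. Since n <= x / \<epsilon>, p is at
        most x \<Gamma>(x) / \<epsilon>, which is eventually below exp(-1), whence l >= 1.\<close>
      define l where "l = - ln p"
      have "ln p < -1" using p_lt \<open>p > 0\<close> by (metis exp_less_cancel_iff exp_ln)
      hence "l \<ge> 1" by (simp add: l_def)
      have exp_l: "exp (- l) = p" using \<open>p > 0\<close> by (simp add: l_def)
      have "l \<le> - ln (\<Gamma> x)" using n1 \<Gamma>x by (simp add: l_def p_def ln_mult)
      also have "ln (\<Gamma> 1) \<le> ln (x powr a * \<Gamma> x)" using \<open>\<Gamma> 1 \<le> x powr a * \<Gamma> x\<close> \<Gamma>1 by simp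
      hence "- ln (\<Gamma> x) \<le> a * ln x - ln (\<Gamma> 1)" using \<Gamma>x x by (simp add: ln_mult ln_powr)
      finally have l_le: "l \<le> a * ln x - ln (\<Gamma> 1)" .
      define s where "s = l / (\<epsilon> * x)"
      have "s > 0" unfolding s_def using \<open>l \<ge> 1\<close> \<epsilon> x by simp
      have "s \<le> (a * ln x - ln (\<Gamma> 1)) / (\<epsilon> * x)" unfolding s_def using l_le \<epsilon> x
        by (intro divide_right_mono) auto
      hence "s \<le> s0" using x by linarith
      define y where "y = \<epsilon> * x / 2"
      have "y > 0" using \<epsilon> x by (simp add: y_def)
      have sy: "s * y = l / 2" using \<epsilon> x by (simp add: s_def y_def)
      define q where "q = 1 + s * (r + \<epsilon>) + exp (l / 2) * ((l / \<epsilon>) powr a * \<Gamma> x)"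
      \<comment> \<open>If the exponent is at most 1, the quadratic estimate for exp applies.
        Otherwise Y > 1 / s and the truncation bounds the exponential by exp(l / 2).\<close>
      have exp_bd: "exp (s * min (Y \<omega>) y) \<le> 1 + s * Y \<omega> + s * (Y \<omega> * min 1 (\<bar>s\<bar> * Y \<omega>))
          + exp (l / 2) * indicator {\<omega> \<in> space M. Y \<omega> > 1 / s} \<omega>" if "\<omega> \<in> space M" for \<omega>
      proof -
        define v where "v = s * min (Y \<omega>) y"
        have v: "0 \<le> v" "v \<le> s * Y \<omega>" "v \<le> l / 2"
          using nonneg[OF that] \<open>s > 0\<close> \<open>y > 0\<close> sy
          by (auto simp: v_def intro: mult_left_mono simp flip: sy)
        have sY: "0 \<le> s * Y \<omega>" using v by linarith
        show ?thesis
        proof (cases "v \<le> 1")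
          case True
          have "exp v \<le> 1 + v + v * min 1 v" using exp_bound[of v] v True by (simp add: power2_eq_square)
          also have "\<dots> \<le> 1 + s * Y \<omega> + (s * Y \<omega>) * min 1 (s * Y \<omega>)"
            using v sY by (intro add_mono mult_mono) auto
          finally have "exp v \<le> 1 + s * Y \<omega> + s * (Y \<omega> * min 1 (\<bar>s\<bar> * Y \<omega>))"
            using \<open>s > 0\<close> by (simp add: mult.assoc)
          moreover have "0 \<le> exp (l / 2) * indicator {\<omega> \<in> space M. Y \<omega> > 1 / s} \<omega>" by simp
          ultimately show ?thesis unfolding v_def by linarith
        next
          case False
          hence "1 < s * Y \<omega>" using v by linarith
          hence "Y \<omega> > 1 / s" using \<open>s > 0\<close> by (simp add: field_simps)
          hence ind: "indicator {\<omega> \<in> space M. Y \<omega> > 1 / s} \<omega> = (1 :: real)" using that by simp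
          have "exp v \<le> exp (l / 2)" using v by simp
          moreover have "0 \<le> s * (Y \<omega> * min 1 (\<bar>s\<bar> * Y \<omega>))"
            using nonneg[OF that] \<open>s > 0\<close> by (intro mult_nonneg_nonneg) auto
          ultimately show ?thesis using sY unfolding v_def ind by linarith
        qed
      qed
      have tail_s: "prob {\<omega> \<in> space M. Y \<omega> > 1 / s} \<le> (l / \<epsilon>) powr a * \<Gamma> x"
      proof -
        have eq: "1 / s = x / (l / \<epsilon>)" using \<epsilon> x \<open>l \<ge> 1\<close> by (simp add: s_def field_simps)
        have "prob {\<omega> \<in> space M. Y \<omega> > 1 / s} \<le> \<Gamma> (1 / s)" using \<open>s > 0\<close> by (intro tail) simp
        also have "\<dots> \<le> (l / \<epsilon>) powr a * \<Gamma> x"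
          unfolding eq using \<open>l \<ge> 1\<close> \<epsilon> x by (intro dom) (auto simp: field_simps)
        finally show ?thesis .
      qed
      have le1: "exp (s * min (Y \<omega>) y) \<le> exp (l / 2)" for \<omega>
        using \<open>s > 0\<close> by (simp flip: sy)
      have int_exp: "integrable M (\<lambda>\<omega>. exp (s * min (Y \<omega>) y))"
        by (rule integrable_const_bound[where B = "exp (l / 2)"]) (use le1 in auto)
      have int_ind: "integrable M (indicator {\<omega> \<in> space M. Y \<omega> > 1 / s} :: 'a \<Rightarrow> real)"
        by (intro integrable_real_indicator) (auto simp: emeasure_eq_measure)
      have "expectation (\<lambda>\<omega>. exp (s * min (Y \<omega>) y))
          \<le> expectation (\<lambda>\<omega>. 1 + s * Y \<omega> + s * (Y \<omega> * min 1 (\<bar>s\<bar> * Y \<omega>))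
          + exp (l / 2) * indicator {\<omega> \<in> space M. Y \<omega> > 1 / s} \<omega>)"
        using exp_bd s0(3)[of s] int int_exp int_ind by (intro integral_mono) auto
      also have "\<dots> = 1 + s * r + s * expectation (\<lambda>\<omega>. Y \<omega> * min 1 (s * Y \<omega>))
          + exp (l / 2) * prob {\<omega> \<in> space M. Y \<omega> > 1 / s}"
        using s0(3)[of s] int int_ind \<open>s > 0\<close> by (simp add: prob_space r_def)
      also have "\<dots> \<le> 1 + s * r + s * \<epsilon> + exp (l / 2) * ((l / \<epsilon>) powr a * \<Gamma> x)"
        using s0(2)[of s] \<open>s > 0\<close> \<open>s \<le> s0\<close> tail_s by (intro add_mono mult_left_mono) auto
      also have "\<dots> = q" by (simp add: q_def algebra_simps)
      finally have q: "expectation (\<lambda>\<omega>. exp (s * min (Y \<omega>) y)) \<le> q" .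
      have "r \<ge> 0" unfolding r_def using nonneg by (intro integral_nonneg_AE AE_I2)
      have "n * exp (l / 2) * ((l / \<epsilon>) powr a * \<Gamma> x) = exp (- l / 2) * (l powr a / \<epsilon> powr a)"
      proof -
        have "n * exp (l / 2) * ((l / \<epsilon>) powr a * \<Gamma> x) = exp (- l) * exp (l / 2) * (l / \<epsilon>) powr a"
          by (simp add: exp_l p_def)
        also have "exp (- l) * exp (l / 2) = exp (- l / 2)" by (simp add: mult_exp_exp)
        finally show ?thesis using \<open>l \<ge> 1\<close> \<epsilon> by (simp add: powr_divide)
      qed
      \<comment> \<open>The inequality z <= exp z at z = l / (2a), raised to the power a. This is
        the origin of \<open>C1\<close>.\<close>
      also have "l powr a \<le> (2 * a) powr a * exp (l / 2)"
      proof -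
        have "l / (2 * a) \<le> exp (l / (2 * a))"
          using exp_ge_add_one_self[of "l / (2 * a)"] by linarith
        hence "(l / (2 * a)) powr a \<le> exp (l / (2 * a)) powr a"
          using \<open>l \<ge> 1\<close> a by (intro powr_mono2) auto
        thus ?thesis using \<open>l \<ge> 1\<close> a by (simp add: powr_divide exp_powr_real field_simps)
      qed
      hence "exp (- l / 2) * (l powr a / \<epsilon> powr a)
          \<le> exp (- l / 2) * ((2 * a) powr a * exp (l / 2) / \<epsilon> powr a)"
        by (intro mult_left_mono divide_right_mono) auto
      also have "\<dots> = C1" by (simp add: C1_def exp_minus)
      finally have C1: "n * exp (l / 2) * ((l / \<epsilon>) powr a * \<Gamma> x) \<le> C1" .
      have qn: "q ^ n \<le> exp (n * s * (r + \<epsilon>) + C1)"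
      proof -
        have "q \<le> exp (s * (r + \<epsilon>) + exp (l / 2) * ((l / \<epsilon>) powr a * \<Gamma> x))"
          unfolding q_def add.assoc by (rule exp_ge_add_one_self)
        moreover have "q \<ge> 0" unfolding q_def using \<open>s > 0\<close> \<open>r \<ge> 0\<close> \<epsilon> \<Gamma>x by (intro add_nonneg_nonneg) auto
        ultimately have "q ^ n \<le> exp (s * (r + \<epsilon>) + exp (l / 2) * ((l / \<epsilon>) powr a * \<Gamma> x)) ^ n"
          by (intro power_mono)
        also have "\<dots> = exp (n * s * (r + \<epsilon>) + n * exp (l / 2) * ((l / \<epsilon>) powr a * \<Gamma> x))"
          by (simp add: exp_of_nat_mult[symmetric] algebra_simps)
        also have "\<dots> \<le> exp (n * s * (r + \<epsilon>) + C1)" using C1 by simp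
        finally show ?thesis .
      qed
      define t where "t = n * (r + \<epsilon>) + \<epsilon> * x"
      have meas: "(\<lambda>z. exp (s * min z y)) \<in> borel_measurable borel" by measurable
      note tr = expectation_cong_distr[OF rv _ meas distr, simplified]
      have trunc: "prob {\<omega> \<in> space M. (\<Sum>m=1..n. s * min (X m \<omega>) y) \<ge> s * t} \<le> exp C1 * p"
      proof -
        have "prob {\<omega> \<in> space M. (\<Sum>m=1..n. s * min (X m \<omega>) y) \<ge> s * t} \<le> exp (- (s * t)) * q ^ card {1..n}"
        proof (rule exponential_moment_bound)
          show "indep_vars (\<lambda>_. borel) (\<lambda>m \<omega>. s * min (X m \<omega>) y) {1..n}"
            by (rule indep_vars_compose2[OF indep_vars_subset[OF indep]]) auto
        qed (use tr int_exp q in auto)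
        also have "\<dots> \<le> exp (- (s * t)) * exp (n * s * (r + \<epsilon>) + C1)"
          using qn by simp
        also have "\<dots> = exp (C1 - s * (\<epsilon> * x))" by (simp add: mult_exp_exp t_def algebra_simps)
        also have "s * (\<epsilon> * x) = l" using \<epsilon> x by (simp add: s_def)
        also have "exp (C1 - l) = exp C1 * p" using exp_l by (simp add: exp_diff exp_minus field_simps)
        finally show ?thesis .
      qed
      have big: "prob {\<omega> \<in> space M. X m \<omega> > y} \<le> (2 / \<epsilon>) powr a * \<Gamma> x" for m
      proof -
        have "prob {\<omega> \<in> space M. X m \<omega> > y} = prob {\<omega> \<in> space M. Y \<omega> > y}"
          by (rule prob_cong_distr) (use distr in auto)
        also have "\<dots> \<le> \<Gamma> (x / (2 / \<epsilon>))" using tail[OF \<open>y > 0\<close>] \<epsilon> by (simp add: y_def field_simps)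
        also have "\<dots> \<le> (2 / \<epsilon>) powr a * \<Gamma> x" using x \<epsilon> by (intro dom) auto
        finally show ?thesis .
      qed
      have "prob {\<omega> \<in> space M. (\<Sum>m=1..n. X m \<omega>) > t}
          \<le> prob ((\<Union>m\<in>{1..n}. {\<omega> \<in> space M. X m \<omega> > y}) \<union> {\<omega> \<in> space M. (\<Sum>m=1..n. s * min (X m \<omega>) y) \<ge> s * t})"
      proof (rule finite_measure_mono)
        show "{\<omega> \<in> space M. t < (\<Sum>m=1..n. X m \<omega>)}
          \<subseteq> (\<Union>m\<in>{1..n}. {\<omega> \<in> space M. X m \<omega> > y}) \<union> {\<omega> \<in> space M. s * t \<le> (\<Sum>m=1..n. s * min (X m \<omega>) y)}"
        proof (intro subsetI UnCI)
          fix \<omega> assume \<omega>: "\<omega> \<in> {\<omega> \<in> space M. t < (\<Sum>m=1..n. X m \<omega>)}"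
            and not: "\<omega> \<notin> {\<omega> \<in> space M. s * t \<le> (\<Sum>m=1..n. s * min (X m \<omega>) y)}"
          show "\<omega> \<in> (\<Union>m\<in>{1..n}. {\<omega> \<in> space M. X m \<omega> > y})"
          proof (rule ccontr)
            assume "\<omega> \<notin> (\<Union>m\<in>{1..n}. {\<omega> \<in> space M. X m \<omega> > y})"
            \<comment> \<open>When no summand exceeds y the truncation changes nothing, so the
              truncated sum would have to be large as well.\<close>
            hence "(\<Sum>m=1..n. s * min (X m \<omega>) y) = (\<Sum>m=1..n. s * X m \<omega>)"
              using \<omega> by (intro sum.cong) (auto simp: not_less)
            also have "\<dots> = s * (\<Sum>m=1..n. X m \<omega>)" by (simp add: sum_distrib_left)
            finally show False using \<omega> not \<open>s > 0\<close> by simp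
          qed
        qed
      qed measurable
      also have "\<dots> \<le> prob (\<Union>m\<in>{1..n}. {\<omega> \<in> space M. X m \<omega> > y})
          + prob {\<omega> \<in> space M. (\<Sum>m=1..n. s * min (X m \<omega>) y) \<ge> s * t}"
        by (intro measure_Un_le) measurable
      also have "\<dots> \<le> (\<Sum>m\<in>{1..n}. prob {\<omega> \<in> space M. X m \<omega> > y}) + exp C1 * p"
        by (intro add_mono trunc finite_measure_subadditive_finite) auto
      also have "\<dots> \<le> (\<Sum>m\<in>{1..n}. (2 / \<epsilon>) powr a * \<Gamma> x) + exp C1 * p"
        by (intro add_mono sum_mono big) auto
      also have "\<dots> = C * n * \<Gamma> x" by (simp add: C_def p_def algebra_simps)
      finally show ?thesis unfolding t_def r_def .
    qed
  qed
qed

end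

section \<open>The branching fixed-point equation\<close>

definition weight_vector :: "('k::finite \<Rightarrow> 'a \<Rightarrow> real) \<Rightarrow> ('k \<Rightarrow> 'k \<Rightarrow> 'a \<Rightarrow> nat) \<Rightarrow> 'k \<Rightarrow> 'a \<Rightarrow> real ^ 'k option" where
  "weight_vector Q N i \<omega> = (\<chi> j. case j of None \<Rightarrow> Q i \<omega> | Some k \<Rightarrow> real (N i k \<omega>))"

lemma sum_UNIV_option: "(\<Sum>j\<in>(UNIV :: 'k::finite option set). f j) = f None + (\<Sum>k\<in>UNIV. f (Some k))"
  by (simp add: UNIV_option_conv sum.reindex)

section \<open>General facts on unions of events, truncated means and tails\<close>

context prob_space
begin

text \<open>A Bonferroni inequality, with the square of the cardinality as a generous count of the
  pairs.\<close>

lemma prob_Union_ge: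
  assumes "finite J" "\<And>p. p \<in> J \<Longrightarrow> D p \<in> events"
    "\<And>p q. p \<in> J \<Longrightarrow> q \<in> J \<Longrightarrow> p \<noteq> q \<Longrightarrow> prob (D p \<inter> D q) \<le> z" "z \<ge> 0"
  shows "(\<Sum>p\<in>J. prob (D p)) - (real (card J))\<^sup>2 * z \<le> prob (\<Union>p\<in>J. D p)"
  using assms
proof (induction J rule: finite_induct)
  case (insert p J)
  have "prob (D p \<inter> (\<Union>q\<in>J. D q)) = prob (\<Union>q\<in>J. D p \<inter> D q)"
    by (rule arg_cong[where f = prob]) blast
  also have "\<dots> \<le> (\<Sum>q\<in>J. prob (D p \<inter> D q))"
    using insert.prems by (intro finite_measure_subadditive_finite) (auto simp: insert.hyps)
  also have "\<dots> \<le> (\<Sum>q\<in>J. z)" using insert by (intro sum_mono insert.prems(2)) auto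
  finally have int: "prob (D p \<inter> (\<Union>q\<in>J. D q)) \<le> card J * z" by simp
  have "prob (D p \<union> (\<Union>q\<in>J. D q)) = prob (D p) + prob (\<Union>q\<in>J. D q) - prob (D p \<inter> (\<Union>q\<in>J. D q))"
    using insert.prems insert.hyps by (intro measure_Un3) (auto simp: fmeasurable_eq_sets)
  moreover have "(\<Sum>p\<in>J. prob (D p)) - (real (card J))\<^sup>2 * z \<le> prob (\<Union>p\<in>J. D p)"
    using insert by auto
  moreover have "(real (card J))\<^sup>2 * z + card J * z \<le> (real (card (insert p J)))\<^sup>2 * z"
    using insert.hyps \<open>z \<ge> 0\<close> by (simp add: power2_eq_square algebra_simps)
  ultimately show ?case using int insert.hyps by simp
qed auto

text \<open>Truncated layer-cake formula. It is how the mean number of summands emerges from the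
  single-jump events indexed by n in the lower bound.\<close>

lemma sum_prob_ge:
  assumes [measurable]: "X \<in> measurable M (count_space UNIV)"
  shows "(\<Sum>j=1..n. prob {\<omega> \<in> space M. X \<omega> \<ge> j}) = expectation (\<lambda>\<omega>. real (min (X \<omega>) n))"
proof -
  have "(\<Sum>j=1..n. prob {\<omega> \<in> space M. X \<omega> \<ge> j})
      = expectation (\<lambda>\<omega>. \<Sum>j=1..n. indicator {\<omega> \<in> space M. X \<omega> \<ge> j} \<omega>)"
    by (subst Bochner_Integration.integral_sum)
       (auto simp: emeasure_eq_measure intro!: integrable_real_indicator)
  also have "\<dots> = expectation (\<lambda>\<omega>. real (min (X \<omega>) n))"
  proof (rule Bochner_Integration.integral_cong)
    fix \<omega> assume "\<omega> \<in> space M"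
    hence "(\<Sum>j=1..n. indicator {\<omega> \<in> space M. X \<omega> \<ge> j} \<omega>) = (\<Sum>j=1..n. if j \<in> {1..X \<omega>} then 1 else 0 :: real)"
      by (intro sum.cong) auto
    also have "\<dots> = (\<Sum>j\<in>{1..n} \<inter> {1..X \<omega>}. 1)" by (rule sum.inter_restrict[symmetric]) simp
    also have "{1..n} \<inter> {1..X \<omega>} = {1..min (X \<omega>) n}" by auto
    finally show "(\<Sum>j=1..n. indicator {\<omega> \<in> space M. X \<omega> \<ge> j} \<omega>) = real (min (X \<omega>) n)" by simp
  qed auto
  finally show ?thesis .
qed

lemma expectation_tail_tendsto_0:
  fixes X :: "'a \<Rightarrow> nat"
  assumes [measurable]: "\<And>n. W n \<in> events" and int: "integrable M (\<lambda>\<omega>. real (X \<omega>))"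
    and ev: "\<And>\<omega>. \<omega> \<in> space M \<Longrightarrow> \<forall>\<^sub>F n in sequentially. \<omega> \<notin> W n"
  shows "(\<lambda>n. expectation (\<lambda>\<omega>. real (X \<omega>) * indicator (W n) \<omega>)) \<longlonglongrightarrow> 0"
proof -
  have [measurable]: "(\<lambda>\<omega>. real (X \<omega>)) \<in> borel_measurable M" using int by auto
  have "(\<lambda>n. expectation (\<lambda>\<omega>. real (X \<omega>) * indicator (W n) \<omega>)) \<longlonglongrightarrow> expectation (\<lambda>_. 0)"
  proof (rule integral_dominated_convergence[where w = "\<lambda>\<omega>. real (X \<omega>)"])
    show "AE \<omega> in M. (\<lambda>n. real (X \<omega>) * indicator (W n) \<omega>) \<longlonglongrightarrow> 0"
    proof (intro AE_I2 tendsto_eventually)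
      fix \<omega> assume "\<omega> \<in> space M"
      from ev[OF this] show "\<forall>\<^sub>F n in sequentially. real (X \<omega>) * indicator (W n) \<omega> = 0"
        by eventually_elim simp
    qed
  qed (use int in \<open>auto intro!: AE_I2 mult_left_le simp: indicator_def\<close>)
  thus ?thesis by simp
qed

text \<open>x P(X > x) is at most the mean of X restricted to X > x. For \<open>R\<close> this is
  the only tail information available at the start.\<close>

lemma tail_first_moment:
  fixes X :: "'a \<Rightarrow> real"
  assumes int: "integrable M X" and nonneg: "\<And>\<omega>. \<omega> \<in> space M \<Longrightarrow> X \<omega> \<ge> 0"
  shows "((\<lambda>x. x * prob {\<omega> \<in> space M. X \<omega> > x}) \<longlongrightarrow> 0) at_top"
proof -
  note [measurable] = borel_measurable_integrable[OF int]
  have "((\<lambda>x. expectation (\<lambda>\<omega>. X \<omega> * indicator {\<omega> \<in> space M. X \<omega> > x} \<omega>)) \<longlongrightarrow> expectation (\<lambda>_. 0)) at_top"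
  proof (rule integral_dominated_convergence_at_top[where w = X])
    show "AE \<omega> in M. ((\<lambda>x. X \<omega> * indicator {\<omega> \<in> space M. X \<omega> > x} \<omega>) \<longlongrightarrow> 0) at_top"
    proof (intro AE_I2 tendsto_eventually)
      fix \<omega>
      show "\<forall>\<^sub>F x in at_top. X \<omega> * indicator {\<omega> \<in> space M. X \<omega> > x} \<omega> = 0"
        using eventually_ge_at_top[of "X \<omega>"] by eventually_elim (auto simp: indicator_def)
    qed
    show "\<forall>\<^sub>F x in at_top. AE \<omega> in M. norm (X \<omega> * indicator {\<omega> \<in> space M. X \<omega> > x} \<omega>) \<le> X \<omega>"
      using nonneg by (auto intro!: always_eventually AE_I2 simp: indicator_def)
  qed (use int in auto)
  hence lim: "((\<lambda>x. expectation (\<lambda>\<omega>. X \<omega> * indicator {\<omega> \<in> space M. X \<omega> > x} \<omega>)) \<longlongrightarrow> 0) at_top" by simp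
  show ?thesis
  proof (rule tendsto_sandwich[OF _ _ tendsto_const lim])
    show "\<forall>\<^sub>F x in at_top. 0 \<le> x * prob {\<omega> \<in> space M. X \<omega> > x}"
      using eventually_ge_at_top[of 0] by eventually_elim auto
    show "\<forall>\<^sub>F x in at_top. x * prob {\<omega> \<in> space M. X \<omega> > x}
        \<le> expectation (\<lambda>\<omega>. X \<omega> * indicator {\<omega> \<in> space M. X \<omega> > x} \<omega>)"
      using eventually_ge_at_top[of 0]
    proof eventually_elim
      case (elim x)
      have "x * prob {\<omega> \<in> space M. X \<omega> > x} = expectation (\<lambda>\<omega>. x * indicator {\<omega> \<in> space M. X \<omega> > x} \<omega>)"
        by simp
      also have "\<dots> \<le> expectation (\<lambda>\<omega>. X \<omega> * indicator {\<omega> \<in> space M. X \<omega> > x} \<omega>)"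
        by (intro integral_mono integrable_real_mult_indicator int)
          (auto simp: indicator_def emeasure_eq_measure intro!: integrable_real_indicator)
      finally show ?case .
    qed
  qed
qed

lemma prob_gt_tendsto_0:
  assumes [measurable]: "X \<in> borel_measurable M"
  shows "((\<lambda>x::real. prob {\<omega> \<in> space M. X \<omega> > x}) \<longlongrightarrow> 0) at_top"
proof -
  have "((\<lambda>x. expectation (indicator {\<omega> \<in> space M. X \<omega> > x})) \<longlongrightarrow> expectation (\<lambda>_. 0 :: real)) at_top"
  proof (rule integral_dominated_convergence_at_top[where w = "\<lambda>_. 1"])
    show "AE \<omega> in M. ((\<lambda>x. indicator {\<omega> \<in> space M. X \<omega> > x} \<omega> :: real) \<longlongrightarrow> 0) at_top"
    proof (intro AE_I2 tendsto_eventually)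
      fix \<omega>
      show "\<forall>\<^sub>F x in at_top. indicator {\<omega> \<in> space M. X \<omega> > x} \<omega> = (0 :: real)"
        using eventually_ge_at_top[of "X \<omega>"] by eventually_elim (auto simp: indicator_def)
    qed
  qed (auto intro!: always_eventually)
  thus ?thesis by simp
qed

end

locale branching_fixed_point = prob_space M
  for M :: "'a measure" +
  fixes Q :: "'k::finite \<Rightarrow> 'a \<Rightarrow> real"
    and N :: "'k \<Rightarrow> 'k \<Rightarrow> 'a \<Rightarrow> nat"
    and Rm :: "'k \<Rightarrow> nat \<Rightarrow> 'a \<Rightarrow> real"
    and R :: "'k \<Rightarrow> 'a \<Rightarrow> real"
  assumes Q_rv[measurable]: "\<And>i. Q i \<in> borel_measurable M"
    and Q_nonneg: "\<And>i \<omega>. \<omega> \<in> space M \<Longrightarrow> Q i \<omega> \<ge> 0"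
    and N_rv[measurable]: "\<And>i k. N i k \<in> measurable M (count_space UNIV)"
    and N_int: "\<And>i k. integrable M (\<lambda>\<omega>. real (N i k \<omega>))"
    and Rm_rv[measurable]: "\<And>k n. Rm k n \<in> borel_measurable M"
    and Rm_indep: "indep_vars (\<lambda>_. borel) (\<lambda>p. Rm (fst p) (snd p)) UNIV"
    and V_Rm_indep: "\<And>i. indep_set
           (sets (vimage_algebra (space M) (weight_vector Q N i) borel))
           (sets (vimage_algebra (space M) (\<lambda>\<omega> p. Rm (fst p) (snd p) \<omega>) (Pi\<^sub>M UNIV (\<lambda>_. borel))))"
    and Rm_distr: "\<And>k n. distr M borel (Rm k n) = distr M borel (R k)"
    and R_rv[measurable]: "\<And>i. R i \<in> borel_measurable M"
    and R_nonneg: "\<And>i \<omega>. \<omega> \<in> space M \<Longrightarrow> R i \<omega> \<ge> 0"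
    and R_int: "\<And>i. integrable M (R i)"
    and fixpoint: "\<And>i. distr M borel (R i) =
          distr M borel (\<lambda>\<omega>. Q i \<omega> + (\<Sum>k\<in>UNIV. \<Sum>n\<in>{1..N i k \<omega>}. Rm k n \<omega>))"
begin

abbreviation "VA i \<equiv> vimage_algebra (space M) (weight_vector Q N i) borel"
abbreviation "RA \<equiv> vimage_algebra (space M) (\<lambda>\<omega> p. Rm (fst p) (snd p) \<omega>) (Pi\<^sub>M UNIV (\<lambda>_. borel))"

definition "m i k = expectation (\<lambda>\<omega>. real (N i k \<omega>))"
definition "r k = expectation (R k)"
definition "H k x = prob {\<omega> \<in> space M. R k \<omega> > x}"

lemma V_indep: "A \<in> sets (VA i) \<Longrightarrow> B \<in> sets RA \<Longrightarrow> prob (A \<inter> B) = prob A * prob B"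
  and VA_events: "A \<in> sets (VA i) \<Longrightarrow> A \<in> events"
  and RA_events: "B \<in> sets RA \<Longrightarrow> B \<in> events"
  using indep_setD[OF V_Rm_indep] indep_setD_ev1[OF V_Rm_indep] indep_setD_ev2[OF V_Rm_indep] by blast+

lemma space_VA [simp]: "space (VA i) = space M" and space_RA [simp]: "space RA = space M"
  by simp_all

lemma V_VA: "weight_vector Q N i \<in> borel_measurable (VA i)"
  by (rule measurable_vimage_algebra1) auto

lemma V_component_VA: "(\<lambda>\<omega>. weight_vector Q N i \<omega> $ j) \<in> borel_measurable (VA i)"
  by (rule measurable_compose[OF V_VA borel_measurable_vec_nth])

lemma Q_VA: "Q i \<in> borel_measurable (VA i)"
  using V_component_VA[of i None] by (simp add: weight_vector_def)

lemma N_VA: "(\<lambda>\<omega>. real (N i k \<omega>)) \<in> borel_measurable (VA i)"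
  using V_component_VA[of i "Some k"] by (simp add: weight_vector_def)

lemma N_eq_VA: "{\<omega> \<in> space M. P (real (N i k \<omega>))} \<in> sets (VA i)" if "Measurable.pred borel P"
  using measurable_compose[OF N_VA that] by (simp add: pred_def)

lemma Rm_RA: "Rm k n \<in> borel_measurable RA"
proof -
  have "(\<lambda>\<omega> p. Rm (fst p) (snd p) \<omega>) \<in> measurable RA (Pi\<^sub>M UNIV (\<lambda>_. borel))"
    by (rule measurable_vimage_algebra1) (auto simp: space_PiM)
  from measurable_compose[OF this measurable_component_singleton[of "(k, n)"]] show ?thesis by simp
qed

lemma Rm_gt_RA: "{\<omega> \<in> space M. Rm k n \<omega> > y} \<in> sets RA"
  using measurable_sets[OF Rm_RA[of k n], of "{y<..}"] by (simp add: vimage_def Int_def conj_commute)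

text \<open>Pointwise non-negativity is assumed for \<open>R\<close> alone. The copies inherit it
  through their law, hence only almost surely; the inclusions of events below are therefore stated
  almost everywhere.\<close>

lemma AE_Rm_nonneg: "AE \<omega> in M. \<forall>k n. Rm k n \<omega> \<ge> 0"
proof -
  have "AE \<omega> in M. Rm k n \<omega> \<ge> 0" for k n
  proof -
    have "AE x in distr M borel (R k). x \<ge> 0"
      by (subst AE_distr_iff) (auto intro: R_nonneg)
    hence "AE x in distr M borel (Rm k n). x \<ge> 0" unfolding Rm_distr .
    thus ?thesis by (subst (asm) AE_distr_iff) auto
  qed
  thus ?thesis by (simp add: AE_all_countable)
qed

lemma prob_Rm: "prob {\<omega> \<in> space M. Rm k n \<omega> > x} = H k x"
  unfolding H_def by (rule prob_cong_distr) (auto simp: Rm_distr)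

lemma H_nonneg: "H k x \<ge> 0" and H_le_1: "H k x \<le> 1"
  by (simp_all add: H_def)

lemma H_tendsto_0: "(H k \<longlongrightarrow> 0) at_top"
  unfolding H_def[abs_def] by (rule prob_gt_tendsto_0) auto

lemma first_moment_H: "((\<lambda>x. x * H k x) \<longlongrightarrow> 0) at_top"
  unfolding H_def by (rule tail_first_moment) (auto intro: R_int R_nonneg)

lemma m_nonneg: "m i k \<ge> 0"
  unfolding m_def by (rule integral_nonneg_AE) auto

lemma r_nonneg: "r k \<ge> 0"
  unfolding r_def by (rule integral_nonneg_AE) (auto intro: R_nonneg)

lemma Rm_indep_row: "indep_vars (\<lambda>_. borel) (Rm k) UNIV"
  unfolding indep_vars_def2
proof (intro conjI ballI indep_setsI)
  fix A and J :: "nat set"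
  assume J: "J \<noteq> {}" "J \<subseteq> UNIV" "finite J"
    and A: "\<forall>j\<in>J. A j \<in> {Rm k j -` A \<inter> space M |A. A \<in> sets borel}"
  have sets: "indep_sets (\<lambda>p. {Rm (fst p) (snd p) -` A \<inter> space M |A. A \<in> sets borel}) UNIV"
    using Rm_indep unfolding indep_vars_def2 by auto
  have "prob (\<Inter>p\<in>Pair k ` J. A (snd p)) = (\<Prod>p\<in>Pair k ` J. prob (A (snd p)))"
    by (rule indep_setsD[OF sets]) (use J A in auto)
  thus "prob (\<Inter>j\<in>J. A j) = (\<Prod>j\<in>J. prob (A j))"
    by (simp add: prod.reindex inj_on_def)
qed auto

lemma prob_two_Rm:
  assumes "p \<noteq> q"
  shows "prob {\<omega> \<in> space M. Rm (fst p) (snd p) \<omega> > x \<and> Rm (fst q) (snd q) \<omega> > x} = H (fst p) x * H (fst q) x"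
proof -
  have "indep_events (\<lambda>p. {\<omega> \<in> space M. Rm (fst p) (snd p) \<omega> > x}) UNIV"
    by (rule indep_eventsI_indep_vars[OF Rm_indep]) auto
  hence "prob (\<Inter>p\<in>{p, q}. {\<omega> \<in> space M. Rm (fst p) (snd p) \<omega> > x})
      = (\<Prod>p\<in>{p, q}. prob {\<omega> \<in> space M. Rm (fst p) (snd p) \<omega> > x})"
    unfolding indep_events_def by (elim conjE allE[of _ "{p, q}"]) auto
  moreover have "(\<Inter>p\<in>{p, q}. {\<omega> \<in> space M. Rm (fst p) (snd p) \<omega> > x})
      = {\<omega> \<in> space M. Rm (fst p) (snd p) \<omega> > x \<and> Rm (fst q) (snd q) \<omega> > x}" by auto
  ultimately show ?thesis using assms by (simp add: prob_Rm)
qed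

text \<open>Conditioning on the number of summands without conditional expectations: A is split
  according to N = j, each piece is independent of \<open>B j\<close>, and the products are summed
  back into one expectation.\<close>

lemma prob_conditional_bound:
  assumes A: "A \<in> sets (VA i)" and B: "\<And>j. B j \<in> sets RA" and \<beta>: "\<And>j. prob (B j) \<le> \<beta> j"
    and int: "integrable M (\<lambda>\<omega>. \<beta> (N i k \<omega>) * indicator A \<omega>)"
  shows "{\<omega> \<in> A. \<omega> \<in> B (N i k \<omega>)} \<in> events"
    "prob {\<omega> \<in> A. \<omega> \<in> B (N i k \<omega>)} \<le> expectation (\<lambda>\<omega>. \<beta> (N i k \<omega>) * indicator A \<omega>)"
proof -
  define C where "C j = A \<inter> {\<omega> \<in> space M. N i k \<omega> = j}" for j
  have C: "C j \<in> sets (VA i)" for j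
    unfolding C_def using N_eq_VA[of "\<lambda>x. x = real j" i k] A by auto
  have CB: "C j \<inter> B j \<in> events" for j
    using VA_events[OF C] RA_events[OF B] by blast
  have "A \<subseteq> space M" using sets.sets_into_space[OF A] by simp
  hence eq: "{\<omega> \<in> A. \<omega> \<in> B (N i k \<omega>)} = (\<Union>j. C j \<inter> B j)" by (auto simp: C_def)
  show "{\<omega> \<in> A. \<omega> \<in> B (N i k \<omega>)} \<in> events" unfolding eq using CB by auto
  have "disjoint_family (\<lambda>j. C j \<inter> B j)" by (auto simp: disjoint_family_on_def C_def)
  with CB have sums: "(\<lambda>j. prob (C j \<inter> B j)) sums prob (\<Union>j. C j \<inter> B j)"
    by (intro finite_measure_UNION) auto
  have \<beta>0: "\<beta> j \<ge> 0" for j using \<beta>[of j] measure_nonneg[of M "B j"] by linarith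
  have "(\<Sum>j<n. prob (C j \<inter> B j)) \<le> expectation (\<lambda>\<omega>. \<beta> (N i k \<omega>) * indicator A \<omega>)" for n
  proof -
    have "(\<Sum>j<n. prob (C j \<inter> B j)) = (\<Sum>j<n. prob (C j) * prob (B j))"
      by (simp add: V_indep[OF C B])
    also have "\<dots> \<le> (\<Sum>j<n. prob (C j) * \<beta> j)" by (intro sum_mono mult_left_mono \<beta>) auto
    also have "\<dots> = expectation (\<lambda>\<omega>. \<Sum>j<n. indicator (C j) \<omega> * \<beta> j)"
      using VA_events[OF C] by (subst Bochner_Integration.integral_sum) (auto simp: emeasure_eq_measure)
    also have "\<dots> \<le> expectation (\<lambda>\<omega>. \<beta> (N i k \<omega>) * indicator A \<omega>)"
    proof (rule integral_mono[OF _ int])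
      show "integrable M (\<lambda>\<omega>. \<Sum>j<n. indicator (C j) \<omega> * \<beta> j)"
        using VA_events[OF C] by (intro Bochner_Integration.integrable_sum) (auto simp: emeasure_eq_measure)
      fix \<omega> assume "\<omega> \<in> space M"
      hence "(\<Sum>j<n. indicator (C j) \<omega> * \<beta> j) = (\<Sum>j<n. if j = N i k \<omega> then \<beta> j * indicator A \<omega> else 0)"
        by (intro sum.cong) (auto simp: C_def indicator_def)
      also have "\<dots> \<le> \<beta> (N i k \<omega>) * indicator A \<omega>" using \<beta>0 by simp
      finally show "(\<Sum>j<n. indicator (C j) \<omega> * \<beta> j) \<le> \<beta> (N i k \<omega>) * indicator A \<omega>" .
    qed
    finally show ?thesis .
  qed
  hence "prob (\<Union>j. C j \<inter> B j) \<le> expectation (\<lambda>\<omega>. \<beta> (N i k \<omega>) * indicator A \<omega>)"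
    using sums unfolding sums_def by (intro LIMSEQ_le_const2) auto
  thus "prob {\<omega> \<in> A. \<omega> \<in> B (N i k \<omega>)} \<le> expectation (\<lambda>\<omega>. \<beta> (N i k \<omega>) * indicator A \<omega>)"
    unfolding eq .
qed

definition "S i \<omega> = Q i \<omega> + (\<Sum>k\<in>UNIV. \<Sum>n\<in>{1..N i k \<omega>}. Rm k n \<omega>)"

lemma row_sum_measurable [measurable]:
  "(\<lambda>\<omega>. \<Sum>n\<in>{1..N i k \<omega>}. Rm k n \<omega>) \<in> borel_measurable M"
proof -
  have "(\<lambda>\<omega>. (\<lambda>j \<omega>. \<Sum>n\<in>{1..j}. Rm k n \<omega>) (N i k \<omega>) \<omega>) \<in> borel_measurable M"
    by (rule measurable_compose_countable[OF _ N_rv]) measurable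
  thus ?thesis by simp
qed

lemma S_measurable [measurable]: "S i \<in> borel_measurable M"
  unfolding S_def by measurable

lemma H_eq_S: "H i x = prob {\<omega> \<in> space M. S i \<omega> > x}"
  unfolding H_def by (rule prob_cong_distr) (auto simp: fixpoint S_def[abs_def])

end

section \<open>One-step tail recursions\<close>

context branching_fixed_point
begin

text \<open>Given N = j, a union bound gives j times the tail of one summand; averaging over N
  produces the mean.\<close>

lemma big_jump_bound:
  "{\<omega> \<in> space M. \<exists>n\<in>{1..N i k \<omega>}. Rm k n \<omega> > y} \<in> events"
  "prob {\<omega> \<in> space M. \<exists>n\<in>{1..N i k \<omega>}. Rm k n \<omega> > y} \<le> m i k * H k y"
proof -
  define B where "B j = (\<Union>n\<in>{1..j}. {\<omega> \<in> space M. Rm k n \<omega> > y})" for j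
  have B: "B j \<in> sets RA" for j unfolding B_def using Rm_gt_RA by auto
  have \<beta>: "prob (B j) \<le> real j * H k y" for j
  proof -
    have "prob (B j) \<le> (\<Sum>n\<in>{1..j}. prob {\<omega> \<in> space M. Rm k n \<omega> > y})"
      unfolding B_def by (intro finite_measure_subadditive_finite) auto
    thus ?thesis by (simp add: prob_Rm)
  qed
  have A: "space M \<in> sets (VA i)" using sets.top[of "VA i"] by simp
  have eq: "{\<omega> \<in> space M. \<exists>n\<in>{1..N i k \<omega>}. Rm k n \<omega> > y} = {\<omega> \<in> space M. \<omega> \<in> B (N i k \<omega>)}"
    by (auto simp: B_def)
  have int: "integrable M (\<lambda>\<omega>. real (N i k \<omega>) * H k y * indicator (space M) \<omega>)"
    using N_int[of i k] by (intro integrable_real_mult_indicator) auto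
  note * = prob_conditional_bound[OF A B \<beta> int]
  show "{\<omega> \<in> space M. \<exists>n\<in>{1..N i k \<omega>}. Rm k n \<omega> > y} \<in> events" unfolding eq by (rule *(1))
  have "expectation (\<lambda>\<omega>. real (N i k \<omega>) * H k y * indicator (space M) \<omega>) = expectation (\<lambda>\<omega>. real (N i k \<omega>) * H k y)"
    by (intro Bochner_Integration.integral_cong) auto
  also have "\<dots> = m i k * H k y" by (simp add: m_def)
  finally show "prob {\<omega> \<in> space M. \<exists>n\<in>{1..N i k \<omega>}. Rm k n \<omega> > y} \<le> m i k * H k y"
    unfolding eq using *(2) by simp
qed

text \<open>A sum of at most \<open>n0\<close> summands of each type that is large, although its weight part is not
  and no summand reaches \<open>(1 - \<delta>) x\<close>, needs two exceedances of level \<open>\<eta> x\<close>.\<close>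
lemma two_jumps:
  assumes \<epsilon>: "0 < \<epsilon>" and \<delta>: "0 < \<delta>" and x: "x > 0"
    and \<eta>: "0 < \<eta>" "\<eta> * n0 < \<epsilon>" "\<eta> * (2 * real CARD('k) * n0) < \<delta>"
    and nonneg: "\<And>k n. \<rho> k n \<ge> (0::real)"
    and \<nu>: "\<And>k :: 'k. \<nu> k \<le> (n0 :: nat)"
    and small: "\<And>k n. n \<in> {1..\<nu> k} \<Longrightarrow> \<rho> k n \<le> (1 - \<delta>) * x"
    and row: "(\<Sum>n=1..\<nu> k0. \<rho> k0 n) > \<epsilon> * x"
    and total: "q + (\<Sum>k\<in>UNIV. \<Sum>n=1..\<nu> k. \<rho> k n) > x"
  shows "(q > \<delta> / 2 * x \<and> (\<exists>p\<in>UNIV \<times> {1..n0}. \<rho> (fst p) (snd p) > \<eta> * x)) \<or>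
    (\<exists>p\<in>UNIV \<times> {1..n0}. \<exists>p'\<in>UNIV \<times> {1..n0}. p \<noteq> p' \<and>
        \<rho> (fst p) (snd p) > \<eta> * x \<and> \<rho> (fst p') (snd p') > \<eta> * x)"
proof -
  have "\<exists>n\<in>{1..\<nu> k0}. \<rho> k0 n > \<eta> * x"
  proof (rule ccontr)
    assume "\<not> ?thesis"
    hence "(\<Sum>n=1..\<nu> k0. \<rho> k0 n) \<le> (\<Sum>n=1..\<nu> k0. \<eta> * x)" by (intro sum_mono) (auto simp: not_less)
    also have "\<dots> = real (\<nu> k0) * (\<eta> * x)" by simp
    also have "\<dots> \<le> n0 * (\<eta> * x)" using \<nu>[of k0] \<eta>(1) x by (intro mult_right_mono) auto
    also have "\<dots> = (\<eta> * n0) * x" by simp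
    also have "\<dots> \<le> \<epsilon> * x" using \<eta>(2) x by (intro mult_right_mono) auto
    finally show False using row by simp
  qed
  then obtain n1 where n1: "n1 \<in> {1..\<nu> k0}" "\<rho> k0 n1 > \<eta> * x" by blast
  have p1: "(k0, n1) \<in> UNIV \<times> {1..n0}" using n1 \<nu>[of k0] by auto
  show ?thesis
  proof (cases "q > \<delta> / 2 * x")
    case True
    thus ?thesis using p1 n1 by (intro disjI1 conjI bexI[of _ "(k0, n1)"]) auto
  next
    case False
    define J where "J = (SIGMA k:UNIV. {1..\<nu> k})"
    have finJ: "finite J" unfolding J_def by auto
    have J_sub: "J \<subseteq> UNIV \<times> {1..n0}" unfolding J_def by (auto intro: order.trans[OF _ \<nu>])
    hence cardJ: "card J \<le> CARD('k) * n0"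
      using card_mono[OF _ J_sub] by (simp add: card_cartesian_product)
    have mem: "(k0, n1) \<in> J" using n1 by (simp add: J_def)
    have "(\<Sum>p\<in>J. \<rho> (fst p) (snd p)) = (\<Sum>k\<in>UNIV. \<Sum>n=1..\<nu> k. \<rho> k n)"
      unfolding J_def by (subst sum.Sigma) (auto simp: case_prod_unfold)
    hence "(\<Sum>p\<in>J. \<rho> (fst p) (snd p)) > (1 - \<delta> / 2) * x"
      using total False by (simp add: algebra_simps)
    moreover have "(\<Sum>p\<in>J. \<rho> (fst p) (snd p)) = \<rho> k0 n1 + (\<Sum>p\<in>J - {(k0, n1)}. \<rho> (fst p) (snd p))"
      using sum.remove[OF finJ mem, of "\<lambda>p. \<rho> (fst p) (snd p)"] by simp
    \<comment> \<open>Without q the summands still exceed (1 - \<delta>/2) x, and the first jump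
      accounts for at most (1 - \<delta>) x of this.\<close>
    ultimately have rest: "(\<Sum>p\<in>J - {(k0, n1)}. \<rho> (fst p) (snd p)) > \<delta> / 2 * x"
      using small[OF n1(1)] by (simp add: algebra_simps)
    have "\<exists>p\<in>J - {(k0, n1)}. \<rho> (fst p) (snd p) > \<eta> * x"
    proof (rule ccontr)
      assume "\<not> ?thesis"
      hence "(\<Sum>p\<in>J - {(k0, n1)}. \<rho> (fst p) (snd p)) \<le> (\<Sum>p\<in>J - {(k0, n1)}. \<eta> * x)"
        by (intro sum_mono) (auto simp: not_less)
      also have "\<dots> = real (card (J - {(k0, n1)})) * (\<eta> * x)" by simp
      also have "\<dots> \<le> real (CARD('k) * n0) * (\<eta> * x)"
        using cardJ card_mono[OF finJ, of "J - {(k0, n1)}"] \<eta>(1) x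
        by (intro mult_right_mono) (auto intro: order.trans simp del: of_nat_mult)
      also have "\<dots> = (\<eta> * (2 * real CARD('k) * n0)) / 2 * x" by simp
      also have "\<dots> \<le> \<delta> / 2 * x" using \<eta>(3) x by (intro mult_right_mono) auto
      finally show False using rest by simp
    qed
    then obtain p2 where "p2 \<in> J" "p2 \<noteq> (k0, n1)" "\<rho> (fst p2) (snd p2) > \<eta> * x" by blast
    thus ?thesis using p1 n1 J_sub by (intro disjI2 bexI[of _ "(k0, n1)"] bexI[of _ p2] conjI) auto
  qed
qed

text \<open>The scenario of a large weight vector: every summand of type k is replaced by the
  constant \<open>v k\<close>, which will be a perturbation of its mean.\<close>

definition heavy :: "'k \<Rightarrow> ('k \<Rightarrow> real) \<Rightarrow> real \<Rightarrow> 'a set" where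
  "heavy i v y = {\<omega> \<in> space M. Q i \<omega> + (\<Sum>k\<in>UNIV. v k * real (N i k \<omega>)) > y}"

lemma heavy_VA: "heavy i v y \<in> sets (VA i)"
proof -
  have "(\<lambda>\<omega>. Q i \<omega> + (\<Sum>k\<in>UNIV. v k * real (N i k \<omega>))) \<in> borel_measurable (VA i)"
    using Q_VA N_VA by (intro borel_measurable_add borel_measurable_sum borel_measurable_times) auto
  from measurable_sets[OF this, of "{y<..}"] show ?thesis
    by (simp add: heavy_def vimage_def Int_def conj_commute)
qed

lemma heavy_events [measurable]: "heavy i v y \<in> events"
  by (rule VA_events[OF heavy_VA])

definition "h x = (\<Sum>k\<in>UNIV. H k x)"

lemma h_nonneg: "h x \<ge> 0" and H_le_h: "H k x \<le> h x"
  by (auto simp: h_def H_nonneg intro: sum_nonneg member_le_sum)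

lemma h_tendsto_0: "(h \<longlongrightarrow> 0) at_top"
  unfolding h_def[abs_def] by (intro tendsto_null_sum H_tendsto_0)

text \<open>The summand indices run over a fixed rectangle instead of up to the random numbers N, so
  that independence applies directly to each of the finitely many pieces.\<close>

definition "two_jump_event i n0 y z = 
  (\<Union>p\<in>UNIV \<times> {1..n0}. {\<omega> \<in> space M. Q i \<omega> > z \<and> Rm (fst p) (snd p) \<omega> > y}) \<union>
  (\<Union>(p, p')\<in>{(p, p') \<in> (UNIV \<times> {1..n0}) \<times> (UNIV \<times> {1..n0}). p \<noteq> p'}.
     {\<omega> \<in> space M. Rm (fst p) (snd p) \<omega> > y \<and> Rm (fst p') (snd p') \<omega> > y})"

lemma two_jump_event [measurable]: "two_jump_event i n0 y z \<in> events"
  unfolding two_jump_event_def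
  by (intro sets.Un sets.finite_UN) (auto intro: finite_subset[of _ "(UNIV \<times> {1..n0}) \<times> (UNIV \<times> {1..n0})"])

text \<open>Both terms contain h y multiplied by a factor that tends to 0 as the levels grow, which
  makes them negligible against any majorant of h y.\<close>

lemma prob_two_jump_event:
  "prob (two_jump_event i n0 y z) \<le>
    (CARD('k) * n0) * prob {\<omega> \<in> space M. Q i \<omega> > z} * h y + (CARD('k) * n0)\<^sup>2 * (h y)\<^sup>2"
proof -
  let ?J = "UNIV \<times> {1..n0} :: ('k \<times> nat) set"
  let ?P = "{(p, p') \<in> ?J \<times> ?J. p \<noteq> p'}"
  have finP: "finite ?P" by (rule finite_subset[of _ "?J \<times> ?J"]) auto
  have cardJ: "card ?J = CARD('k) * n0" by (simp add: card_cartesian_product)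
  have cardP: "card ?P \<le> (CARD('k) * n0)\<^sup>2"
    using card_mono[of "?J \<times> ?J" ?P] by (auto simp: card_cartesian_product power2_eq_square)
  have QR: "prob {\<omega> \<in> space M. Q i \<omega> > z \<and> Rm k n \<omega> > y} \<le> prob {\<omega> \<in> space M. Q i \<omega> > z} * h y" for k n
  proof -
    have "{\<omega> \<in> space M. Q i \<omega> > z} \<in> sets (VA i)"
      using measurable_sets[OF Q_VA[of i], of "{z<..}"] by (simp add: vimage_def Int_def conj_commute)
    hence "prob ({\<omega> \<in> space M. Q i \<omega> > z} \<inter> {\<omega> \<in> space M. Rm k n \<omega> > y})
        = prob {\<omega> \<in> space M. Q i \<omega> > z} * H k y"
      by (simp add: V_indep Rm_gt_RA prob_Rm)
    also have "{\<omega> \<in> space M. Q i \<omega> > z} \<inter> {\<omega> \<in> space M. Rm k n \<omega> > y}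
        = {\<omega> \<in> space M. Q i \<omega> > z \<and> Rm k n \<omega> > y}" by auto
    finally show ?thesis using H_le_h by (simp add: mult_left_mono)
  qed
  have "prob (two_jump_event i n0 y z)
    \<le> prob (\<Union>p\<in>?J. {\<omega> \<in> space M. Q i \<omega> > z \<and> Rm (fst p) (snd p) \<omega> > y})
     + prob (\<Union>(p, p')\<in>?P. {\<omega> \<in> space M. Rm (fst p) (snd p) \<omega> > y \<and> Rm (fst p') (snd p') \<omega> > y})"
    unfolding two_jump_event_def using finP by (intro measure_Un_le sets.finite_UN) auto
  also have "\<dots> \<le> (\<Sum>p\<in>?J. prob {\<omega> \<in> space M. Q i \<omega> > z \<and> Rm (fst p) (snd p) \<omega> > y})
     + (\<Sum>pp\<in>?P. prob (case pp of (p, p') \<Rightarrow> {\<omega> \<in> space M. Rm (fst p) (snd p) \<omega> > y \<and> Rm (fst p') (snd p') \<omega> > y}))"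
    using finP by (intro add_mono finite_measure_subadditive_finite) auto
  also have "\<dots> \<le> (\<Sum>p\<in>?J. prob {\<omega> \<in> space M. Q i \<omega> > z} * h y) + (\<Sum>pp\<in>?P. (h y)\<^sup>2)"
  proof (intro add_mono sum_mono QR)
    fix pp assume "pp \<in> ?P"
    then obtain p p' where pp: "pp = (p, p')" "p \<noteq> p'" by auto
    show "prob (case pp of (p, p') \<Rightarrow> {\<omega> \<in> space M. Rm (fst p) (snd p) \<omega> > y \<and> Rm (fst p') (snd p') \<omega> > y}) \<le> (h y)\<^sup>2"
      unfolding pp(1) prod.case prob_two_Rm[OF pp(2)] power2_eq_square
      by (intro mult_mono H_le_h H_nonneg h_nonneg)
  qed
  also have "\<dots> = (CARD('k) * n0) * prob {\<omega> \<in> space M. Q i \<omega> > z} * h y + card ?P * (h y)\<^sup>2"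
    by (simp add: cardJ)
  also have "\<dots> \<le> (CARD('k) * n0) * prob {\<omega> \<in> space M. Q i \<omega> > z} * h y + (CARD('k) * n0)\<^sup>2 * (h y)\<^sup>2"
    using cardP by (intro add_left_mono mult_right_mono) (auto simp del: of_nat_power simp flip: of_nat_power)
  finally show ?thesis .
qed

text \<open>What \<open>upper_deviation_bound\<close> asks of a majorant, simultaneously for all
  types: a tail bound, dominated variation, positivity at one point, and decay faster than
  1/x.\<close>

definition "tail_dominator a \<Gamma> \<longleftrightarrow>
  (\<forall>k u. u > 0 \<longrightarrow> H k u \<le> \<Gamma> u) \<and>
  (\<forall>x l. x > 0 \<longrightarrow> l \<ge> 1 \<longrightarrow> \<Gamma> (x / l) \<le> l powr a * \<Gamma> x) \<and>
  \<Gamma> 1 > 0 \<and> ((\<lambda>x. x * \<Gamma> x) \<longlongrightarrow> 0) at_top"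

lemma tail_dominatorD:
  assumes "tail_dominator a \<Gamma>"
  shows "\<And>u. u > 0 \<Longrightarrow> H k u \<le> \<Gamma> u"
    "\<And>x l. x > 0 \<Longrightarrow> l \<ge> 1 \<Longrightarrow> \<Gamma> (x / l) \<le> l powr a * \<Gamma> x"
    "\<Gamma> 1 > 0" "((\<lambda>x. x * \<Gamma> x) \<longlongrightarrow> 0) at_top"
  using assms unfolding tail_dominator_def by auto

lemma tail_dominator_pos:
  assumes "tail_dominator a \<Gamma>" "x \<ge> 1"
  shows "\<Gamma> x > 0"
proof -
  have "\<Gamma> (x / x) \<le> x powr a * \<Gamma> x" using assms(2) by (intro tail_dominatorD[OF assms(1)]) auto
  moreover have "\<Gamma> (x / x) > 0" using tail_dominatorD(3)[OF assms(1)] assms(2) by simp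
  ultimately have "0 < x powr a * \<Gamma> x" by linarith
  thus ?thesis by (simp add: zero_less_mult_iff)
qed

definition "deviation_event i k \<epsilon> x =
  {\<omega> \<in> space M. real (N i k \<omega>) \<le> x / \<epsilon> \<and>
     (\<Sum>n=1..N i k \<omega>. Rm k n \<omega>) > N i k \<omega> * (r k + \<epsilon>) + \<epsilon> * x}"

lemma deviation_event [measurable]: "deviation_event i k \<epsilon> x \<in> events"
  unfolding deviation_event_def by measurable

definition "many i n0 = {\<omega> \<in> space M. \<exists>k. N i k \<omega> > n0}"

lemma many_VA: "many i n0 \<in> sets (VA i)"
proof -
  have "many i n0 = (\<Union>k. {\<omega> \<in> space M. real (N i k \<omega>) > n0})" by (auto simp: many_def)
  also have "\<dots> \<in> sets (VA i)" by (intro sets.finite_UN N_eq_VA) auto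
  finally show ?thesis .
qed

lemma many_events [measurable]: "many i n0 \<in> events"
  by (rule VA_events[OF many_VA])

text \<open>The order of quantifiers matters: C and the range of x are fixed before
  \<open>n0\<close>, so that \<open>n0\<close> can later be taken so large that C times the
  truncated mean is small.\<close>

lemma deviation_bound:
  assumes \<Gamma>: "tail_dominator a \<Gamma>" and a: "a > 0" and \<epsilon>: "0 < \<epsilon>" "\<epsilon> \<le> 1"
  obtains C where "C > 0" "\<forall>\<^sub>F x in at_top. \<forall>n0.
    prob (many i n0 \<inter> deviation_event i k \<epsilon> x) \<le> C * expectation (\<lambda>\<omega>. real (N i k \<omega>) * indicator (many i n0) \<omega>) * \<Gamma> x"
proof -
  obtain C where C: "C > 0" "\<forall>\<^sub>F x in at_top. \<forall>n. real n \<le> x / \<epsilon> \<longrightarrow>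
    prob {\<omega> \<in> space M. (\<Sum>j=1..n. Rm k j \<omega>) > n * (expectation (R k) + \<epsilon>) + \<epsilon> * x} \<le> C * n * \<Gamma> x"
  proof (rule upper_deviation_bound[where \<Gamma> = \<Gamma> and a = a and \<epsilon> = \<epsilon>, OF Rm_indep_row Rm_distr R_int R_nonneg _ _ _ _ a \<epsilon>])
    show "prob {\<omega> \<in> space M. u < R k \<omega>} \<le> \<Gamma> u" if "u > 0" for u
      using tail_dominatorD(1)[OF \<Gamma> that] by (simp add: H_def)
  qed (use tail_dominatorD[OF \<Gamma>] in auto)
  show ?thesis
  proof (rule that[OF C(1)], use C(2) eventually_ge_at_top[of 1] in eventually_elim, intro allI)
    fix x n0 assume bd: "\<forall>n. real n \<le> x / \<epsilon> \<longrightarrow>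
      prob {\<omega> \<in> space M. (\<Sum>j=1..n. Rm k j \<omega>) > n * (expectation (R k) + \<epsilon>) + \<epsilon> * x} \<le> C * n * \<Gamma> x"
      and x: "1 \<le> x"
    \<comment> \<open>The deviation estimate covers only j <= x / \<epsilon>. The event
      \<open>deviation_event\<close> imposes the same range on N, so the empty set is the right
      choice beyond it.\<close>
    define B where "B j = (if real j \<le> x / \<epsilon> then {\<omega> \<in> space M. (\<Sum>n=1..j. Rm k n \<omega>) > j * (r k + \<epsilon>) + \<epsilon> * x} else {})" for j
    have "(\<lambda>\<omega>. \<Sum>n=1..j. Rm k n \<omega>) \<in> borel_measurable RA" for j
      using Rm_RA by (intro borel_measurable_sum)
    hence "{\<omega> \<in> space M. (\<Sum>n=1..j. Rm k n \<omega>) > y} \<in> sets RA" for j y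
      using measurable_sets[of "\<lambda>\<omega>. \<Sum>n=1..j. Rm k n \<omega>" RA borel "{y<..}"]
      by (simp add: vimage_def Int_def conj_commute)
    hence B: "B j \<in> sets RA" for j by (simp add: B_def)
    have "\<Gamma> x > 0" by (rule tail_dominator_pos[OF \<Gamma> x])
    hence \<beta>: "prob (B j) \<le> C * real j * \<Gamma> x" for j
      using bd C(1) by (auto simp: B_def r_def)
    have int: "integrable M (\<lambda>\<omega>. C * real (N i k \<omega>) * \<Gamma> x * indicator (many i n0) \<omega>)"
      using N_int[of i k] by (intro integrable_real_mult_indicator) auto
    have "many i n0 \<inter> deviation_event i k \<epsilon> x = {\<omega> \<in> many i n0. \<omega> \<in> B (N i k \<omega>)}"
      by (auto simp: many_def deviation_event_def B_def)
    hence "prob (many i n0 \<inter> deviation_event i k \<epsilon> x)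
        \<le> expectation (\<lambda>\<omega>. C * real (N i k \<omega>) * \<Gamma> x * indicator (many i n0) \<omega>)"
      using prob_conditional_bound(2)[OF many_VA B \<beta> int] by simp
    also have "\<dots> = expectation (\<lambda>\<omega>. (C * \<Gamma> x) * (real (N i k \<omega>) * indicator (many i n0) \<omega>))"
      by (intro Bochner_Integration.integral_cong) auto
    finally show "prob (many i n0 \<inter> deviation_event i k \<epsilon> x)
        \<le> C * expectation (\<lambda>\<omega>. real (N i k \<omega>) * indicator (many i n0) \<omega>) * \<Gamma> x"
      by (simp add: mult_ac)
  qed
qed

text \<open>Outside the heavy event all N are O(x), and some row must exceed its mean line by a
  multiple of x. If some N is above \<open>n0\<close>, the deviation bound restricted to
  \<open>many\<close> makes this negligible. Otherwise there are boundedly many summands, and unless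
  one of them alone exceeds (1 - \<delta>) x, two independent exceedances are required.\<close>

proposition upper_recursion:
  assumes \<Gamma>: "tail_dominator a \<Gamma>" and a: "a > 0" and \<epsilon>: "0 < \<epsilon>" "\<epsilon> \<le> 1"
    and \<delta>: "0 < \<delta>" and \<kappa>: "\<kappa> > 0"
  shows "\<forall>\<^sub>F x in at_top. H i x \<le>
    prob (heavy i (\<lambda>k. r k + \<epsilon>) ((1 - \<epsilon>) * x))
    + (\<Sum>k\<in>UNIV. m i k * H k ((1 - \<delta>) * x)) + \<kappa> * \<Gamma> x"
proof -
  \<comment> \<open>The slack \<epsilon> x between the two thresholds is shared equally by the
    rows.\<close>
  define \<epsilon>' where "\<epsilon>' = \<epsilon> / CARD('k)"
  have \<epsilon>': "0 < \<epsilon>'" "\<epsilon>' \<le> 1" "\<epsilon>' \<le> \<epsilon>" "CARD('k) * \<epsilon>' = \<epsilon>"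
  proof -
    have "real CARD('k) \<ge> 1" by (simp add: Suc_leI)
    hence "\<epsilon> / CARD('k) \<le> \<epsilon> / 1" using \<epsilon> by (intro divide_left_mono) auto
    thus "\<epsilon>' \<le> \<epsilon>" by (simp add: \<epsilon>'_def)
    thus "\<epsilon>' \<le> 1" using \<epsilon> by linarith
  qed (use \<epsilon> in \<open>auto simp: \<epsilon>'_def\<close>)
  define dev where "dev k C \<longleftrightarrow> (\<forall>\<^sub>F x in at_top. \<forall>n0. prob (many i n0 \<inter> deviation_event i k \<epsilon>' x)
    \<le> C * expectation (\<lambda>\<omega>. real (N i k \<omega>) * indicator (many i n0) \<omega>) * \<Gamma> x)" for k C
  have "\<forall>k. \<exists>C>0. dev k C"
  proof
    fix k
    obtain C where "C > 0" "dev k C"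
      using deviation_bound[OF \<Gamma> a \<epsilon>'(1,2), of i k] unfolding dev_def by blast
    thus "\<exists>C>0. dev k C" by blast
  qed
  from choice[OF this] obtain C where C: "\<And>k. C k > 0" "\<And>k. dev k (C k)" by blast
  have "(\<lambda>n0. \<Sum>k\<in>UNIV. C k * expectation (\<lambda>\<omega>. real (N i k \<omega>) * indicator (many i n0) \<omega>)) \<longlonglongrightarrow> (\<Sum>k\<in>UNIV. C k * 0)"
  proof (intro tendsto_sum tendsto_mult tendsto_const expectation_tail_tendsto_0 N_int)
    fix \<omega>
    show "\<forall>\<^sub>F n in sequentially. \<omega> \<notin> many i n"
      using eventually_ge_at_top[of "Max (range (\<lambda>k. N i k \<omega>))"]
      by eventually_elim (auto simp: many_def not_less)
  qed measurable
  hence "\<forall>\<^sub>F n0 in sequentially. (\<Sum>k\<in>UNIV. C k * expectation (\<lambda>\<omega>. real (N i k \<omega>) * indicator (many i n0) \<omega>)) < \<kappa> / 2"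
    using \<kappa> by (intro order_tendstoD) auto
  then obtain n0 where n0: "(\<Sum>k\<in>UNIV. C k * expectation (\<lambda>\<omega>. real (N i k \<omega>) * indicator (many i n0) \<omega>)) < \<kappa> / 2"
    using eventually_happens'[OF sequentially_bot] by blast
  \<comment> \<open>The denominator exceeds both n0 and 2 CARD('k) n0, as \<open>two_jumps\<close>
    requires, and is positive also for n0 = 0. The cap at 1 makes 1 / \<eta> an admissible ratio in
    the domination clause.\<close>
  define \<eta> where "\<eta> = min 1 (min \<epsilon>' \<delta> / (4 * real CARD('k) * (n0 + 1)))"
  have den: "4 * real CARD('k) * (n0 + 1) > 0" by simp
  have \<eta>0: "0 < \<eta>" "\<eta> \<le> 1" using \<epsilon>' \<delta> den by (auto simp: \<eta>_def intro!: divide_pos_pos)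
  have "\<eta> \<le> min \<epsilon>' \<delta> / (4 * real CARD('k) * (n0 + 1))" by (simp add: \<eta>_def)
  hence \<eta>_le: "\<eta> * (4 * real CARD('k) * (n0 + 1)) \<le> min \<epsilon>' \<delta>"
    using den by (subst (asm) pos_le_divide_eq) auto
  have K1: "1 \<le> real CARD('k)" by (simp add: Suc_leI)
  have \<eta>: "\<eta> * n0 < \<epsilon>'" "\<eta> * (2 * real CARD('k) * n0) < \<delta>"
  proof -
    have le: "real n0 \<le> real CARD('k) * n0" using K1 mult_right_mono[of 1 "real CARD('k)" "real n0"] by simp
    have eq: "4 * real CARD('k) * (n0 + 1) = 4 * (real CARD('k) * n0) + 4 * real CARD('k)"
      by (simp add: algebra_simps)
    have "real n0 < 4 * real CARD('k) * (n0 + 1)" unfolding eq using le K1 by linarith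
    hence "\<eta> * n0 < \<eta> * (4 * real CARD('k) * (n0 + 1))"
      using \<eta>0 by (intro mult_strict_left_mono)
    thus "\<eta> * n0 < \<epsilon>'" using \<eta>_le by simp
    have "2 * real CARD('k) * n0 = 2 * (real CARD('k) * n0)" by simp
    hence "2 * real CARD('k) * n0 < 4 * real CARD('k) * (n0 + 1)" using eq le K1 by linarith
    hence "\<eta> * (2 * real CARD('k) * n0) < \<eta> * (4 * real CARD('k) * (n0 + 1))"
      using \<eta>0 by (intro mult_strict_left_mono)
    hence "\<eta> * (2 * real CARD('k) * n0) < min \<epsilon>' \<delta>" using \<eta>_le by (rule less_le_trans)
    thus "\<eta> * (2 * real CARD('k) * n0) < \<delta>" by simp
  qed
  define c1 where "c1 = real CARD('k) * real n0"
  \<comment> \<open>The bound for two jumps with one factor h(\<eta> x) taken out. That factor is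
    O(\<Gamma>(x)) by domination, while \<open>?q x\<close> tends to 0.\<close>
  let ?q = "\<lambda>x. c1 * prob {\<omega> \<in> space M. Q i \<omega> > \<delta> / 2 * x} + c1\<^sup>2 * h (\<eta> * x)"
  have "((\<lambda>x. ?q x * (real CARD('k) * (1 / \<eta>) powr a)) \<longlongrightarrow>
      (c1 * 0 + c1\<^sup>2 * 0) * (real CARD('k) * (1 / \<eta>) powr a)) at_top"
  proof (intro tendsto_intros)
    have f: "filterlim (\<lambda>x. c * x) at_top at_top" if "c > 0" for c :: real
      using filterlim_tendsto_pos_mult_at_top[OF tendsto_const that filterlim_ident] .
    show "((\<lambda>x. prob {\<omega> \<in> space M. Q i \<omega> > \<delta> / 2 * x}) \<longlongrightarrow> 0) at_top"
      using filterlim_compose[OF prob_gt_tendsto_0[OF Q_rv] f[of "\<delta> / 2"]] \<delta> by simp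
    show "((\<lambda>x. h (\<eta> * x)) \<longlongrightarrow> 0) at_top"
      using filterlim_compose[OF h_tendsto_0 f[OF \<eta>0(1)]] .
  qed
  hence ev_q: "\<forall>\<^sub>F x in at_top. ?q x * (real CARD('k) * (1 / \<eta>) powr a) < \<kappa> / 2"
    using \<kappa> by (intro order_tendstoD) auto
  have ev_C: "\<forall>\<^sub>F x in at_top. \<forall>k. \<forall>n0. prob (many i n0 \<inter> deviation_event i k \<epsilon>' x)
    \<le> C k * expectation (\<lambda>\<omega>. real (N i k \<omega>) * indicator (many i n0) \<omega>) * \<Gamma> x"
    using C(2) unfolding dev_def by (rule eventually_all_finite)
  show ?thesis using ev_q ev_C eventually_ge_at_top[of 1]
  proof eventually_elim
    case (elim x)
    hence x: "x > 0" by simp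
    let ?A = "heavy i (\<lambda>k. r k + \<epsilon>) ((1 - \<epsilon>) * x)"
    let ?B = "\<lambda>k. {\<omega> \<in> space M. \<exists>n\<in>{1..N i k \<omega>}. Rm k n \<omega> > (1 - \<delta>) * x}"
    let ?D = "\<lambda>k. many i n0 \<inter> deviation_event i k \<epsilon>' x"
    let ?T = "two_jump_event i n0 (\<eta> * x) (\<delta> / 2 * x)"
    have ev: "?A \<in> events" "(\<Union>k. ?B k) \<in> events" "(\<Union>k. ?D k) \<in> events" "?T \<in> events"
      using big_jump_bound(1) by (auto intro!: sets.finite_UN)
    have "prob {\<omega> \<in> space M. S i \<omega> > x} \<le> prob (?A \<union> (\<Union>k. ?B k) \<union> (\<Union>k. ?D k) \<union> ?T)"
    proof (rule finite_measure_mono_AE)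
      show "AE \<omega> in M. \<omega> \<in> {\<omega> \<in> space M. S i \<omega> > x} \<longrightarrow> \<omega> \<in> ?A \<union> (\<Union>k. ?B k) \<union> (\<Union>k. ?D k) \<union> ?T"
        using AE_Rm_nonneg
      proof eventually_elim
        case nonneg: (elim \<omega>)
        show ?case
        proof (intro impI, rule ccontr)
          assume S: "\<omega> \<in> {\<omega> \<in> space M. S i \<omega> > x}"
            and "\<omega> \<notin> ?A \<union> (\<Union>k. ?B k) \<union> (\<Union>k. ?D k) \<union> ?T"
          hence \<omega>: "\<omega> \<in> space M" and nA: "\<omega> \<notin> ?A" and nB: "\<And>k. \<omega> \<notin> ?B k"
            and nD: "\<And>k. \<omega> \<notin> ?D k" and nT: "\<omega> \<notin> ?T" by auto
          have A: "Q i \<omega> + (\<Sum>k\<in>UNIV. (r k + \<epsilon>) * N i k \<omega>) \<le> (1 - \<epsilon>) * x" using nA \<omega> by (simp add: heavy_def not_less)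
          \<comment> \<open>The coefficients r k + \<epsilon> are bounded away from 0 even when r k
            = 0, so the heavy part controls every N.\<close>
          have N_le: "real (N i k \<omega>) \<le> x / \<epsilon>'" for k
          proof -
            have "\<epsilon>' * N i k \<omega> \<le> (r k + \<epsilon>) * N i k \<omega>"
              using r_nonneg[of k] \<epsilon>' by (intro mult_right_mono) auto
            also have "\<dots> \<le> (\<Sum>k\<in>UNIV. (r k + \<epsilon>) * N i k \<omega>)"
              using r_nonneg \<epsilon> by (intro member_le_sum[of k UNIV "\<lambda>k. (r k + \<epsilon>) * N i k \<omega>"]) (auto intro!: add_nonneg_nonneg mult_nonneg_nonneg)
            also have "\<dots> \<le> (1 - \<epsilon>) * x" using A Q_nonneg[OF \<omega>, of i] by linarith
            also have "\<dots> \<le> x" using \<epsilon> x by (simp add: algebra_simps)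
            finally show ?thesis using \<epsilon>' by (simp add: field_simps)
          qed
          have "\<exists>k. (\<Sum>n=1..N i k \<omega>. Rm k n \<omega>) > N i k \<omega> * (r k + \<epsilon>') + \<epsilon>' * x"
          proof (rule ccontr)
            assume "\<not> ?thesis"
            hence "(\<Sum>k\<in>UNIV. \<Sum>n=1..N i k \<omega>. Rm k n \<omega>) \<le> (\<Sum>k\<in>UNIV. N i k \<omega> * (r k + \<epsilon>') + \<epsilon>' * x)"
              by (intro sum_mono) (auto simp: not_less)
            also have "\<dots> \<le> (\<Sum>k\<in>UNIV. (r k + \<epsilon>) * N i k \<omega> + \<epsilon>' * x)"
              using \<epsilon>'(3) by (intro sum_mono add_right_mono) (auto simp: mult.commute intro!: mult_left_mono)
            also have "\<dots> = (\<Sum>k\<in>UNIV. (r k + \<epsilon>) * N i k \<omega>) + \<epsilon> * x"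
              using \<epsilon>'(4) by (simp add: sum.distrib mult.assoc[symmetric])
            finally show False using S A by (simp add: S_def algebra_simps)
          qed
          then obtain k0 where k0: "(\<Sum>n=1..N i k0 \<omega>. Rm k0 n \<omega>) > N i k0 \<omega> * (r k0 + \<epsilon>') + \<epsilon>' * x" by blast
          hence "\<omega> \<in> deviation_event i k0 \<epsilon>' x" using N_le \<omega> by (simp add: deviation_event_def)
          hence "\<omega> \<notin> many i n0" using nD[of k0] by blast
          hence \<nu>: "N i k \<omega> \<le> n0" for k using \<omega> by (auto simp: many_def not_less)
          have row: "(\<Sum>n=1..N i k0 \<omega>. Rm k0 n \<omega>) > \<epsilon>' * x"
            using k0 r_nonneg[of k0] \<epsilon>' by (smt (verit) mult_nonneg_nonneg of_nat_0_le_iff)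
          have small: "Rm k n \<omega> \<le> (1 - \<delta>) * x" if "n \<in> {1..N i k \<omega>}" for k n
            using nB[of k] that \<omega> by (auto simp: not_less)
          have "(Q i \<omega> > \<delta> / 2 * x \<and> (\<exists>p\<in>UNIV \<times> {1..n0}. Rm (fst p) (snd p) \<omega> > \<eta> * x)) \<or>
            (\<exists>p\<in>UNIV \<times> {1..n0}. \<exists>p'\<in>UNIV \<times> {1..n0}. p \<noteq> p' \<and>
                Rm (fst p) (snd p) \<omega> > \<eta> * x \<and> Rm (fst p') (snd p') \<omega> > \<eta> * x)"
            by (rule two_jumps[of \<epsilon>' \<delta> x \<eta> n0 "\<lambda>k n. Rm k n \<omega>" "\<lambda>k. N i k \<omega>" k0 "Q i \<omega>"])
              (use \<epsilon>' \<delta> x \<eta>0 \<eta> nonneg \<nu> small row S in \<open>auto simp: S_def\<close>)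
          hence "\<omega> \<in> ?T" unfolding two_jump_event_def using \<omega> by blast
          with nT show False ..
        qed
      qed
    qed (use ev in auto)
    also have "\<dots> \<le> prob ?A + prob (\<Union>k. ?B k) + prob (\<Union>k. ?D k) + prob ?T"
      using ev by (intro order.trans[OF measure_Un_le] add_mono order.refl) auto
    also have "\<dots> \<le> prob ?A + (\<Sum>k\<in>UNIV. m i k * H k ((1 - \<delta>) * x)) + \<kappa> / 2 * \<Gamma> x + \<kappa> / 2 * \<Gamma> x"
    proof (intro add_mono order.refl)
      have "prob (\<Union>k. ?B k) \<le> (\<Sum>k\<in>UNIV. prob (?B k))"
        using big_jump_bound(1) by (intro finite_measure_subadditive_finite) auto
      also have "\<dots> \<le> (\<Sum>k\<in>UNIV. m i k * H k ((1 - \<delta>) * x))" by (intro sum_mono big_jump_bound(2))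
      finally show "prob (\<Union>k. ?B k) \<le> (\<Sum>k\<in>UNIV. m i k * H k ((1 - \<delta>) * x))" .
      have \<Gamma>x: "\<Gamma> x > 0" using tail_dominator_pos[OF \<Gamma>] elim by simp
      have "prob (\<Union>k. ?D k) \<le> (\<Sum>k\<in>UNIV. prob (?D k))"
        by (intro finite_measure_subadditive_finite) auto
      also have "\<dots> \<le> (\<Sum>k\<in>UNIV. C k * expectation (\<lambda>\<omega>. real (N i k \<omega>) * indicator (many i n0) \<omega>) * \<Gamma> x)"
        using elim by (intro sum_mono) auto
      also have "\<dots> = (\<Sum>k\<in>UNIV. C k * expectation (\<lambda>\<omega>. real (N i k \<omega>) * indicator (many i n0) \<omega>)) * \<Gamma> x"
        by (simp add: sum_distrib_right)
      also have "\<dots> \<le> \<kappa> / 2 * \<Gamma> x" using n0 \<Gamma>x by (intro mult_right_mono) auto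
      finally show "prob (\<Union>k. ?D k) \<le> \<kappa> / 2 * \<Gamma> x" .
      have "h (\<eta> * x) \<le> CARD('k) * (1 / \<eta>) powr a * \<Gamma> x"
      proof -
        have "H k (\<eta> * x) \<le> (1 / \<eta>) powr a * \<Gamma> x" for k
        proof -
          have "H k (\<eta> * x) \<le> \<Gamma> (x / (1 / \<eta>))"
            using tail_dominatorD(1)[OF \<Gamma>, of "\<eta> * x" k] \<eta>0 x by (simp add: mult.commute)
          also have "\<dots> \<le> (1 / \<eta>) powr a * \<Gamma> x"
            using \<eta>0 x by (intro tail_dominatorD(2)[OF \<Gamma>]) auto
          finally show ?thesis .
        qed
        hence "h (\<eta> * x) \<le> (\<Sum>k\<in>(UNIV :: 'k set). (1 / \<eta>) powr a * \<Gamma> x)" unfolding h_def by (intro sum_mono)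
        thus ?thesis by (simp add: mult.assoc)
      qed
      hence "?q x * h (\<eta> * x) \<le> ?q x * (CARD('k) * (1 / \<eta>) powr a * \<Gamma> x)"
        using h_nonneg by (intro mult_left_mono) (auto simp: c1_def)
      also have "\<dots> = ?q x * (CARD('k) * (1 / \<eta>) powr a) * \<Gamma> x" by simp
      also have "\<dots> \<le> \<kappa> / 2 * \<Gamma> x" using elim(1) \<Gamma>x by (intro mult_right_mono) auto
      finally have "?q x * h (\<eta> * x) \<le> \<kappa> / 2 * \<Gamma> x" .
      thus "prob ?T \<le> \<kappa> / 2 * \<Gamma> x"
        using prob_two_jump_event[of i n0 "\<eta> * x" "\<delta> / 2 * x"] by (simp add: c1_def algebra_simps power2_eq_square)
    qed
    finally show ?case by (simp add: H_eq_S)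
  qed
qed

text \<open>Three contributions: the heavy event minus its failures by lower deviations, a single
  large summand outside the heavy event, and the Bonferroni correction. The rates s do not depend on
  x or \<open>n0\<close>.\<close>

definition lower_estimate :: "'k \<Rightarrow> ('k \<Rightarrow> real) \<Rightarrow> real \<Rightarrow> ('k \<Rightarrow> real) \<Rightarrow> bool" where
  "lower_estimate i \<rho> \<epsilon> s \<longleftrightarrow> (\<forall>x n0. x > 0 \<longrightarrow>
    prob (heavy i \<rho> ((1 + \<epsilon>) * x)) * (1 - (\<Sum>k\<in>UNIV. exp (- s k * x)))
    + (\<Sum>k\<in>UNIV. \<Sum>n=1..n0. prob ({\<omega> \<in> space M. N i k \<omega> \<ge> n} - heavy i \<rho> ((1 + \<epsilon>) * x)) * H k x)
    - (CARD('k) * n0)\<^sup>2 * (h x)\<^sup>2 \<le> H i x)"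

text \<open>Two disjoint scenarios force S > x up to a null set: a heavy weight part whose rows do
  not fall far below \<rho> k per summand, or one summand above x outside the heavy event. Allowing
  \<rho> k = 0 covers types with r k = 0, where no non-negative value lies strictly below the
  mean.\<close>

proposition lower_recursion:
  assumes \<rho>: "\<And>k. 0 \<le> \<rho> k" "\<And>k. \<rho> k = 0 \<or> \<rho> k < r k" and \<epsilon>: "\<epsilon> > 0"
  shows "\<exists>s. (\<forall>k. s k > 0) \<and> lower_estimate i \<rho> \<epsilon> s"
proof -
  define \<epsilon>' where "\<epsilon>' = \<epsilon> / CARD('k)"
  have \<epsilon>': "0 < \<epsilon>'" "CARD('k) * \<epsilon>' = \<epsilon>" using \<epsilon> by (auto simp: \<epsilon>'_def)
  define lo where "lo k s \<longleftrightarrow> (\<forall>j. \<forall>t>0. prob {\<omega> \<in> space M. (\<Sum>n=1..j. Rm k n \<omega>) \<le> real j * \<rho> k - t} \<le> exp (- s * t))"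
    for k and s :: real
  have "\<exists>s>0. lo k s" for k
  proof (cases "\<rho> k = 0")
    \<comment> \<open>The sum is almost surely non-negative and t > 0, so the event is null and any
      rate will do.\<close>
    case True
    have "prob {\<omega> \<in> space M. (\<Sum>n=1..j. Rm k n \<omega>) \<le> j * \<rho> k - t} \<le> exp (- 1 * t)" if "t > 0" for j t
    proof -
      have "AE \<omega> in M. \<omega> \<notin> {\<omega> \<in> space M. (\<Sum>n=1..j. Rm k n \<omega>) \<le> j * \<rho> k - t}"
        using AE_Rm_nonneg
      proof eventually_elim
        case (elim \<omega>)
        hence "0 \<le> (\<Sum>n=1..j. Rm k n \<omega>)" by (intro sum_nonneg) auto
        hence "\<not> (\<Sum>n=1..j. Rm k n \<omega>) \<le> real j * \<rho> k - t" using that unfolding True by linarith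
        thus ?case by blast
      qed
      hence "prob {\<omega> \<in> space M. (\<Sum>n=1..j. Rm k n \<omega>) \<le> j * \<rho> k - t} = 0"
        by (intro measure_eq_0_null_sets) (auto simp: AE_iff_null_sets)
      thus ?thesis by simp
    qed
    hence "lo k 1" unfolding lo_def by blast
    thus ?thesis by (intro exI[of _ 1]) auto
  next
    case False
    hence "\<rho> k < expectation (R k)" using \<rho>(2)[of k] by (auto simp: r_def)
    from lower_deviation_bound[OF Rm_indep_row Rm_distr R_int R_nonneg this]
    obtain s where "s > 0" "\<And>j t. prob {\<omega> \<in> space M. (\<Sum>n=1..j. Rm k n \<omega>) \<le> real j * \<rho> k - t} \<le> exp (- s * t)"
      by blast
    thus ?thesis unfolding lo_def by blast
  qed
  hence "\<forall>k. \<exists>s>0. lo k s" by blast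
  from choice[OF this] obtain s where s_lo: "\<And>k. s k > 0" "\<And>k. lo k (s k)" by blast
  have s: "s k > 0"
    "t > 0 \<Longrightarrow> prob {\<omega> \<in> space M. (\<Sum>n=1..j. Rm k n \<omega>) \<le> real j * \<rho> k - t} \<le> exp (- s k * t)" for k j t
    using s_lo unfolding lo_def by blast+
  show ?thesis
    unfolding lower_estimate_def
  proof (intro exI[of _ "\<lambda>k. s k * \<epsilon>'"] conjI allI impI)
    show "s k * \<epsilon>' > 0" for k using s \<epsilon>' by simp
    fix x :: real and n0 :: nat
    assume x: "x > 0"
    let ?A = "heavy i \<rho> ((1 + \<epsilon>) * x)"
    let ?J = "UNIV \<times> {1..n0} :: ('k \<times> nat) set"
    have A_VA: "?A \<in> sets (VA i)" and A: "?A \<in> events" by (rule heavy_VA heavy_events)+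
    \<comment> \<open>Heavy outcomes whose row k falls short of its share by more than its part of
      the slack \<epsilon> x, or by exactly that part.\<close>
    define L where "L k = {\<omega> \<in> ?A. (\<Sum>n=1..N i k \<omega>. Rm k n \<omega>) \<le> N i k \<omega> * \<rho> k - \<epsilon>' * x}" for k
    have L: "L k \<in> events" "prob (L k) \<le> prob ?A * exp (- (s k * \<epsilon>') * x)" for k
    proof -
      define B where "B j = {\<omega> \<in> space M. (\<Sum>n=1..j. Rm k n \<omega>) \<le> j * \<rho> k - \<epsilon>' * x}" for j :: nat
      have eq: "B j = (\<lambda>\<omega>. \<Sum>n=1..j. Rm k n \<omega>) -` {..real j * \<rho> k - \<epsilon>' * x} \<inter> space RA" for j
        by (auto simp: B_def)
      have B: "B j \<in> sets RA" for j
        unfolding eq using Rm_RA by (intro measurable_sets[of _ RA borel] borel_measurable_sum) auto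
      have \<beta>: "prob (B j) \<le> exp (- (s k * \<epsilon>') * x)" for j
        using s(2)[of "\<epsilon>' * x" k j] x \<epsilon>' by (simp add: B_def mult.assoc)
      have int: "integrable M (\<lambda>\<omega>. exp (- (s k * \<epsilon>') * x) * indicator ?A \<omega>)"
        using A by (auto simp: emeasure_eq_measure intro!: integrable_real_indicator)
      have eq: "L k = {\<omega> \<in> ?A. \<omega> \<in> B (N i k \<omega>)}" by (auto simp: L_def B_def heavy_def)
      note * = prob_conditional_bound[OF A_VA B \<beta> int]
      show "L k \<in> events" unfolding eq by (rule *(1))
      show "prob (L k) \<le> prob ?A * exp (- (s k * \<epsilon>') * x)" unfolding eq using *(2) A by (simp add: mult.commute)
    qed
    define D where "D p = ({\<omega> \<in> space M. N i (fst p) \<omega> \<ge> snd p} - ?A) \<inter> {\<omega> \<in> space M. Rm (fst p) (snd p) \<omega> > x}" for p :: "'k \<times> nat"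
    have N_VA': "{\<omega> \<in> space M. N i k \<omega> \<ge> n} \<in> sets (VA i)" for k n
      using N_eq_VA[of "\<lambda>y. y \<ge> real n" i k] by simp
    have D_prob: "prob (D p) = prob ({\<omega> \<in> space M. N i (fst p) \<omega> \<ge> snd p} - ?A) * H (fst p) x" for p
      unfolding D_def using V_indep[OF sets.Diff[OF N_VA' A_VA] Rm_gt_RA] by (simp add: prob_Rm)
    have D: "D p \<in> events" for p
      unfolding D_def using A by measurable
    have D2: "prob (D p \<inter> D q) \<le> (h x)\<^sup>2" if "p \<noteq> q" for p q
    proof -
      have "prob (D p \<inter> D q) \<le> prob {\<omega> \<in> space M. Rm (fst p) (snd p) \<omega> > x \<and> Rm (fst q) (snd q) \<omega> > x}"
        by (intro finite_measure_mono) (auto simp: D_def)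
      also have "\<dots> \<le> (h x)\<^sup>2" unfolding prob_two_Rm[OF that] power2_eq_square
        by (intro mult_mono H_le_h H_nonneg h_nonneg)
      finally show ?thesis .
    qed
    have "(\<Sum>p\<in>?J. prob (D p)) - (real (card ?J))\<^sup>2 * (h x)\<^sup>2 \<le> prob (\<Union>p\<in>?J. D p)"
      by (intro prob_Union_ge D D2) auto
    moreover have "(\<Sum>p\<in>?J. prob (D p)) = (\<Sum>k\<in>UNIV. \<Sum>n=1..n0. prob ({\<omega> \<in> space M. N i k \<omega> \<ge> n} - ?A) * H k x)"
      unfolding D_prob by (subst sum.cartesian_product) (simp add: case_prod_unfold)
    ultimately have UD: "(\<Sum>k\<in>UNIV. \<Sum>n=1..n0. prob ({\<omega> \<in> space M. N i k \<omega> \<ge> n} - ?A) * H k x)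
        - (CARD('k) * n0)\<^sup>2 * (h x)\<^sup>2 \<le> prob (\<Union>p\<in>?J. D p)"
      by (simp add: card_cartesian_product)
    have "prob (\<Union>k. L k) \<le> (\<Sum>k\<in>UNIV. prob (L k))" using L(1) by (intro finite_measure_subadditive_finite) auto
    also have "\<dots> \<le> (\<Sum>k\<in>UNIV. prob ?A * exp (- (s k * \<epsilon>') * x))" by (intro sum_mono L(2))
    finally have UL: "prob (\<Union>k. L k) \<le> prob ?A * (\<Sum>k\<in>UNIV. exp (- (s k * \<epsilon>') * x))"
      by (simp add: sum_distrib_left)
    have LA: "(\<Union>k. L k) \<subseteq> ?A" by (auto simp: L_def)
    have UL_ev: "(\<Union>k. L k) \<in> events" using L(1) by (intro sets.finite_UN) auto
    have UD_ev: "(\<Union>p\<in>?J. D p) \<in> events" using D by (intro sets.finite_UN) auto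
    \<comment> \<open>Each \<open>D p\<close> was defined outside the heavy event, so the two
      scenarios are disjoint and their probabilities add.\<close>
    have "prob ?A - prob (\<Union>k. L k) + prob (\<Union>p\<in>?J. D p) = prob ((?A - (\<Union>k. L k)) \<union> (\<Union>p\<in>?J. D p))"
    proof (subst finite_measure_Union)
      show "(?A - (\<Union>k. L k)) \<inter> (\<Union>p\<in>?J. D p) = {}" unfolding D_def by blast
    qed (use finite_measure_Diff[OF A UL_ev LA] A UL_ev UD_ev in auto)
    also have "\<dots> \<le> prob {\<omega> \<in> space M. S i \<omega> > x}"
    proof (rule finite_measure_mono_AE)
      show "AE \<omega> in M. \<omega> \<in> (?A - (\<Union>k. L k)) \<union> (\<Union>p\<in>?J. D p) \<longrightarrow> \<omega> \<in> {\<omega> \<in> space M. S i \<omega> > x}"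
        using AE_Rm_nonneg
      proof eventually_elim
        case nonneg: (elim \<omega>)
        show ?case
        proof
          assume \<omega>_in: "\<omega> \<in> (?A - (\<Union>k. L k)) \<union> (\<Union>p\<in>?J. D p)"
          hence \<omega>: "\<omega> \<in> space M" unfolding D_def heavy_def by blast
          show "\<omega> \<in> {\<omega> \<in> space M. S i \<omega> > x}"
          proof (cases "\<omega> \<in> ?A - (\<Union>k. L k)")
            case True
            hence "(\<Sum>n=1..N i k \<omega>. Rm k n \<omega>) \<ge> N i k \<omega> * \<rho> k - \<epsilon>' * x" for k
              by (auto simp: L_def not_le intro: less_imp_le)
            hence "(\<Sum>k\<in>UNIV. \<Sum>n=1..N i k \<omega>. Rm k n \<omega>) \<ge> (\<Sum>k\<in>UNIV. N i k \<omega> * \<rho> k - \<epsilon>' * x)"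
              by (intro sum_mono)
            also have "(\<Sum>k\<in>UNIV. N i k \<omega> * \<rho> k - \<epsilon>' * x) = (\<Sum>k\<in>UNIV. \<rho> k * N i k \<omega>) - \<epsilon> * x"
              using \<epsilon>'(2) by (simp add: sum_subtractf mult.assoc[symmetric] mult.commute[of _ "\<rho> _"])
            finally show ?thesis using True \<omega> by (simp add: heavy_def S_def algebra_simps)
          next
            case False
            then obtain k n where kn: "n \<in> {1..n0}" "n \<le> N i k \<omega>" "Rm k n \<omega> > x"
              using \<omega>_in by (auto simp: D_def)
            have "Rm k n \<omega> \<le> (\<Sum>n=1..N i k \<omega>. Rm k n \<omega>)"
              using kn nonneg by (intro member_le_sum[of n _ "\<lambda>n. Rm k n \<omega>"]) auto
            also have "\<dots> \<le> (\<Sum>k\<in>UNIV. \<Sum>n=1..N i k \<omega>. Rm k n \<omega>)"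
              using nonneg by (intro member_le_sum[of k UNIV "\<lambda>k. \<Sum>n=1..N i k \<omega>. Rm k n \<omega>"]) (auto intro: sum_nonneg)
            finally show ?thesis using kn \<omega> Q_nonneg[OF \<omega>, of i] by (simp add: S_def)
          qed
        qed
      qed
    qed measurable
    finally show "prob ?A * (1 - (\<Sum>k\<in>UNIV. exp (- (s k * \<epsilon>') * x)))
        + (\<Sum>k\<in>UNIV. \<Sum>n=1..n0. prob ({\<omega> \<in> space M. N i k \<omega> \<ge> n} - ?A) * H k x)
        - (CARD('k) * n0)\<^sup>2 * (h x)\<^sup>2 \<le> H i x"
      using UD UL unfolding H_eq_S right_diff_distrib by linarith
  qed
qed

end

section \<open>Tail asymptotics of the fixed point\<close>

text \<open>The infimum of the admissible t cannot be positive, since the step would lead below it.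
  The step is stated for all t' > \<rho> t because passing to a limit proves a bound only up to an
  arbitrarily small loss.\<close>

lemma contraction_to_zero:
  fixes P :: "real \<Rightarrow> bool"
  assumes \<rho>: "0 \<le> \<rho>" "\<rho> < 1" and start: "t0 \<ge> 0" "P t0"
    and step: "\<And>t t'. t \<ge> 0 \<Longrightarrow> P t \<Longrightarrow> t' > \<rho> * t \<Longrightarrow> P t'"
    and \<tau>: "\<tau> > 0"
  shows "P \<tau>"
proof -
  define T where "T = {t. t \<ge> 0 \<and> P t}"
  have T: "T \<noteq> {}" "bdd_below T" using start by (auto simp: T_def intro: bdd_belowI[of _ 0])
  define \<sigma> where "\<sigma> = Inf T"
  have \<sigma>_le: "\<sigma> \<le> t" if "t \<in> T" for t unfolding \<sigma>_def using that T by (intro cInf_lower)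
  have ex: "\<exists>t\<in>T. t < y" if "\<sigma> < y" for y
    using cInf_less_iff[OF T, of y] that unfolding \<sigma>_def by simp
  have "\<sigma> \<le> 0"
  proof (rule ccontr)
    assume "\<not> \<sigma> \<le> 0"
    hence "\<sigma> > 0" by simp
    hence "(1 - \<rho>) * \<sigma> > 0" using \<rho> by simp
    \<comment> \<open>The margin is such that \<rho> t stays below (1 - (1 - \<rho>)^2) \<sigma> <
      \<sigma>; the midpoint of \<rho> t and \<sigma> is then admissible but below the
      infimum.\<close>
    then obtain t where t: "t \<in> T" "t < \<sigma> + (1 - \<rho>) * \<sigma>" using ex by force
    have "\<rho> * t \<le> \<rho> * (\<sigma> + (1 - \<rho>) * \<sigma>)" using t \<rho> by (intro mult_left_mono) auto
    also have "\<dots> = \<sigma> - (1 - \<rho>) * ((1 - \<rho>) * \<sigma>)" by (simp add: algebra_simps)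
    also have "\<dots> < \<sigma>" using \<rho> \<open>\<sigma> > 0\<close> by simp
    finally have lt: "\<rho> * t < \<sigma>" .
    have "\<rho> * t \<ge> 0" using t \<rho> by (simp add: T_def)
    hence "(\<rho> * t + \<sigma>) / 2 \<in> T" using step[of t "(\<rho> * t + \<sigma>) / 2"] t lt by (simp add: T_def)
    from \<sigma>_le[OF this] show False using lt by simp
  qed
  then obtain t where t: "t \<in> T" "t < \<tau>" using ex[of \<tau>] \<tau> by auto
  \<comment> \<open>Because \<rho> t <= t, the step also raises an admissible t below \<tau> to
    \<tau> itself.\<close>
  have "\<rho> * t \<le> 1 * t" using \<rho> t by (intro mult_right_mono) (auto simp: T_def)
  thus ?thesis using step[of t \<tau>] t by (simp add: T_def)
qed

text \<open>Multivariate regular variation enters only through two consequences: the tail limits of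
  non-negative linear functionals, and the continuity of these limits in the coefficients.\<close>

locale branching_tail = branching_fixed_point M Q N Rm R + regularly_varying_tail G \<alpha>
  for M :: "'a measure" and Q :: "'k::finite \<Rightarrow> 'a \<Rightarrow> real" and N Rm R and G \<alpha> +
  fixes c :: "'k \<Rightarrow> real ^ 'k option \<Rightarrow> real" and w :: "real ^ 'k"
  assumes weighted_tail: "\<And>i v. (\<And>j. v $ j \<ge> 0) \<Longrightarrow>
      ((\<lambda>x. measure M {\<omega> \<in> space M. (\<Sum>j\<in>UNIV. v $ j * weight_vector Q N i \<omega> $ j) > x} / G x) \<longlongrightarrow> c i v) at_top"
    and c_limit: "\<And>i v v0. (\<And>j. (\<lambda>n. v n $ j) \<longlonglongrightarrow> v0 $ j) \<Longrightarrow> (\<And>n j. v n $ j \<ge> 0) \<Longrightarrow>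
      (\<lambda>n. c i (v n)) \<longlonglongrightarrow> c i v0"
    and w_ge_1: "\<And>i. w $ i \<ge> 1"
    and w_eq: "\<And>i. w $ i = 1 + (\<Sum>k\<in>UNIV. integral\<^sup>L M (\<lambda>\<omega>. real (N i k \<omega>)) * w $ k)"
begin

lemma G_nonneg: "G x \<ge> 0"
  using pos[of x] by simp

lemma divide_G_mono: "x \<le> y \<Longrightarrow> x / G z \<le> y / G z"
  by (intro divide_right_mono G_nonneg)

lemma sum_m_w: "(\<Sum>k\<in>UNIV. m i k * w $ k) = w $ i - 1"
  using w_eq[of i] by (simp add: m_def)

definition "W = Max (range (($) w))"
definition "\<rho> = 1 - 1 / W"

lemma w_le_W: "w $ i \<le> W"
  unfolding W_def by simp

lemma W_ge_1: "W \<ge> 1"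
  using w_ge_1[of undefined] w_le_W[of undefined] by linarith

lemma \<rho>: "0 \<le> \<rho>" "\<rho> < 1"
  using W_ge_1 by (auto simp: \<rho>_def)

lemma sum_m_w_le: "(\<Sum>k\<in>UNIV. m i k * w $ k) \<le> \<rho> * w $ i"
proof -
  have "w $ i / W \<le> 1" using w_le_W[of i] W_ge_1 by simp
  thus ?thesis unfolding sum_m_w \<rho>_def by (simp add: algebra_simps)
qed

definition coeffs :: "real \<Rightarrow> ('k \<Rightarrow> real) \<Rightarrow> real ^ 'k option" where
  "coeffs q v = (\<chi> j. case j of None \<Rightarrow> q | Some k \<Rightarrow> v k)"

text \<open>Dividing by q moves the rescaled threshold into the coefficients, so that continuity of
  c also handles thresholds (1 - \<epsilon>) x and (1 + \<epsilon>) x.\<close>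

lemma weighted_tail_coeffs:
  fixes v :: "'k \<Rightarrow> real"
  assumes "q > 0" "\<And>k. v k \<ge> 0"
  shows "((\<lambda>x. prob (heavy i v (q * x)) / G x)
    \<longlongrightarrow> c i (coeffs (1 / q) (\<lambda>k. v k / q))) at_top"
proof -
  have "(\<Sum>j\<in>UNIV. coeffs (1 / q) (\<lambda>k. v k / q) $ j * weight_vector Q N i \<omega> $ j)
      = (Q i \<omega> + (\<Sum>k\<in>UNIV. v k * N i k \<omega>)) / q" for \<omega>
    unfolding sum_UNIV_option coeffs_def weight_vector_def
    by (simp add: add_divide_distrib sum_divide_distrib)
  hence eq: "(x < (\<Sum>j\<in>UNIV. coeffs (1 / q) (\<lambda>k. v k / q) $ j * weight_vector Q N i \<omega> $ j))
      \<longleftrightarrow> Q i \<omega> + (\<Sum>k\<in>UNIV. v k * N i k \<omega>) > q * x" for \<omega> x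
    using assms(1) by (simp add: pos_less_divide_eq mult.commute)
  have "coeffs (1 / q) (\<lambda>k. v k / q) $ j \<ge> 0" for j
    using assms by (cases j) (auto simp: coeffs_def)
  from weighted_tail[OF this, of i] show ?thesis unfolding eq heavy_def .
qed

lemma weighted_tail_bounded:
  fixes v :: "'k \<Rightarrow> real"
  assumes "q > 0" "\<And>k. v k \<ge> 0"
  obtains C where "C > 0" "\<forall>\<^sub>F x in at_top. \<forall>i.
    prob (heavy i v (q * x)) \<le> C * G x"
proof
  define L where "L i = c i (coeffs (1 / q) (\<lambda>k. v k / q))" for i
  have "\<bar>L undefined\<bar> \<le> Max (range (\<lambda>i. \<bar>L i\<bar>))" by simp
  thus "(1 + Max (range (\<lambda>i. \<bar>L i\<bar>))) > 0"
    using abs_ge_zero[of "L undefined"] by linarith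
  have "\<forall>\<^sub>F x in at_top. prob (heavy i v (q * x))
      \<le> (1 + Max (range (\<lambda>i. \<bar>L i\<bar>))) * G x" for i
  proof -
    have "L i \<le> \<bar>L i\<bar>" "\<bar>L i\<bar> \<le> Max (range (\<lambda>i. \<bar>L i\<bar>))" by auto
    hence "L i < 1 + Max (range (\<lambda>i. \<bar>L i\<bar>))" by linarith
    from order_tendstoD(2)[OF weighted_tail_coeffs[where q = q and v = v and i = i, OF assms, folded L_def] this]
    show ?thesis
    proof eventually_elim
      case (elim x)
      thus ?case using pos[of x] by (simp add: pos_divide_less_eq)
    qed
  qed
  thus "\<forall>\<^sub>F x in at_top. \<forall>i. prob (heavy i v (q * x))
      \<le> (1 + Max (range (\<lambda>i. \<bar>L i\<bar>))) * G x" by (rule eventually_all_finite)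
qed

section \<open>A priori bound: the tails of \<open>R\<close> are O(G)\<close>

definition "relH x = Max (range (\<lambda>k. H k x / w $ k))"

lemma H_le_relH: "H k x \<le> w $ k * relH x"
proof -
  have "H k x / w $ k \<le> relH x" unfolding relH_def by simp
  thus ?thesis using w_ge_1[of k] by (simp add: pos_divide_le_eq mult.commute)
qed

lemma relH_leI: "(\<And>k. H k x \<le> w $ k * y) \<Longrightarrow> relH x \<le> y"
  unfolding relH_def using w_ge_1
  by (subst Max_le_iff) (auto simp: pos_divide_le_eq mult.commute less_le_trans[OF zero_less_one])

lemma relH_nonneg: "relH x \<ge> 0"
proof -
  have "0 \<le> w $ undefined * relH x" using H_nonneg[of undefined x] H_le_relH[of undefined x] by linarith
  thus ?thesis using w_ge_1[of undefined] by (simp add: zero_le_mult_iff)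
qed

lemma relH_le_1: "relH x \<le> 1"
  using H_le_1 w_ge_1 by (intro relH_leI) (auto intro: order.trans)

lemma first_moment_relH: "((\<lambda>x. x * relH x) \<longlongrightarrow> 0) at_top"
proof (rule tendsto_sandwich[OF _ _ tendsto_const])
  show "((\<lambda>x. \<Sum>k\<in>UNIV. x * H k x) \<longlongrightarrow> 0) at_top"
    by (intro tendsto_null_sum first_moment_H)
  show "\<forall>\<^sub>F x in at_top. 0 \<le> x * relH x"
    using eventually_ge_at_top[of 0] by eventually_elim (simp add: relH_nonneg)
  show "\<forall>\<^sub>F x in at_top. x * relH x \<le> (\<Sum>k\<in>UNIV. x * H k x)"
    using eventually_ge_at_top[of 0]
  proof eventually_elim
    case (elim x)
    have "relH x \<le> h x"
    proof (rule relH_leI)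
      fix k
      have "H k x \<le> 1 * h x" using H_le_h by simp
      also have "\<dots> \<le> w $ k * h x" using w_ge_1 h_nonneg by (intro mult_right_mono)
      finally show "H k x \<le> w $ k * h x" .
    qed
    hence "x * relH x \<le> x * h x" using elim by (rule mult_left_mono)
    thus ?case by (simp add: h_def sum_distrib_left)
  qed
qed

text \<open>A majorant of the tails of \<open>R\<close> that is dominatedly varying with exponent \<open>\<alpha> + 1\<close>, which makes
  the deviation bounds available before the tails of \<open>R\<close> are known to be \<open>O(G)\<close>.\<close>
definition "envelope x = 1 + (SUP u\<in>{0..x}. u powr (\<alpha> + 1) * relH u)"
definition "dominator x = W * x powr - (\<alpha> + 1) * envelope x"

lemma envelope_bdd: "bdd_above ((\<lambda>u. u powr (\<alpha> + 1) * relH u) ` {0..x})"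
proof (rule bdd_aboveI2)
  fix u assume "u \<in> {0..x}"
  thus "u powr (\<alpha> + 1) * relH u \<le> x powr (\<alpha> + 1) * 1"
    using index_pos relH_le_1 relH_nonneg by (intro mult_mono powr_mono2) auto
qed

lemma relH_le_envelope:
  assumes "0 \<le> u" "u \<le> x"
  shows "1 + u powr (\<alpha> + 1) * relH u \<le> envelope x"
  unfolding envelope_def using assms by (intro add_left_mono cSUP_upper envelope_bdd) auto

lemma envelope_leI:
  "0 \<le> x \<Longrightarrow> (\<And>u. 0 \<le> u \<Longrightarrow> u \<le> x \<Longrightarrow> u powr (\<alpha> + 1) * relH u \<le> y) \<Longrightarrow> envelope x \<le> 1 + y"
  unfolding envelope_def by (intro add_left_mono cSUP_least) auto

lemma envelope_mono: "0 \<le> x \<Longrightarrow> x \<le> y \<Longrightarrow> envelope x \<le> envelope y"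
  unfolding envelope_def by (intro add_left_mono cSUP_subset_mono envelope_bdd) auto

lemma envelope_ge_1: "0 \<le> x \<Longrightarrow> envelope x \<ge> 1"
  using relH_le_envelope[of 0 x] index_pos by simp

lemma relH_le_powr_envelope:
  assumes "x > 0" shows "relH x \<le> x powr - (\<alpha> + 1) * envelope x"
proof -
  have "x powr (\<alpha> + 1) * relH x \<le> envelope x" using relH_le_envelope[of x x] assms by simp
  hence "x powr - (\<alpha> + 1) * (x powr (\<alpha> + 1) * relH x) \<le> x powr - (\<alpha> + 1) * envelope x"
    by (intro mult_left_mono) auto
  also have "x powr - (\<alpha> + 1) * (x powr (\<alpha> + 1) * relH x) = relH x"
    using assms by (simp add: mult.assoc[symmetric] flip: powr_add)
  finally show ?thesis .
qed

text \<open>Since \<open>envelope\<close> is monotone, shrinking the argument by l costs only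
  l^(\<alpha> + 1) from the power. For the decay, the supremum is split at a point x1: below it the
  contribution to x times the dominator is a constant times x^(-\<alpha>), above it the finite mean
  makes u relH(u) small.\<close>

lemma dominator: "tail_dominator (\<alpha> + 1) dominator"
  unfolding tail_dominator_def
proof (intro conjI allI impI)
  fix k and u :: real assume "u > 0"
  have "H k u \<le> w $ k * relH u" by (rule H_le_relH)
  also have "\<dots> \<le> W * (u powr - (\<alpha> + 1) * envelope u)"
    using w_le_W W_ge_1 relH_nonneg relH_le_powr_envelope[OF \<open>u > 0\<close>] by (intro mult_mono) auto
  finally show "H k u \<le> dominator u" by (simp add: dominator_def)
next
  fix x l :: real assume xl: "x > 0" "l \<ge> 1"
  have "x / l \<le> x / 1" using xl by (intro divide_left_mono) auto
  hence "envelope (x / l) \<le> envelope x" using xl by (intro envelope_mono) auto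
  hence "W * (l powr (\<alpha> + 1) * x powr - (\<alpha> + 1)) * envelope (x / l)
      \<le> W * (l powr (\<alpha> + 1) * x powr - (\<alpha> + 1)) * envelope x"
    using W_ge_1 by (intro mult_left_mono) auto
  moreover have "(x / l) powr - a = l powr a * x powr - a" for a
    using xl by (simp add: powr_divide powr_minus field_simps)
  ultimately show "dominator (x / l) \<le> l powr (\<alpha> + 1) * dominator x"
    unfolding dominator_def by (simp only: mult_ac)
next
  show "dominator 1 > 0" using W_ge_1 envelope_ge_1[of 1] by (simp add: dominator_def)
next
  show "((\<lambda>x. x * dominator x) \<longlongrightarrow> 0) at_top"
  proof (rule order_tendstoI)
    fix y :: real assume "y < 0"
    show "\<forall>\<^sub>F x in at_top. y < x * dominator x"
      using eventually_gt_at_top[of 0]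
    proof eventually_elim
      case (elim x)
      hence "0 \<le> x * dominator x"
        using W_ge_1 envelope_ge_1[of x] unfolding dominator_def by (intro mult_nonneg_nonneg) auto
      thus ?case using \<open>y < 0\<close> by linarith
    qed
  next
    fix y :: real assume "0 < y"
    define \<tau> where "\<tau> = y / (2 * W)"
    have "\<tau> > 0" using \<open>0 < y\<close> W_ge_1 by (simp add: \<tau>_def)
    from order_tendstoD(2)[OF first_moment_relH this]
    obtain x0 where x0: "\<And>u. u \<ge> x0 \<Longrightarrow> u * relH u < \<tau>" by (auto simp: eventually_at_top_linorder)
    define x1 where "x1 = max x0 1"
    have "((\<lambda>x. W * (1 + x1 powr (\<alpha> + 1)) * x powr - \<alpha>) \<longlongrightarrow> 0) at_top"
      using index_pos by (intro tendsto_mult_right_zero tendsto_neg_powr filterlim_ident) auto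
    hence "\<forall>\<^sub>F x in at_top. W * (1 + x1 powr (\<alpha> + 1)) * x powr - \<alpha> < y / 2"
      using \<open>0 < y\<close> by (intro order_tendstoD) auto
    thus "\<forall>\<^sub>F x in at_top. x * dominator x < y"
      using eventually_gt_at_top[of 0]
    proof eventually_elim
      case (elim x)
      have "envelope x \<le> 1 + (x1 powr (\<alpha> + 1) + \<tau> * x powr \<alpha>)"
      proof (rule envelope_leI)
        fix u assume u: "0 \<le> u" "u \<le> x"
        show "u powr (\<alpha> + 1) * relH u \<le> x1 powr (\<alpha> + 1) + \<tau> * x powr \<alpha>"
        proof (cases "u \<ge> x1")
          case True
          hence "u > 0" "u \<ge> x0" by (auto simp: x1_def)
          have "u powr (\<alpha> + 1) * relH u = u powr \<alpha> * (u * relH u)"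
            using \<open>u > 0\<close> by (simp add: powr_add)
          also have "\<dots> \<le> x powr \<alpha> * \<tau>"
            using u x0[OF \<open>u \<ge> x0\<close>] index_pos relH_nonneg by (intro mult_mono powr_mono2) auto
          finally show ?thesis by (simp add: mult.commute add_increasing)
        next
          case False
          have "u powr (\<alpha> + 1) * relH u \<le> x1 powr (\<alpha> + 1) * 1"
            using u False index_pos relH_le_1 relH_nonneg by (intro mult_mono powr_mono2) auto
          thus ?thesis using \<open>\<tau> > 0\<close> by (simp add: add_increasing2)
        qed
      qed (use elim in auto)
      hence "x * dominator x \<le> x * (W * x powr - (\<alpha> + 1) * (1 + (x1 powr (\<alpha> + 1) + \<tau> * x powr \<alpha>)))"
        unfolding dominator_def using elim W_ge_1 by (intro mult_left_mono) auto
      also have "\<dots> = (x * x powr - (\<alpha> + 1)) * (W * (1 + x1 powr (\<alpha> + 1)) + W * \<tau> * x powr \<alpha>)"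
        by (simp add: algebra_simps)
      also have "x * x powr - (\<alpha> + 1) = x powr - \<alpha>" using elim by (simp add: powr_mult_base)
      also have "x powr - \<alpha> * (W * (1 + x1 powr (\<alpha> + 1)) + W * \<tau> * x powr \<alpha>)
          = W * (1 + x1 powr (\<alpha> + 1)) * x powr - \<alpha> + W * \<tau> * (x powr - \<alpha> * x powr \<alpha>)"
        by (simp add: algebra_simps)
      also have "x powr - \<alpha> * x powr \<alpha> = 1" using elim by (simp flip: powr_add)
      also have "W * \<tau> * 1 = y / 2" using W_ge_1 by (simp add: \<tau>_def)
      finally show ?case using elim by linarith
    qed
  qed
qed

text \<open>Multiplied by x^a, the upper recursion bounds x^a relH(x) by C x^a G(x) plus \<theta>
  times the envelope, with \<theta> < 1. Potter's bound transfers this from all u <= x to x, so the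
  supremum obeys the same inequality; the envelope is finite and can be absorbed.\<close>

proposition dominator_bigo:
  obtains C where "C > 0" "\<forall>\<^sub>F x in at_top. dominator x \<le> C * G x"
proof -
  obtain Cp x1 where potter: "Cp > 0" "x1 > 0"
    "\<And>u x. x1 \<le> u \<Longrightarrow> u \<le> x \<Longrightarrow> u powr (\<alpha> + 1) * G u \<le> Cp * (x powr (\<alpha> + 1) * G x)"
    using potter_bound[of "\<alpha> + 1"] by auto
  define a where "a = \<alpha> + 1"
  have a: "a > 0" using index_pos by (simp add: a_def)
  \<comment> \<open>Chosen so that l^(-a) = 2 / (1 + \<rho>). Then evaluating the tails at l x costs
    \<rho> l^(-a) = 2 \<rho> / (1 + \<rho>), which is at most (1 + \<rho>) / 2 < 1.\<close>
  define l where "l = ((1 + \<rho>) / 2) powr (1 / a)"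
  have l: "0 < l" "l < 1"
  proof -
    have "((1 + \<rho>) / 2) powr (1 / a) < 1 powr (1 / a)" using \<rho> a by (intro powr_less_mono2) auto
    thus "l < 1" by (simp add: l_def)
  qed (use \<rho> in \<open>simp add: l_def\<close>)
  have l_powr: "l powr - a = 2 / (1 + \<rho>)"
    using a \<rho> by (simp add: l_def powr_powr powr_minus_divide)
  \<comment> \<open>The sum of (1 + \<rho>) / 2 from the rescaled tails and (1 - \<rho>) / 4 from
    the error term.\<close>
  define \<theta> where "\<theta> = (3 + \<rho>) / 4"
  have \<theta>: "0 < \<theta>" "\<theta> < 1" using \<rho> by (auto simp: \<theta>_def)
  have coef: "\<rho> * l powr - a + (1 - \<rho>) / 4 \<le> \<theta>"
  proof -
    have "0 \<le> (1 - \<rho>)\<^sup>2" by simp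
    hence "\<rho> * 2 * 2 \<le> (1 + \<rho>) * (1 + \<rho>)" by (simp add: power2_eq_square algebra_simps)
    hence "\<rho> * (2 / (1 + \<rho>)) \<le> (1 + \<rho>) / 2" using \<rho> by (simp add: field_simps)
    moreover have "z + (1 - \<rho>) / 4 \<le> (3 + \<rho>) / 4" if "z \<le> (1 + \<rho>) / 2" for z
      using that by (simp add: field_simps)
    ultimately show ?thesis unfolding l_powr \<theta>_def by blast
  qed
  \<comment> \<open>The factor W of the dominator turns this into (1 - \<rho>) / 4.\<close>
  define \<kappa> where "\<kappa> = (1 - \<rho>) / (4 * W)"
  have \<kappa>: "\<kappa> > 0" using \<rho> W_ge_1 by (simp add: \<kappa>_def)
  obtain C where C: "C > 0" "\<forall>\<^sub>F x in at_top. \<forall>i.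
    prob (heavy i (\<lambda>k. r k + 1 / 2) ((1 - 1 / 2) * x)) \<le> C * G x"
    using weighted_tail_bounded[of "1 - 1 / 2" "\<lambda>k. r k + 1 / 2"] r_nonneg by (auto simp: add_nonneg_pos less_imp_le)
  have "\<forall>\<^sub>F x in at_top. \<forall>i. H i x \<le>
    prob (heavy i (\<lambda>k. r k + 1 / 2) ((1 - 1 / 2) * x))
    + (\<Sum>k\<in>UNIV. m i k * H k ((1 - (1 - l)) * x)) + \<kappa> * dominator x"
    using l index_pos \<kappa> by (intro eventually_all_finite upper_recursion[OF dominator]) auto
  with C(2) have "\<forall>\<^sub>F x in at_top. \<forall>i. H i x \<le> C * G x + (\<Sum>k\<in>UNIV. m i k * H k (l * x)) + \<kappa> * dominator x"
  proof eventually_elim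
    case (elim x)
    show ?case
    proof
      fix i show "H i x \<le> C * G x + (\<Sum>k\<in>UNIV. m i k * H k (l * x)) + \<kappa> * dominator x"
        using elim(1)[rule_format, of i] elim(2)[rule_format, of i] by simp
    qed
  qed
  then obtain x2 where x2: "\<And>x i. x \<ge> x2 \<Longrightarrow> H i x \<le> C * G x + (\<Sum>k\<in>UNIV. m i k * H k (l * x)) + \<kappa> * dominator x"
    by (auto simp: eventually_at_top_linorder)
  define x0 where "x0 = max x1 x2"
  have x0: "x0 > 0" "x1 \<le> x0" "x2 \<le> x0" using potter by (auto simp: x0_def)
  have rec: "x powr a * relH x \<le> C * (x powr a * G x) + \<theta> * envelope x" if "x \<ge> x0" for x
  proof -
    have x: "x > 0" "x \<ge> x2" using that x0 by auto
    have e1: "envelope x \<ge> 1" using envelope_ge_1 x by simp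
    have "relH x \<le> C * G x + \<rho> * relH (l * x) + \<kappa> * dominator x"
    proof (rule relH_leI)
      fix i
      have "(\<Sum>k\<in>UNIV. m i k * H k (l * x)) \<le> (\<Sum>k\<in>UNIV. m i k * (w $ k * relH (l * x)))"
        by (intro sum_mono mult_left_mono H_le_relH m_nonneg)
      also have "\<dots> = (\<Sum>k\<in>UNIV. m i k * w $ k) * relH (l * x)" by (simp add: sum_distrib_right mult.assoc)
      also have "\<dots> \<le> \<rho> * w $ i * relH (l * x)" by (intro mult_right_mono sum_m_w_le relH_nonneg)
      finally have "H i x \<le> C * G x + \<rho> * w $ i * relH (l * x) + \<kappa> * dominator x"
        using x2[OF x(2), of i] by linarith
      also have "\<dots> \<le> w $ i * (C * G x) + \<rho> * w $ i * relH (l * x) + w $ i * (\<kappa> * dominator x)"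
      proof -
        have "1 * (C * G x) \<le> w $ i * (C * G x)" using w_ge_1 C(1) G_nonneg by (intro mult_right_mono) auto
        moreover have "1 * (\<kappa> * dominator x) \<le> w $ i * (\<kappa> * dominator x)"
          using w_ge_1 \<kappa> W_ge_1 e1 by (intro mult_right_mono) (auto simp: dominator_def)
        ultimately show ?thesis by linarith
      qed
      also have "\<dots> = w $ i * (C * G x + \<rho> * relH (l * x) + \<kappa> * dominator x)" by (simp add: algebra_simps)
      finally show "H i x \<le> w $ i * (C * G x + \<rho> * relH (l * x) + \<kappa> * dominator x)" .
    qed
    also have "\<rho> * relH (l * x) \<le> \<rho> * ((l * x) powr - a * envelope x)"
    proof -
      have "relH (l * x) \<le> (l * x) powr - a * envelope (l * x)"
        unfolding a_def using l x by (intro relH_le_powr_envelope) auto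
      also have "\<dots> \<le> (l * x) powr - a * envelope x"
        using l x by (intro mult_left_mono envelope_mono) auto
      finally show ?thesis using \<rho> by (intro mult_left_mono)
    qed
    hence "C * G x + \<rho> * relH (l * x) + \<kappa> * dominator x
        \<le> C * G x + \<rho> * ((l * x) powr - a * envelope x) + \<kappa> * dominator x" by simp
    finally have "x powr a * relH x \<le> x powr a * (C * G x + \<rho> * ((l * x) powr - a * envelope x) + \<kappa> * dominator x)"
      by (intro mult_left_mono) auto
    also have "\<dots> = C * (x powr a * G x) + (x powr a * x powr - a) * (\<rho> * l powr - a + \<kappa> * W) * envelope x"
      using l x unfolding dominator_def a_def[symmetric] by (simp add: powr_mult algebra_simps)
    also have "x powr a * x powr - a = 1" using x by (simp flip: powr_add)
    also have "\<kappa> * W = (1 - \<rho>) / 4" using W_ge_1 by (simp add: \<kappa>_def)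
    also have "1 * (\<rho> * l powr - a + (1 - \<rho>) / 4) * envelope x \<le> \<theta> * envelope x"
      using coef e1 by (simp add: mult_right_mono)
    finally show ?thesis by simp
  qed
  \<comment> \<open>The first part converts the constant 1 + x0^a, which comes from arguments below
    x0, into a multiple of x^a G(x) by Potter's bound between x0 and x; the second comes from the
    heavy term.\<close>
  define D where "D = (1 + x0 powr a) / (x0 powr a * G x0) * Cp + C * Cp"
  have D0: "D > 0"
  proof -
    have "0 \<le> (1 + x0 powr a) / (x0 powr a * G x0) * Cp"
      using potter(1) G_nonneg[of x0] by (intro mult_nonneg_nonneg divide_nonneg_nonneg add_nonneg_nonneg) auto
    moreover have "0 < C * Cp" using C(1) potter(1) by simp
    ultimately show ?thesis unfolding D_def by linarith
  qed
  have main: "envelope x * (1 - \<theta>) \<le> D * (x powr a * G x)" if "x \<ge> x0" for x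
  proof -
    have x: "x > 0" using that x0 by auto
    have "envelope x \<le> 1 + (x0 powr a + C * Cp * (x powr a * G x) + \<theta> * envelope x)"
    proof (rule envelope_leI)
      fix u assume u: "0 \<le> u" "u \<le> x"
      show "u powr (\<alpha> + 1) * relH u \<le> x0 powr a + C * Cp * (x powr a * G x) + \<theta> * envelope x"
        unfolding a_def[symmetric]
      proof (cases "u \<ge> x0")
        case True
        have "C * (u powr a * G u) \<le> C * (Cp * (x powr a * G x))"
          using potter(3)[of u x] True u x0 C unfolding a_def by (intro mult_left_mono) auto
        moreover have "\<theta> * envelope u \<le> \<theta> * envelope x" using u \<theta> by (intro mult_left_mono envelope_mono) auto
        moreover have "0 \<le> x0 powr a" by simp
        ultimately show "u powr a * relH u \<le> x0 powr a + C * Cp * (x powr a * G x) + \<theta> * envelope x"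
          using rec[OF True] by (simp only: mult.assoc)
      next
        case False
        have "u powr a * relH u \<le> x0 powr a * 1"
          using u False a relH_le_1 relH_nonneg by (intro mult_mono powr_mono2) auto
        moreover have "0 \<le> C * Cp * (x powr a * G x)" using C potter G_nonneg by (simp add: less_imp_le)
        moreover have "0 \<le> \<theta> * envelope x" using \<theta> envelope_ge_1[of x] x by simp
        ultimately show "u powr a * relH u \<le> x0 powr a + C * Cp * (x powr a * G x) + \<theta> * envelope x" by linarith
      qed
    qed (use x in auto)
    moreover have "1 + x0 powr a \<le> (1 + x0 powr a) / (x0 powr a * G x0) * Cp * (x powr a * G x)"
    proof -
      have p: "x0 powr a * G x0 > 0" using x0 pos by simp
      have "(1 + x0 powr a) / (x0 powr a * G x0) * (x0 powr a * G x0)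
          \<le> (1 + x0 powr a) / (x0 powr a * G x0) * (Cp * (x powr a * G x))"
        using potter(3)[of x0 x] x0 that p unfolding a_def by (intro mult_left_mono) auto
      moreover have "(1 + x0 powr a) / (x0 powr a * G x0) * (x0 powr a * G x0) = 1 + x0 powr a"
        by (rule nonzero_eq_divide_eq[THEN iffD1, OF _ refl]) (use p in linarith)
      ultimately show ?thesis by (simp only: mult.assoc)
    qed
    ultimately show ?thesis unfolding D_def by (simp add: algebra_simps)
  qed
  show ?thesis
  proof (rule that)
    show "W * D / (1 - \<theta>) > 0" using W_ge_1 D0 \<theta> by simp
    show "\<forall>\<^sub>F x in at_top. dominator x \<le> W * D / (1 - \<theta>) * G x"
      using eventually_ge_at_top[of x0]
    proof eventually_elim
      case (elim x)
      hence x: "x > 0" using x0 by simp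
      have "envelope x \<le> D * (x powr a * G x) / (1 - \<theta>)" using main[OF elim] \<theta> by (simp add: pos_le_divide_eq)
      hence "dominator x \<le> W * x powr - a * (D * (x powr a * G x) / (1 - \<theta>))"
        unfolding dominator_def a_def[symmetric] using W_ge_1 by (intro mult_left_mono) auto
      also have "\<dots> = (x powr - a * x powr a) * (W * D / (1 - \<theta>) * G x)" by simp
      also have "x powr - a * x powr a = 1" using x by (simp flip: powr_add)
      finally show ?case by simp
    qed
  qed
qed

section \<open>Upper and lower limits of the tail ratios, squeezed onto the linear system\<close>

context
  fixes d :: "'k \<Rightarrow> real"
  assumes d: "\<And>i. d i = c i (coeffs 1 r) + (\<Sum>k\<in>UNIV. m i k * d k)"
begin

text \<open>With the fixed point d as centre, the affine map acts on a displacement t w through its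
  linear part alone.\<close>

lemma sum_m_d_w: "c i (coeffs 1 r) + (\<Sum>k\<in>UNIV. m i k * (d k + t * w $ k)) = d i + t * (\<Sum>k\<in>UNIV. m i k * w $ k)"
  using d[of i] by (simp add: distrib_left sum.distrib sum_distrib_left mult_ac)

definition "upper t \<longleftrightarrow> (\<forall>i. \<forall>\<^sub>F x in at_top. H i x / G x \<le> d i + t * w $ i)"
definition "lower t \<longleftrightarrow> (\<forall>i. \<forall>\<^sub>F x in at_top. d i - t * w $ i \<le> H i x / G x)"

text \<open>Divide the upper recursion by G and insert the bound d + t w for the tails on its right.
  As the perturbation vanishes, the right-hand side tends to d + t M w <= d + \<rho> t w. The a
  priori bound keeps dominator / G bounded, so its small coefficient removes it.\<close>

lemma upper_step:
  assumes t: "t \<ge> 0" "upper t" and t': "\<rho> * t < t'"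
  shows "upper t'"
  unfolding upper_def
proof
  fix i
  obtain C where C: "C > 0" "\<forall>\<^sub>F x in at_top. dominator x \<le> C * G x" using dominator_bigo .
  \<comment> \<open>The double successor keeps e n below 1, so the scale 1 - e n is
    positive.\<close>
  define e where "e n = inverse (real (Suc (Suc n)))" for n
  have e: "0 < e n" "e n < 1" for n by (auto simp: e_def field_simps)
  have e_lim: "e \<longlonglongrightarrow> 0" unfolding e_def using LIMSEQ_Suc[OF LIMSEQ_inverse_real_of_nat] .
  define A where "A n = coeffs (1 / (1 - e n)) (\<lambda>k. (r k + e n) / (1 - e n))" for n
  \<comment> \<open>The limiting bound, as x grows, when all three perturbation parameters of
    \<open>upper_recursion\<close> equal e n.\<close>
  define B where "B n = c i (A n) + (\<Sum>k\<in>UNIV. m i k * ((d k + t * w $ k) * (1 - e n) powr - \<alpha>)) + e n * C" for n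
  have cA: "(\<lambda>n. c i (A n)) \<longlonglongrightarrow> c i (coeffs 1 r)"
  proof (rule c_limit)
    fix j show "(\<lambda>n. A n $ j) \<longlonglongrightarrow> coeffs 1 r $ j"
    proof (cases j)
      case None
      have "(\<lambda>n. 1 / (1 - e n)) \<longlonglongrightarrow> 1 / (1 - 0)" by (intro tendsto_intros e_lim) auto
      thus ?thesis using None by (simp add: A_def coeffs_def)
    next
      case (Some k)
      have "(\<lambda>n. (r k + e n) / (1 - e n)) \<longlonglongrightarrow> (r k + 0) / (1 - 0)" by (intro tendsto_intros e_lim) auto
      thus ?thesis using Some by (simp add: A_def coeffs_def)
    qed
    fix n show "A n $ j \<ge> 0" using e[of n] r_nonneg
      by (cases j) (auto simp: A_def coeffs_def intro!: divide_nonneg_pos add_nonneg_nonneg less_imp_le[OF e(1)])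
  qed
  have "B \<longlonglongrightarrow> c i (coeffs 1 r) + (\<Sum>k\<in>UNIV. m i k * ((d k + t * w $ k) * (1 - 0) powr - \<alpha>)) + 0 * C"
    unfolding B_def by (intro tendsto_intros e_lim cA) auto
  hence lim: "B \<longlonglongrightarrow> d i + t * (\<Sum>k\<in>UNIV. m i k * w $ k)" using sum_m_d_w[of i t] by simp
  have "t * (\<Sum>k\<in>UNIV. m i k * w $ k) \<le> t * (\<rho> * w $ i)" using t by (intro mult_left_mono sum_m_w_le)
  also have "\<dots> = \<rho> * t * w $ i" by simp
  also have "\<dots> < t' * w $ i" using t' w_ge_1[of i] by (intro mult_strict_right_mono) auto
  finally have "d i + t * (\<Sum>k\<in>UNIV. m i k * w $ k) < d i + t' * w $ i" by simp
  from order_tendstoD(2)[OF lim this] obtain n where n: "B n < d i + t' * w $ i"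
    using eventually_happens'[OF sequentially_bot] by blast
  let ?P = "\<lambda>x. prob (heavy i (\<lambda>k. r k + e n) ((1 - e n) * x))"
  have "((\<lambda>x. ?P x / G x + (\<Sum>k\<in>UNIV. m i k * ((d k + t * w $ k) * (G ((1 - e n) * x) / G x))) + e n * C) \<longlongrightarrow> B n) at_top"
    unfolding B_def A_def using e[of n] r_nonneg
    by (intro tendsto_intros weighted_tail_coeffs scale) (auto intro: add_nonneg_nonneg less_imp_le)
  hence ev1: "\<forall>\<^sub>F x in at_top. ?P x / G x + (\<Sum>k\<in>UNIV. m i k * ((d k + t * w $ k) * (G ((1 - e n) * x) / G x))) + e n * C < d i + t' * w $ i"
    using n by (rule order_tendstoD)
  have ev2: "\<forall>\<^sub>F x in at_top. H i x \<le> ?P x + (\<Sum>k\<in>UNIV. m i k * H k ((1 - e n) * x)) + e n * dominator x"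
    using e[of n] index_pos by (intro upper_recursion[OF dominator]) auto
  have f: "filterlim (\<lambda>x. (1 - e n) * x) at_top at_top"
    using filterlim_tendsto_pos_mult_at_top[OF tendsto_const _ filterlim_ident, of "1 - e n"] e[of n] by simp
  have "\<forall>\<^sub>F x in at_top. \<forall>k. H k x / G x \<le> d k + t * w $ k"
    using t(2) unfolding upper_def by (intro eventually_all_finite) blast
  from eventually_compose_filterlim[OF this f]
  have ev3: "\<forall>\<^sub>F x in at_top. \<forall>k. H k ((1 - e n) * x) / G ((1 - e n) * x) \<le> d k + t * w $ k" .
  show "\<forall>\<^sub>F x in at_top. H i x / G x \<le> d i + t' * w $ i"
    using ev1 ev2 ev3 C(2)
  proof eventually_elim
    case (elim x)
    have "H i x / G x \<le> (?P x + (\<Sum>k\<in>UNIV. m i k * H k ((1 - e n) * x)) + e n * dominator x) / G x"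
      by (rule divide_G_mono[OF elim(2)])
    also have "\<dots> = ?P x / G x + (\<Sum>k\<in>UNIV. m i k * (H k ((1 - e n) * x) / G x)) + e n * (dominator x / G x)"
      by (simp add: add_divide_distrib sum_divide_distrib)
    also have "\<dots> \<le> ?P x / G x + (\<Sum>k\<in>UNIV. m i k * ((d k + t * w $ k) * (G ((1 - e n) * x) / G x))) + e n * C"
    proof (intro add_mono order.refl sum_mono mult_left_mono m_nonneg)
      fix k
      have "H k ((1 - e n) * x) \<le> (d k + t * w $ k) * G ((1 - e n) * x)"
        using elim(3)[rule_format, of k] pos[of "(1 - e n) * x"] by (simp add: pos_divide_le_eq)
      thus "H k ((1 - e n) * x) / G x \<le> (d k + t * w $ k) * (G ((1 - e n) * x) / G x)"
        using divide_G_mono by fastforce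
      show "dominator x / G x \<le> C" using elim(4) pos[of x] by (simp add: pos_divide_le_eq)
    qed (use e[of n] in auto)
    finally show ?case using elim(1) by linarith
  qed
qed

lemma upper_all:
  assumes "\<tau> > 0" shows "upper \<tau>"
proof -
  obtain C where C: "C > 0" "\<forall>\<^sub>F x in at_top. dominator x \<le> C * G x" using dominator_bigo .
  \<comment> \<open>The starting error: the a priori bound gives ratios at most C, and w >= 1 makes
    t0 w cover every gap C - d i.\<close>
  define t0 where "t0 = Max (range (\<lambda>i. \<bar>C - d i\<bar>))"
  have t0: "\<bar>C - d i\<bar> \<le> t0" for i unfolding t0_def by simp
  have "t0 \<ge> 0" using t0[of undefined] by linarith
  have "upper t0" unfolding upper_def
  proof
    fix i
    show "\<forall>\<^sub>F x in at_top. H i x / G x \<le> d i + t0 * w $ i"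
      using C(2) eventually_gt_at_top[of 0]
    proof eventually_elim
      case (elim x)
      have "H i x \<le> C * G x" using tail_dominatorD(1)[OF dominator elim(2), of i] elim(1) by linarith
      hence "H i x / G x \<le> C" using pos[of x] by (simp add: pos_divide_le_eq)
      also have "\<dots> \<le> d i + t0 * 1" using t0[of i] by simp
      also have "\<dots> \<le> d i + t0 * w $ i" using w_ge_1 \<open>t0 \<ge> 0\<close> by (intro add_left_mono mult_left_mono)
      finally show ?case .
    qed
  qed
  show ?thesis
    by (rule contraction_to_zero[where P = upper, OF \<rho> \<open>t0 \<ge> 0\<close> \<open>upper t0\<close> upper_step assms])
qed

text \<open>The counterpart of \<open>upper_step\<close> with the lower recursion. The a priori
  upper bound is used here as well: it reduces the Bonferroni term h^2 / G to a multiple of h, which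
  tends to 0.\<close>

lemma lower_step:
  assumes t: "t \<ge> 0" "lower t" and t': "\<rho> * t < t'"
  shows "lower t'"
  unfolding lower_def
proof
  fix i
  obtain C where C: "C > 0" "\<forall>\<^sub>F x in at_top. dominator x \<le> C * G x" using dominator_bigo .
  define e where "e n = inverse (real (Suc n))" for n
  have e: "0 < e n" for n by (auto simp: e_def)
  have e_lim: "e \<longlonglongrightarrow> 0" unfolding e_def by (rule LIMSEQ_inverse_real_of_nat)
  \<comment> \<open>Clipping at 0 yields exactly the admissible values of
    \<open>lower_recursion\<close>: zero, or strictly below the mean.\<close>
  define \<sigma> where "\<sigma> n k = max 0 (r k - e n)" for n k
  have \<sigma>: "0 \<le> \<sigma> n k" "\<sigma> n k = 0 \<or> \<sigma> n k < r k" for n k using e[of n] by (auto simp: \<sigma>_def max_def)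
  define A where "A n = coeffs (1 / (1 + e n)) (\<lambda>k. \<sigma> n k / (1 + e n))" for n
  \<comment> \<open>The ratios H / G are non-negative, so the positive part is still a lower bound,
    and non-negativity lets it multiply estimates of probabilities.\<close>
  define y where "y k = max 0 (d k - t * w $ k)" for k
  have y: "y k \<ge> 0" for k by (simp add: y_def)
  \<comment> \<open>The index n plays two roles: it fixes the perturbation e n and truncates the
    numbers of summands.\<close>
  define B where "B n = c i (A n) + (\<Sum>k\<in>UNIV. expectation (\<lambda>\<omega>. real (min (N i k \<omega>) n)) * y k)" for n
  have cA: "(\<lambda>n. c i (A n)) \<longlonglongrightarrow> c i (coeffs 1 r)"
  proof (rule c_limit)
    fix j show "(\<lambda>n. A n $ j) \<longlonglongrightarrow> coeffs 1 r $ j"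
    proof (cases j)
      case None
      have "(\<lambda>n. 1 / (1 + e n)) \<longlonglongrightarrow> 1 / (1 + 0)" by (intro tendsto_intros e_lim) auto
      thus ?thesis using None by (simp add: A_def coeffs_def)
    next
      case (Some k)
      have "(\<lambda>n. \<sigma> n k / (1 + e n)) \<longlonglongrightarrow> max 0 (r k - 0) / (1 + 0)"
        unfolding \<sigma>_def by (intro tendsto_intros e_lim) auto
      thus ?thesis using Some r_nonneg[of k] by (simp add: A_def coeffs_def)
    qed
    fix n show "A n $ j \<ge> 0" using e[of n] \<sigma>(1)
      by (cases j) (auto simp: A_def coeffs_def intro!: divide_nonneg_pos)
  qed
  have EN: "(\<lambda>n. expectation (\<lambda>\<omega>. real (min (N i k \<omega>) n))) \<longlonglongrightarrow> m i k" for k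
      unfolding m_def
    proof (rule integral_dominated_convergence[where w = "\<lambda>\<omega>. real (N i k \<omega>)"])
      show "AE \<omega> in M. (\<lambda>n. real (min (N i k \<omega>) n)) \<longlonglongrightarrow> real (N i k \<omega>)"
      proof (intro AE_I2 tendsto_eventually)
        fix \<omega> show "\<forall>\<^sub>F n in sequentially. real (min (N i k \<omega>) n) = real (N i k \<omega>)"
          using eventually_ge_at_top[of "N i k \<omega>"] by eventually_elim simp
      qed
    qed (auto simp: N_int)
  have "B \<longlonglongrightarrow> c i (coeffs 1 r) + (\<Sum>k\<in>UNIV. m i k * y k)"
    unfolding B_def by (intro tendsto_intros cA EN)
  moreover have "d i - t' * w $ i < c i (coeffs 1 r) + (\<Sum>k\<in>UNIV. m i k * y k)"
  proof -
    have "\<rho> * t * w $ i < t' * w $ i" using t' w_ge_1[of i] by (intro mult_strict_right_mono) auto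
    moreover have "t * (\<Sum>k\<in>UNIV. m i k * w $ k) \<le> t * (\<rho> * w $ i)" using t by (intro mult_left_mono sum_m_w_le)
    moreover have "(\<Sum>k\<in>UNIV. m i k * (d k + (- t) * w $ k)) \<le> (\<Sum>k\<in>UNIV. m i k * y k)"
      by (intro sum_mono mult_left_mono m_nonneg) (auto simp: y_def)
    ultimately show ?thesis using sum_m_d_w[of i "- t"] by (simp add: mult_ac)
  qed
  ultimately have "\<forall>\<^sub>F n in sequentially. d i - t' * w $ i < B n" by (rule order_tendstoD)
  then obtain n where n: "d i - t' * w $ i < B n"
    using eventually_happens'[OF sequentially_bot] by blast
  obtain s where s: "\<And>k. s k > 0" "lower_estimate i (\<sigma> n) (e n) s"
    using lower_recursion[of "\<sigma> n" "e n" i] \<sigma> e by blast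
  let ?A = "\<lambda>x. heavy i (\<sigma> n) ((1 + e n) * x)"
  define E where "E x = (\<Sum>k\<in>UNIV. exp (- s k * x))" for x
  define p where "p k j = prob {\<omega> \<in> space M. N i k \<omega> \<ge> j}" for k j
  \<comment> \<open>The lower estimate divided by G x, with each tail ratio replaced by y and the
    Bonferroni term by its a priori bound. Its limit in x is B n.\<close>
  define b where "b x = prob (?A x) / G x * (1 - E x) + (\<Sum>k\<in>UNIV. \<Sum>j=1..n. (p k j - prob (?A x)) * y k)
      - (CARD('k) * n)\<^sup>2 * (CARD('k) * C * h x)" for x
  have "(E \<longlongrightarrow> 0) at_top"
    unfolding E_def
  proof (intro tendsto_null_sum)
    fix k
    have "filterlim (\<lambda>x. s k * x) at_top at_top"
      using filterlim_tendsto_pos_mult_at_top[OF tendsto_const s(1) filterlim_ident] .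
    from filterlim_compose[OF exp_at_bot filterlim_compose[OF filterlim_uminus_at_bot_at_top this]]
    show "((\<lambda>x. exp (- s k * x)) \<longlongrightarrow> 0) at_top" by simp
  qed
  moreover have "((\<lambda>x. prob (?A x) / G x) \<longlongrightarrow> c i (A n)) at_top"
    unfolding A_def using e[of n] \<sigma>(1) by (intro weighted_tail_coeffs) auto
  moreover have "((\<lambda>x. prob (?A x)) \<longlongrightarrow> 0) at_top"
  proof -
    have f: "filterlim (\<lambda>x. (1 + e n) * x) at_top at_top"
      using filterlim_tendsto_pos_mult_at_top[OF tendsto_const _ filterlim_ident, of "1 + e n"] e[of n] by simp
    have "(\<lambda>\<omega>. Q i \<omega> + (\<Sum>k\<in>UNIV. \<sigma> n k * N i k \<omega>)) \<in> borel_measurable M" by measurable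
    from filterlim_compose[OF prob_gt_tendsto_0[OF this] f] show ?thesis unfolding heavy_def .
  qed
  ultimately have "(b \<longlongrightarrow> c i (A n) * (1 - 0) + (\<Sum>k\<in>UNIV. \<Sum>j=1..n. (p k j - 0) * y k)
      - (CARD('k) * n)\<^sup>2 * (CARD('k) * C * 0)) at_top"
    unfolding b_def by (intro tendsto_intros h_tendsto_0)
  also have "c i (A n) * (1 - 0) + (\<Sum>k\<in>UNIV. \<Sum>j=1..n. (p k j - 0) * y k)
      - (CARD('k) * n)\<^sup>2 * (CARD('k) * C * 0) = B n"
    unfolding B_def p_def by (simp add: sum_prob_ge[OF N_rv, symmetric] sum_distrib_right)
  finally have ev1: "\<forall>\<^sub>F x in at_top. d i - t' * w $ i < b x" using n by (rule order_tendstoD)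
  have ev2: "\<forall>\<^sub>F x in at_top. \<forall>k. y k \<le> H k x / G x"
  proof (rule eventually_all_finite)
    fix k
    have "\<forall>\<^sub>F x in at_top. d k - t * w $ k \<le> H k x / G x" using t(2) unfolding lower_def by blast
    thus "\<forall>\<^sub>F x in at_top. y k \<le> H k x / G x"
      by eventually_elim (simp add: y_def H_nonneg G_nonneg)
  qed
  show "\<forall>\<^sub>F x in at_top. d i - t' * w $ i \<le> H i x / G x"
    using ev1 ev2 C(2) eventually_gt_at_top[of 0]
  proof eventually_elim
    case (elim x)
    have "b x \<le> (prob (?A x) * (1 - E x)
        + (\<Sum>k\<in>UNIV. \<Sum>j=1..n. prob ({\<omega> \<in> space M. N i k \<omega> \<ge> j} - ?A x) * H k x)
        - (CARD('k) * n)\<^sup>2 * (h x)\<^sup>2) / G x"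
      unfolding b_def diff_divide_distrib add_divide_distrib sum_divide_distrib
    proof (intro diff_mono add_mono sum_mono)
      fix k j
      have "p k j - prob (?A x) \<le> prob ({\<omega> \<in> space M. N i k \<omega> \<ge> j} - ?A x)"
      proof -
        have "p k j \<le> prob (({\<omega> \<in> space M. N i k \<omega> \<ge> j} - ?A x) \<union> ?A x)"
          unfolding p_def by (intro finite_measure_mono) auto
        also have "\<dots> \<le> prob ({\<omega> \<in> space M. N i k \<omega> \<ge> j} - ?A x) + prob (?A x)"
          by (intro measure_Un_le) measurable
        finally show ?thesis by simp
      qed
      hence "(p k j - prob (?A x)) * y k \<le> prob ({\<omega> \<in> space M. N i k \<omega> \<ge> j} - ?A x) * y k"
        using y by (intro mult_right_mono)
      also have "\<dots> \<le> prob ({\<omega> \<in> space M. N i k \<omega> \<ge> j} - ?A x) * (H k x / G x)"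
        using elim(2) by (intro mult_left_mono) auto
      finally show "(p k j - prob (?A x)) * y k \<le> prob ({\<omega> \<in> space M. N i k \<omega> \<ge> j} - ?A x) * H k x / G x" by simp
    next
      have "h x \<le> (\<Sum>k\<in>(UNIV :: 'k set). C * G x)" unfolding h_def
        using tail_dominatorD(1)[OF dominator elim(4)] elim(3) by (intro sum_mono) (auto intro: order.trans)
      hence "h x / G x \<le> CARD('k) * C" using pos[of x] by (simp add: pos_divide_le_eq mult.assoc)
      hence "h x / G x * h x \<le> CARD('k) * C * h x" using h_nonneg by (rule mult_right_mono)
      hence "(CARD('k) * n)\<^sup>2 * (h x / G x * h x) \<le> (CARD('k) * n)\<^sup>2 * (CARD('k) * C * h x)"
        by (rule mult_left_mono) simp
      thus "(CARD('k) * n)\<^sup>2 * (h x)\<^sup>2 / G x \<le> (CARD('k) * n)\<^sup>2 * (CARD('k) * C * h x)"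
        by (simp add: power2_eq_square)
    qed auto
    also have "\<dots> \<le> H i x / G x"
      using s(2)[unfolded lower_estimate_def, rule_format, OF elim(4), of n]
      unfolding E_def by (rule divide_G_mono)
    finally show ?case using elim(1) by linarith
  qed
qed

lemma lower_all:
  assumes "\<tau> > 0" shows "lower \<tau>"
proof -
  define t0 where "t0 = Max (range (\<lambda>i. \<bar>d i\<bar>))"
  have t0: "\<bar>d i\<bar> \<le> t0" for i unfolding t0_def by simp
  have "t0 \<ge> 0" using t0[of undefined] by linarith
  have "lower t0" unfolding lower_def
  proof (intro allI always_eventually)
    fix i x
    have "d i \<le> t0 * 1" using t0[of i] by simp
    also have "\<dots> \<le> t0 * w $ i" using w_ge_1 \<open>t0 \<ge> 0\<close> by (intro mult_left_mono)
    finally have "d i - t0 * w $ i \<le> 0" by simp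
    also have "0 \<le> H i x / G x" using H_nonneg G_nonneg by simp
    finally show "d i - t0 * w $ i \<le> H i x / G x" .
  qed
  show ?thesis
    by (rule contraction_to_zero[where P = lower, OF \<rho> \<open>t0 \<ge> 0\<close> \<open>lower t0\<close> lower_step assms])
qed

theorem tail_asymptotics: "((\<lambda>x. H i x / G x) \<longlongrightarrow> d i) at_top"
proof (rule order_tendstoI)
  have w: "w $ i > 0" using w_ge_1[of i] by linarith
  fix y
  {
    assume "d i < y"
    define \<tau> where "\<tau> = (y - d i) / (2 * w $ i)"
    have "\<tau> > 0" using \<open>d i < y\<close> w by (simp add: \<tau>_def)
    have "\<tau> * w $ i = (y - d i) / 2" using w by (simp add: \<tau>_def)
    hence "d i + \<tau> * w $ i < y" using \<open>d i < y\<close> by simp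
    moreover have "\<forall>\<^sub>F x in at_top. H i x / G x \<le> d i + \<tau> * w $ i"
      using upper_all[OF \<open>\<tau> > 0\<close>] by (simp add: upper_def)
    ultimately show "\<forall>\<^sub>F x in at_top. H i x / G x < y" by (auto elim: eventually_mono)
  next
    assume "y < d i"
    define \<tau> where "\<tau> = (d i - y) / (2 * w $ i)"
    have "\<tau> > 0" using \<open>y < d i\<close> w by (simp add: \<tau>_def)
    have "\<tau> * w $ i = (d i - y) / 2" using w by (simp add: \<tau>_def)
    hence "y < d i - \<tau> * w $ i" using \<open>y < d i\<close> by simp
    moreover have "\<forall>\<^sub>F x in at_top. d i - \<tau> * w $ i \<le> H i x / G x"
      using lower_all[OF \<open>\<tau> > 0\<close>] by (simp add: lower_def)
    ultimately show "\<forall>\<^sub>F x in at_top. y < H i x / G x" by (auto elim: eventually_mono)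
  }
qed

end

end

section \<open>Assembly of the linear-algebra, regular-variation and branching parts\<close>

theorem theorem3p2:
  fixes M :: "'a measure"
    and Q :: "'k::finite \<Rightarrow> 'a \<Rightarrow> real"
    and N :: "'k \<Rightarrow> 'k \<Rightarrow> 'a \<Rightarrow> nat"
    and Rm :: "'k \<Rightarrow> nat \<Rightarrow> 'a \<Rightarrow> real"
    and R :: "'k \<Rightarrow> 'a \<Rightarrow> real"
    and F :: "real measure" and \<alpha> :: real
    and b :: "'k \<Rightarrow> real" and \<mu> :: "'k \<Rightarrow> (real ^ 'k option) measure"
  defines "V \<equiv> \<lambda>i \<omega>. (\<chi> j. case j of None \<Rightarrow> Q i \<omega> | Some k \<Rightarrow> real (N i k \<omega>)) :: real ^ 'k option"
    and "m \<equiv> \<lambda>i k. prob_space.expectation M (\<lambda>\<omega>. real (N i k \<omega>))"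
    and "rbar \<equiv> \<lambda>i. prob_space.expectation M (R i)"
    and "c \<equiv> \<lambda>i (a :: real ^ 'k option). if b i = 0 then 0
               else b i * (\<integral>\<theta>. (\<Sum>j\<in>UNIV. a $ j * \<theta> $ j) powr \<alpha> \<partial>(\<mu> i))"
  assumes M: "prob_space M"
    and Q_rv: "\<And>i. Q i \<in> borel_measurable M"
    and Q_nonneg: "\<And>i \<omega>. \<omega> \<in> space M \<Longrightarrow> Q i \<omega> \<ge> 0"
    and N_rv: "\<And>i k. N i k \<in> measurable M (count_space UNIV)"
    and N_int: "\<And>i k. integrable M (\<lambda>\<omega>. real (N i k \<omega>))"
    and spec: "spectral_radius (\<chi> i k. m i k) < 1"
    and F: "ref_tail F \<alpha>"
    and MRV: "\<And>i. MRV F M (V i) (b i) (\<mu> i)"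
    and b_pos: "\<exists>i. b i > 0"
    and Rm_rv: "\<And>k n. Rm k n \<in> borel_measurable M"
    and Rm_indep: "prob_space.indep_vars M (\<lambda>_. borel) (\<lambda>p. Rm (fst p) (snd p)) UNIV"
    and V_Rm_indep: "\<And>i. prob_space.indep_set M
           (sets (vimage_algebra (space M) (V i) borel))
           (sets (vimage_algebra (space M) (\<lambda>\<omega> p. Rm (fst p) (snd p) \<omega>)
                    (Pi\<^sub>M UNIV (\<lambda>_. borel))))"
    and Rm_distr: "\<And>k n. distr M borel (Rm k n) = distr M borel (R k)"
    and R_rv: "\<And>i. R i \<in> borel_measurable M"
    and R_nonneg: "\<And>i \<omega>. \<omega> \<in> space M \<Longrightarrow> R i \<omega> \<ge> 0"
    and R_int: "\<And>i. integrable M (R i)"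
    and fixpoint: "\<And>i. distr M borel (R i) =
          distr M borel (\<lambda>\<omega>. Q i \<omega> + (\<Sum>k\<in>UNIV. \<Sum>n\<in>{1..N i k \<omega>}. Rm k n \<omega>))"
  shows "\<exists>d :: 'k \<Rightarrow> real.
           (\<forall>i. tail_equiv (\<lambda>x. measure M {\<omega> \<in> space M. R i \<omega> > x}) (d i) (tail F)) \<and>
           (\<forall>d'. (\<forall>i. d' i = c i (\<chi> j. case j of None \<Rightarrow> 1 | Some k \<Rightarrow> rbar k)
                              + (\<Sum>k\<in>UNIV. m i k * d' k)) \<longleftrightarrow> d' = d)"
proof -
  interpret prob_space M by (rule M)
  have V_eq: "V i = weight_vector Q N i" for i
    by (simp add: V_def weight_vector_def fun_eq_iff)
  \<comment> \<open>Independence is stated for families of events, so it already contains that the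
    sigma-algebra generated by \<open>V i\<close> consists of events.\<close>
  have V_meas: "V i \<in> borel_measurable M" for i
  proof (rule measurableI)
    fix A :: "(real ^ 'k option) set" assume "A \<in> sets borel"
    hence "V i -` A \<inter> space M \<in> sets (vimage_algebra (space M) (V i) borel)"
      by (rule in_vimage_algebra)
    thus "V i -` A \<inter> space M \<in> events"
      using indep_setD_ev1[OF V_Rm_indep] by blast
  qed simp
  interpret regularly_varying_tail "tail F" \<alpha>
    by (rule ref_tail_regularly_varying[OF F])
  have mrv: "mrv_vector M F \<alpha> (V i) (b i) (\<mu> i)" for i
  proof unfold_locales
    fix \<omega> j assume "\<omega> \<in> space M"
    thus "V i \<omega> $ j \<ge> 0" using Q_nonneg by (simp add: V_def split: option.split)
  qed (rule MRV V_meas)+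
  obtain w :: "real ^ 'k" where w: "\<And>i. w $ i \<ge> 1"
    "\<And>i. w $ i = 1 + (\<Sum>k\<in>UNIV. (\<chi> i k. m i k) $ i $ k * w $ k)"
  proof (rule superharmonic_vector[OF _ spec])
    show "(\<chi> i k. m i k) $ i $ k \<ge> 0" for i k
      by (simp add: m_def)
  qed blast
  have c_eq: "c i v = (if b i = 0 then 0 else b i * (\<integral>\<theta>. (\<Sum>j\<in>UNIV. v $ j * \<theta> $ j) powr \<alpha> \<partial>(\<mu> i)))" for i v
    by (simp add: c_def)
  interpret bt: branching_tail M Q N Rm R "tail F" \<alpha> c w
  proof unfold_locales
    show "((\<lambda>x. measure M {\<omega> \<in> space M. (\<Sum>j\<in>UNIV. v $ j * weight_vector Q N i \<omega> $ j) > x} / tail F x)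
        \<longlongrightarrow> c i v) at_top" if "\<And>j. v $ j \<ge> 0" for i v
      using mrv_vector.weighted_tail_limit[OF mrv that, of i] unfolding c_eq V_eq .
    show "(\<lambda>n. c i (v n)) \<longlonglongrightarrow> c i v0"
      if "\<And>j. (\<lambda>n. v n $ j) \<longlonglongrightarrow> v0 $ j" "\<And>n j. v n $ j \<ge> 0" for i v v0
    proof (cases "b i = 0")
      case False
      hence "b i > 0" using mrv_vector.b_nonneg[OF mrv, of i] by simp
      from mrv_vector.angular_integral_limit[OF mrv this that] False show ?thesis
        unfolding c_eq by (auto intro!: tendsto_intros)
    qed (simp add: c_eq)
    show "w $ i = 1 + (\<Sum>k\<in>UNIV. expectation (\<lambda>\<omega>. real (N i k \<omega>)) * w $ k)" for i
      using w(2)[of i] by (simp add: m_def)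
  qed (use assms w(1) in \<open>simp_all flip: V_eq\<close>)
  let ?a = "(\<chi> j. case j of None \<Rightarrow> 1 | Some k \<Rightarrow> rbar k) :: real ^ 'k option"
  have r: "bt.r = rbar" by (rule ext) (simp add: bt.r_def rbar_def)
  have a: "bt.coeffs 1 bt.r = ?a"
    by (simp add: bt.coeffs_def r)
  have m: "bt.m = m" by (intro ext) (simp add: bt.m_def m_def)
  obtain d where d: "\<And>i. d i = c i ?a + (\<Sum>k\<in>UNIV. m i k * d k)"
    and unique: "\<And>d'. \<forall>i. d' i = c i ?a + (\<Sum>k\<in>UNIV. m i k * d' k) \<Longrightarrow> d' = d"
    using unique_affine_fixed_point[OF spec, of "\<lambda>i. c i ?a"] by (auto elim!: ex1E)
  have "((\<lambda>x. bt.H i x / tail F x) \<longlongrightarrow> d i) at_top" for i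
    by (rule bt.tail_asymptotics, unfold a m, rule d)
  hence "tail_equiv (\<lambda>x. measure M {\<omega> \<in> space M. R i \<omega> > x}) (d i) (tail F)" for i
    by (simp add: tail_equiv_iff_tendsto[OF pos] bt.H_def)
  thus ?thesis using d unique by blast
qed

end
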